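(* Let $\mathcal{P}=\{(N_{\mathsf{t}},T_{\mathsf{t}})\}_{\mathsf{t}=0}^{\mathsf{M}}$ be any time-like path, i.e., $(N_0,T_0)=(1,0)$ and for each $\mathsf{t}$ exactly one of $N_{\mathsf{t}+1}-N_{\mathsf{t}}$, $T_{\mathsf{t}+1}-T_{\mathsf{t}}$ equals $1$ and the other equals $0$. Then the joint distribution of the random variables $\{\mathfrak{h}^{\mathrm{Ber}}(N_{\mathsf{t}}+1,T_{\mathsf{t}})\}_{\mathsf{t}=0}^{\mathsf{M}}$ of the inhomogeneous stochastic higher spin six vertex model with the step Bernoulli boundary condition is the same as the joint distribution of $\{\mathbf{x}_{N_{\mathsf{t}}}(N_{\mathsf{t}},T_{\mathsf{t}})+N_{\mathsf{t}}\}_{\mathsf{t}=0}^{\mathsf{M}}$ under the mixed geometric/Bernoulli $q$-TASEP along $\mathcal{P}$ described in the context.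
   Context: Fix $q\in(0,1)$; $(z;q)_k=\prod_{i=0}^{k-1}(1-zq^i)$. Parameters: $u_1,u_2,\ldots\in(-\infty,0)$; $a_1,a_2,\ldots\in(0,\infty)$ uniformly bounded away from $0$ and $\infty$; $\nu_1=0$ and $\nu_2,\nu_3,\ldots\in(0,1)$ uniformly bounded away from $0$ and $1$; $\mathsf{c}_j:=\nu_j/a_j$ and $a_i\mathsf{c}_j<1$ for all $i,j$. Vertex weights $\mathsf{L}_{u,a,\nu}(i_1,j_1;i_2,j_2)$, $i_1,i_2\in\mathbb{Z}_{\ge0}$, $j_1,j_2\in\{0,1\}$ ($i_1,j_1$ arrows entering from below/left; $i_2,j_2$ leaving upward/right), vanish unless $i_1+j_1=i_2+j_2$, and for $g\in\mathbb{Z}_{\ge0}$: $\mathsf{L}(g,0;g,0)=\frac{1-auq^g}{1-au}$, $\mathsf{L}(g,0;g-1,1)=\frac{-au(1-q^g)}{1-au}$, $\mathsf{L}(g,1;g,1)=\frac{\nu q^g-au}{1-au}$, $\mathsf{L}(g,1;g+1,0)=\frac{1-\nu q^g}{1-au}$. The model with step Bernoulli boundary condition: random up-right paths in $\mathbb{Z}_{\ge1}^2$ (vertical edges may carry several arrows, horizontal at most one); one arrow enters each vertex $(1,T)$, $T\ge1$, from the left, none from the bottom; inductively over $N+T$, at each vertex $(N,T)$ with incoming $(i_1,j_1)$, the outgoing $(i_2,j_2)$ are sampled independently with probability $\mathsf{L}_{u_T,a_N,\nu_N}(i_1,j_1;i_2,j_2)$ (since $\nu_1=0$, the edge from $(1,T)$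 to $(2,T)$ independently carries an arrow with probability $-a_1u_T/(1-a_1u_T)$). $\mathfrak{h}^{\mathrm{Ber}}(N,T)$ is the total number of arrows on vertical edges from $(x,T)$ to $(x,T+1)$ with $x\ge N$. $q$-TASEP: for $\gamma\in(0,1)$, $\mathbf{p}_{m,\gamma}(j)=\gamma^j(\gamma;q)_{m-j}\frac{(q;q)_m}{(q;q)_j(q;q)_{m-j}}$, $0\le j\le m$, and $\mathbf{p}_{+\infty,\gamma}(j)=\gamma^j(\gamma;q)_\infty/(q;q)_j$. Particle configurations $x_1>x_2>\ldots$ in $\mathbb{Z}$, convention $x_0=+\infty$; particle $i$ has rate $a_i$. Geometric move $\mathbf{G}_\alpha$: each particle $i$ independently jumps right by $j$ with probability $\mathbf{p}_{x_{i-1}-x_i-1,\,a_i\alpha}(j)$. Bernoulli move $\mathbf{B}_\beta$ ($\beta>0$): sequentially for $i=1,2,\ldots$, particle $i$ jumps right by one with probability $a_i\beta/(1+a_i\beta)$ if $i=1$ or particle $i-1$ has jumped in this move, and with probability $(1-q^{x_{i-1}-x_i-1})a_i\beta/(1+a_i\beta)$ otherwise (gaps before the move). The mixed $q$-TASEP along $\mathcal{P}$: $\vec{\mathbf{x}}(1,0)$ is the step configuration $\mathbf{x}_i(1,0)=-i$, $i\ge1$; for $\mathsf{t}=0,\ldots,\mathsf{M}-1$, $\vec{\mathbf{x}}(N_{\mathsf{t}+1},T_{\mathsf{t}+1})$ is obtained from $\vec{\mathbf{x}}(N_{\mathsf{t}},T_{\mathsf{t}})$ by an independent move $\mathbf{B}_{-u_{T_{\mathsf{t}+1}}}$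 if $T_{\mathsf{t}+1}=T_{\mathsf{t}}+1$, and by an independent move $\mathbf{G}_{\mathsf{c}_{N_{\mathsf{t}+1}}}$ if $N_{\mathsf{t}+1}=N_{\mathsf{t}}+1$. *)

theory Defs
  imports "HOL-Probability.Probability"
begin

definition qpoch :: "real \<Rightarrow> real \<Rightarrow> nat \<Rightarrow> real" where
  "qpoch q z k = (\<Prod>i<k. 1 - z * q ^ i)"

definition qpoch_inf :: "real \<Rightarrow> real \<Rightarrow> real" where
  "qpoch_inf q z = prodinf (\<lambda>i. 1 - z * q ^ i)"

definition Lw :: "real \<Rightarrow> real \<Rightarrow> real \<Rightarrow> real \<Rightarrow> nat \<Rightarrow> nat \<Rightarrow> nat \<Rightarrow> nat \<Rightarrow> real" where
  "Lw q u a \<nu> i1 j1 i2 j2 =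
    (if i1 + j1 \<noteq> i2 + j2 then 0
     else if j1 = 0 \<and> j2 = 0 then (1 - a * u * q ^ i1) / (1 - a * u)
     else if j1 = 0 \<and> j2 = 1 then (- a * u * (1 - q ^ i1)) / (1 - a * u)
     else if j1 = 1 \<and> j2 = 1 then (\<nu> * q ^ i1 - a * u) / (1 - a * u)
     else if j1 = 1 \<and> j2 = 0 then (1 - \<nu> * q ^ i1) / (1 - a * u)
     else 0)"

text \<open>Outgoing arrows (i2 upward, j2 rightward) at vertex (N,T), N,T >= 1, driven by
  independent uniform [0,1] variables omega(N,T): the right exit (j2 = 1) is chosen iff
  omega(N,T) < L(i1,j1; i1+j1-1, 1), otherwise j2 = 0.  One arrow enters each (1,T) from
  the left, none enters row 1 from below.\<close>
function vout :: "real \<Rightarrow> (nat \<Rightarrow> real) \<Rightarrow> (nat \<Rightarrow> real) \<Rightarrow> (nat \<Rightarrow> real)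
    \<Rightarrow> (nat \<times> nat \<Rightarrow> real) \<Rightarrow> nat \<Rightarrow> nat \<Rightarrow> nat \<times> nat" where
  "vout q u a \<nu> \<omega> N T =
    (if N = 0 \<or> T = 0 then (0, 0) else
     (let i1 = fst (vout q u a \<nu> \<omega> N (T - 1));
          j1 = (if N = 1 then 1 else snd (vout q u a \<nu> \<omega> (N - 1) T))
      in if \<omega> (N, T) < Lw q (u T) (a N) (\<nu> N) i1 j1 (i1 + j1 - 1) 1
         then (i1 + j1 - 1, 1) else (i1 + j1, 0)))"
  by pat_completeness auto
termination by (relation "Wellfounded.measure (\<lambda>(q, u, a, \<nu>, \<omega>, N, T). N + T)") auto

text \<open>h^Ber(N,T): total number of arrows on vertical edges (x,T)->(x,T+1), x >= N.
  (If infinitely many such edges were occupied -- a null event -- the sum is 0.)\<close>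
definition hBer :: "real \<Rightarrow> (nat \<Rightarrow> real) \<Rightarrow> (nat \<Rightarrow> real) \<Rightarrow> (nat \<Rightarrow> real)
    \<Rightarrow> (nat \<times> nat \<Rightarrow> real) \<Rightarrow> nat \<Rightarrow> nat \<Rightarrow> nat" where
  "hBer q u a \<nu> \<omega> N T =
    (\<Sum>x | N \<le> x \<and> 0 < fst (vout q u a \<nu> \<omega> x T). fst (vout q u a \<nu> \<omega> x T))"

definition pgeom :: "real \<Rightarrow> nat \<Rightarrow> real \<Rightarrow> nat \<Rightarrow> real" where
  "pgeom q m \<gamma> j =
    (if j \<le> m then \<gamma> ^ j * qpoch q \<gamma> (m - j) * qpoch q q m / (qpoch q q j * qpoch q q (m - j))
     else 0)"

definition pgeom_inf :: "real \<Rightarrow> real \<Rightarrow> nat \<Rightarrow> real" where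
  "pgeom_inf q \<gamma> j = \<gamma> ^ j * qpoch_inf q \<gamma> / qpoch q q j"

definition icdf :: "(nat \<Rightarrow> real) \<Rightarrow> real \<Rightarrow> nat" where
  "icdf p v = (if \<exists>j. v < (\<Sum>k\<le>j. p k) then (LEAST j. v < (\<Sum>k\<le>j. p k)) else 0)"

text \<open>Configurations: x :: nat => int, particle i >= 1 at x i (index 0 unused, x_0 = +infinity).
  U i is the uniform variable used by particle i in the move.\<close>
definition geom_move :: "real \<Rightarrow> (nat \<Rightarrow> real) \<Rightarrow> real \<Rightarrow> (nat \<Rightarrow> int) \<Rightarrow> (nat \<Rightarrow> real) \<Rightarrow> nat \<Rightarrow> int" where
  "geom_move q a \<alpha> x U i = x i + int
     (if i = 1 then icdf (pgeom_inf q (a i * \<alpha>)) (U i)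
      else icdf (pgeom q (nat (x (i - 1) - x i - 1)) (a i * \<alpha>)) (U i))"

fun bjumped :: "real \<Rightarrow> (nat \<Rightarrow> real) \<Rightarrow> real \<Rightarrow> (nat \<Rightarrow> int) \<Rightarrow> (nat \<Rightarrow> real) \<Rightarrow> nat \<Rightarrow> bool" where
  "bjumped q a \<beta> x U 0 = False"
| "bjumped q a \<beta> x U (Suc i) =
     (U (Suc i) < (if i = 0 \<or> bjumped q a \<beta> x U i then 1 else 1 - q ^ nat (x i - x (Suc i) - 1))
                  * (a (Suc i) * \<beta> / (1 + a (Suc i) * \<beta>)))"

definition bern_move :: "real \<Rightarrow> (nat \<Rightarrow> real) \<Rightarrow> real \<Rightarrow> (nat \<Rightarrow> int) \<Rightarrow> (nat \<Rightarrow> real) \<Rightarrow> nat \<Rightarrow> int" where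
  "bern_move q a \<beta> x U i = x i + (if bjumped q a \<beta> x U i then 1 else 0)"

fun qtasep :: "real \<Rightarrow> (nat \<Rightarrow> real) \<Rightarrow> (nat \<Rightarrow> real) \<Rightarrow> (nat \<Rightarrow> real) \<Rightarrow> (nat \<Rightarrow> nat) \<Rightarrow> (nat \<Rightarrow> nat)
    \<Rightarrow> (nat \<times> nat \<Rightarrow> real) \<Rightarrow> nat \<Rightarrow> nat \<Rightarrow> int" where
  "qtasep q u a \<nu> Np Tp \<omega> 0 = (\<lambda>i. - int i)"
| "qtasep q u a \<nu> Np Tp \<omega> (Suc t) =
     (let x = qtasep q u a \<nu> Np Tp \<omega> t; U = (\<lambda>i. \<omega> (t, i)) in
      if Tp (Suc t) = Tp t + 1 then bern_move q a (- u (Tp (Suc t))) x U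
      else geom_move q a (\<nu> (Np (Suc t)) / a (Np (Suc t))) x U)"

definition timelike_path :: "(nat \<Rightarrow> nat) \<Rightarrow> (nat \<Rightarrow> nat) \<Rightarrow> nat \<Rightarrow> bool" where
  "timelike_path Np Tp M \<longleftrightarrow> Np 0 = 1 \<and> Tp 0 = 0 \<and>
     (\<forall>t<M. (Np (Suc t) = Np t + 1 \<and> Tp (Suc t) = Tp t) \<or>
            (Np (Suc t) = Np t \<and> Tp (Suc t) = Tp t + 1))"

definition unifOmega :: "(nat \<times> nat \<Rightarrow> real) measure" where
  "unifOmega = PiM UNIV (\<lambda>_. uniform_measure lborel {0..1})"

end

theory Submission
  imports Defs
begin

text \<open>
  In the coordinates \<open>y\<^sub>i = x\<^sub>i + i\<close> a Bernoulli move is a row of the vertex model with all \<open>\<nu>\<^sub>i = 0\<close>: the gap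
  \<open>y\<^sub>i\<^sub>-\<^sub>1 - y\<^sub>i\<close> is the number of vertical arrows, and a jump is a horizontal arrow. Let \<open>V(\<mu>)\<close> be a row in which
  particle \<open>i\<close> has parameter \<open>\<mu>\<^sub>i\<close>, and let \<open>J(\<alpha>, lo, hi)\<close> be the geometric move restricted to the particles
  \<open>lo \<le> i < hi\<close>. The key fact is an exchange relation \<open>V(\<mu>) J = J V(\<mu>')\<close>, where \<open>\<mu>\<close> and \<open>\<mu>'\<close> vanish strictly
  between \<open>lo\<close> and \<open>hi\<close>: the move \<open>J\<close> transports the parameter \<open>a\<^sub>i \<alpha>\<close> from \<open>i = hi\<close> to \<open>i = lo\<close> (where it is lost
  if \<open>lo = 1\<close>). It is proved particle by particle from two rational identities involving a signed
  2-by-2 matrix.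

  A geometric move splits into its action \<open>E\<^sub>N = J(c\<^sub>N, N, \<infinity>)\<close> on the rear particles followed by its action
  \<open>D\<^sub>N = J(c\<^sub>N, 1, N)\<close> on the front particles. Along a time-like path all \<open>E\<^sub>N\<close> can be exchanged to the start, where
  they act trivially on the step configuration; then all \<open>D\<^sub>N\<close> can be exchanged to the end, where they
  only move particles that are no longer observed. What remains is the vertex model with all parameters \<open>\<nu>\<^sub>N\<close>.
\<close>

section \<open>The q-geometric weights\<close>

text \<open>The exchanges preserve a joint law because each time records a single coordinate, that
  of particle N. Before column N is entered only particles of smaller index have been recorded, and
  E_N fixes them; afterwards only particles of index at least N are recorded, and D_N fixes those.
  The obstacle is that the two orders split the same total increment of a particle differently, and
  its follower sees the split. The remedy is to cut behind particle i as if it had made no geometric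
  jump, the follower receiving the parameter a_{i+1} \<alpha> instead. This tail law is a signed
  mixture of the true tail laws for the two possible splits, so the exchange becomes scalar
  identities for each particle. Since a particle reacts only to its predecessor, everything takes
  place on the first n = \<open>Np M\<close> particles, and lists with discrete laws suffice. On the
  vertex side y_N counts the arrows leaving column N to the right. It equals the height only almost
  surely: arrows must not escape to infinity along a row, which is where the uniform bounds on a and
  \<nu> enter.\<close>

lemma qpoch_Suc: "qpoch q z (Suc k) = qpoch q z k * (1 - z * q ^ k)"
  by (simp add: qpoch_def)

lemma qpoch_pos:
  assumes "0 < q" "q < 1" "0 \<le> z" "z < 1"
  shows "0 < qpoch q z k"
  unfolding qpoch_def
proof (rule prod_pos)
  fix i
  have "z * q ^ i \<le> z * 1" using assms by (intro mult_left_mono power_le_one) auto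
  then show "0 < 1 - z * q ^ i" using assms by simp
qed

lemma qpoch_qq_Suc: "qpoch q q (Suc k) = qpoch q q k * (1 - q ^ Suc k)"
  by (simp add: qpoch_Suc)

locale qgeom =
  fixes q \<gamma> :: real
  assumes q: "0 < q" "q < 1" and \<gamma>: "0 < \<gamma>" "\<gamma> < 1"
begin

lemma qq_pos: "0 < qpoch q q k"
  using q by (intro qpoch_pos) auto

lemma qpow_less_1: "q ^ Suc k < 1"
  using q by (intro power_Suc_less_one) auto

lemma pgeom_nonneg: "0 \<le> pgeom q m \<gamma> j"
  unfolding pgeom_def using \<gamma> q qq_pos qpoch_pos[of q \<gamma>]
  by (auto intro!: divide_nonneg_nonneg mult_nonneg_nonneg simp: less_imp_le)

lemma pgeom_0_0: "pgeom q 0 \<gamma> 0 = 1"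
  by (simp add: pgeom_def qpoch_def)

lemma pgeom_gt: "m < j \<Longrightarrow> pgeom q m \<gamma> j = 0"
  by (simp add: pgeom_def)

lemma pgeom_Suc_Suc:
  "pgeom q (Suc m) \<gamma> (Suc j) * (1 - q ^ Suc j) = \<gamma> * (1 - q ^ Suc m) * pgeom q m \<gamma> j"
proof -
  have "1 - q ^ Suc j \<noteq> 0" using qpow_less_1[of j] by simp
  then show ?thesis using qq_pos
    by (auto simp: pgeom_def qpoch_qq_Suc simp del: power_Suc) (simp add: divide_simps)
qed

lemma pgeom_Suc:
  assumes "j \<le> m"
  shows "pgeom q (Suc m) \<gamma> j * (1 - q ^ Suc (m - j)) =
         pgeom q m \<gamma> j * (1 - \<gamma> * q ^ (m - j)) * (1 - q ^ Suc m)"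
proof -
  have "1 - q ^ Suc (m - j) \<noteq> 0" using qpow_less_1[of "m - j"] by simp
  then show ?thesis using qq_pos assms
    by (auto simp: pgeom_def qpoch_qq_Suc Suc_diff_le qpoch_Suc[of _ \<gamma>] simp del: power_Suc)
qed

text \<open>A q-Pascal rule. After multiplication by 1 - q^(j+1) every term is expressed by the
  weights at j for the gaps m and m - 1, and \<open>pgeom_Suc\<close> links those two. For j = m the
  truncated exponent \<open>m - Suc j\<close> multiplies a vanishing weight.\<close>

lemma pgeom_pascal:
  assumes "j \<le> m"
  shows "pgeom q (Suc m) \<gamma> (Suc j) =
    (1 - \<gamma> * q ^ (m - Suc j)) * pgeom q m \<gamma> (Suc j) + \<gamma> * q ^ (m - j) * pgeom q m \<gamma> j"
proof (cases "j = m")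
  case True
  have n: "1 - q ^ Suc m \<noteq> 0" using qpow_less_1[of m] by simp
  have "pgeom q (Suc m) \<gamma> (Suc m) * (1 - q ^ Suc m) = (\<gamma> * pgeom q m \<gamma> m) * (1 - q ^ Suc m)"
    using pgeom_Suc_Suc[of m m] by (simp only: mult_ac)
  then have "pgeom q (Suc m) \<gamma> (Suc m) = \<gamma> * pgeom q m \<gamma> m" using n by (simp only: mult_cancel_right) simp
  then show ?thesis using True by (simp add: pgeom_gt)
next
  case False
  with assms obtain d where m: "m = Suc (j + d)" by (metis less_iff_Suc_add le_neq_implies_less)
  define B where "B = pgeom q (j + d) \<gamma> j"
  define A where "A = pgeom q (Suc (Suc (j + d))) \<gamma> (Suc j)"
  define C where "C = pgeom q (Suc (j + d)) \<gamma> (Suc j)"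
  define D where "D = pgeom q (Suc (j + d)) \<gamma> j"
  have 1: "A * (1 - q ^ Suc j) = \<gamma> * (1 - q ^ Suc (Suc (j+d))) * D"
    unfolding A_def D_def by (rule pgeom_Suc_Suc)
  have 2: "C * (1 - q ^ Suc j) = \<gamma> * (1 - q ^ Suc (j+d)) * B"
    unfolding C_def B_def by (rule pgeom_Suc_Suc)
  have 3: "D * (1 - q ^ Suc d) = B * (1 - \<gamma> * q ^ d) * (1 - q ^ Suc (j+d))"
    using pgeom_Suc[of j "j+d"] unfolding D_def B_def by simp
  have n: "1 - q ^ Suc j \<noteq> 0" using qpow_less_1[of j] by simp
  have "((1 - \<gamma> * q ^ d) * C + \<gamma> * q ^ Suc d * D) * (1 - q ^ Suc j)
      = (1 - \<gamma> * q ^ d) * (C * (1 - q ^ Suc j)) + \<gamma> * q ^ Suc d * D * (1 - q ^ Suc j)"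
    by (simp only: algebra_simps)
  also have "\<dots> = \<gamma> * (D * (1 - q ^ Suc d)) + \<gamma> * q ^ Suc d * D * (1 - q ^ Suc j)"
    unfolding 2 3 by (simp only: mult_ac)
  also have "\<dots> = \<gamma> * (1 - q ^ Suc (Suc (j+d))) * D"
    by (simp add: algebra_simps power_add)
  finally have "((1 - \<gamma> * q ^ d) * C + \<gamma> * q ^ Suc d * D) * (1 - q ^ Suc j) = A * (1 - q ^ Suc j)"
    using 1 by simp
  then have "A = (1 - \<gamma> * q ^ d) * C + \<gamma> * q ^ Suc d * D" using n by (simp only: mult_cancel_right) simp
  then show ?thesis unfolding A_def C_def D_def m by simp
qed

text \<open>By the Pascal rule, raising the gap from m to m + 1 splits the weight at j into a
  fraction 1 - \<gamma> q^(m-j) that stays and a fraction \<gamma> q^(m-j) that moves to j + 1, so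
  the total mass is preserved.\<close>

lemma sum_pgeom: "(\<Sum>j\<le>m. pgeom q m \<gamma> j) = 1"
proof (induction m)
  case 0
  then show ?case by (simp add: pgeom_0_0)
next
  case (Suc m)
  have n: "1 - q ^ Suc m \<noteq> 0" using qpow_less_1[of m] by simp
  have z: "pgeom q (Suc m) \<gamma> 0 = (1 - \<gamma> * q ^ m) * pgeom q m \<gamma> 0"
    using pgeom_Suc[of 0 m] n by (simp add: mult_ac del: power_Suc)
  have "(\<Sum>j\<le>Suc m. pgeom q (Suc m) \<gamma> j)
      = pgeom q (Suc m) \<gamma> 0 + (\<Sum>j\<le>m. pgeom q (Suc m) \<gamma> (Suc j))"
    by (simp only: sum.atMost_Suc_shift)
  also have "\<dots> = (1 - \<gamma> * q ^ m) * pgeom q m \<gamma> 0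
     + (\<Sum>j\<le>m. (1 - \<gamma> * q ^ (m - Suc j)) * pgeom q m \<gamma> (Suc j))
     + (\<Sum>j\<le>m. \<gamma> * q ^ (m - j) * pgeom q m \<gamma> j)"
    using z by (simp add: pgeom_pascal sum.distrib)
  also have "(1 - \<gamma> * q ^ m) * pgeom q m \<gamma> 0
     + (\<Sum>j\<le>m. (1 - \<gamma> * q ^ (m - Suc j)) * pgeom q m \<gamma> (Suc j))
     = (\<Sum>j\<le>Suc m. (1 - \<gamma> * q ^ (m - j)) * pgeom q m \<gamma> j)"
    by (subst sum.atMost_Suc_shift) simp
  also have "\<dots> = (\<Sum>j\<le>m. (1 - \<gamma> * q ^ (m - j)) * pgeom q m \<gamma> j)"
    by (simp add: pgeom_gt)
  finally show ?case using Suc by (simp add: algebra_simps flip: sum.distrib)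
qed

lemma qpoch_inf_tendsto: "qpoch q \<gamma> \<longlonglongrightarrow> qpoch_inf q \<gamma>" and qpoch_inf_pos: "0 < qpoch_inf q \<gamma>"
proof -
  have "summable (\<lambda>i. \<gamma> * q ^ i)"
    using q by (intro summable_mult summable_geometric) simp
  moreover have "norm ((1 - \<gamma> * q ^ i) - 1) = \<gamma> * q ^ i" for i
    using q(1) \<gamma>(1) by simp
  ultimately have "summable (\<lambda>i. norm ((1 - \<gamma> * q ^ i) - 1))" by simp
  from abs_convergent_prod_imp_convergent_prod[OF summable_imp_abs_convergent_prod[OF this]]
  have c: "convergent_prod (\<lambda>i. 1 - \<gamma> * q ^ i)" .
  then have "(\<lambda>n. \<Prod>i\<le>n. 1 - \<gamma> * q ^ i) \<longlonglongrightarrow> qpoch_inf q \<gamma>"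
    unfolding qpoch_inf_def by (rule convergent_prod_LIMSEQ)
  then have "(\<lambda>n. qpoch q \<gamma> (Suc n)) \<longlonglongrightarrow> qpoch_inf q \<gamma>"
    unfolding qpoch_def lessThan_Suc_atMost .
  then show "qpoch q \<gamma> \<longlonglongrightarrow> qpoch_inf q \<gamma>" by (simp only: filterlim_sequentially_Suc)
  have f: "0 < 1 - \<gamma> * q ^ i" for i
  proof -
    have "\<gamma> * q ^ i \<le> \<gamma> * 1" using q \<gamma> by (intro mult_left_mono power_le_one) auto
    then show ?thesis using \<gamma> by linarith
  qed
  have "qpoch_inf q \<gamma> \<noteq> 0"
    unfolding qpoch_inf_def using c by (rule prodinf_nonzero) (metis f less_irrefl)
  moreover have "0 \<le> qpoch_inf q \<gamma>"
    using \<open>qpoch q \<gamma> \<longlonglongrightarrow> qpoch_inf q \<gamma>\<close> by (rule LIMSEQ_le_const) (use q \<gamma> qpoch_pos[of q \<gamma>] in \<open>auto intro!: exI[of _ 0] less_imp_le\<close>)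
  ultimately show "0 < qpoch_inf q \<gamma>" by simp
qed

lemma pgeom_inf_nonneg: "0 \<le> pgeom_inf q \<gamma> j"
  unfolding pgeom_inf_def using \<gamma> qq_pos qpoch_inf_pos by (simp add: less_imp_le)

lemma pgeom_inf_Suc: "pgeom_inf q \<gamma> (Suc j) * (1 - q ^ Suc j) = \<gamma> * pgeom_inf q \<gamma> j"
proof -
  have "1 - q ^ Suc j \<noteq> 0" using qpow_less_1[of j] by simp
  then show ?thesis using qq_pos
    by (auto simp: pgeom_inf_def qpoch_qq_Suc simp del: power_Suc) (simp add: divide_simps)
qed

lemma summable_q_exponential:
  assumes "0 \<le> x" "x \<le> \<gamma>"
  shows "summable (\<lambda>j. x ^ j / qpoch q q j)"
proof -
  have lim: "(\<lambda>j. \<gamma> / (1 - q ^ Suc j)) \<longlonglongrightarrow> \<gamma> / (1 - 0)"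
    using q by (intro tendsto_intros LIMSEQ_Suc LIMSEQ_realpow_zero) auto
  \<comment> \<open>Any ratio strictly between \<gamma> and 1 serves; this is the midpoint.\<close>
  define c where "c = (\<gamma> + 1) / 2"
  have c: "\<gamma> < c" "c < 1" using \<gamma> by (auto simp: c_def)
  then have "\<forall>\<^sub>F j in sequentially. \<gamma> / (1 - q ^ Suc j) < c"
    using order_tendstoD(2)[OF lim, of c] by simp
  then obtain N where N: "\<And>j. j \<ge> N \<Longrightarrow> \<gamma> / (1 - q ^ Suc j) < c"
    by (auto simp: eventually_sequentially)
  show ?thesis
  proof (rule summable_ratio_test[of c N])
    show "c < 1" by fact
    fix j assume j: "N \<le> j"
    have p: "0 < 1 - q ^ Suc j" using qpow_less_1[of j] by simp
    have "x / (1 - q ^ Suc j) \<le> \<gamma> / (1 - q ^ Suc j)" using p assms by (intro divide_right_mono) auto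
    also have "\<dots> \<le> c" using N[OF j] by simp
    finally have "(x ^ j / qpoch q q j) * (x / (1 - q ^ Suc j)) \<le> (x ^ j / qpoch q q j) * c"
      using assms qq_pos[of j] by (intro mult_left_mono) auto
    then show "norm (x ^ Suc j / qpoch q q (Suc j)) \<le> c * norm (x ^ j / qpoch q q j)"
      using assms qq_pos[of j] p by (simp add: qpoch_qq_Suc abs_mult mult_ac del: power_Suc) (simp add: mult_ac)
  qed
qed

text \<open>Euler's identity: the power series \<open>f x\<close> with coefficients \<open>1 / (q; q)\<^sub>j\<close> satisfies \<open>(1 - x) f x = f (q x)\<close>
  and is continuous at \<open>0\<close>.\<close>

lemma sums_pgeom_inf: "pgeom_inf q \<gamma> sums 1"
proof -
  define f where "f x = (\<Sum>j. (1 / qpoch q q j) * x ^ j)" for x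
  have s: "summable (\<lambda>j. (1 / qpoch q q j) * x ^ j)" if "0 \<le> x" "x \<le> \<gamma>" for x
    using summable_q_exponential[OF that] by simp
  have feq: "f (q * x) = (1 - x) * f x" if x: "0 \<le> x" "x \<le> \<gamma>" for x
  proof -
    have qx: "0 \<le> q * x" "q * x \<le> \<gamma>"
      using x q mult_right_mono[of q 1 x] by auto
    have "f x - f (q * x) = (\<Sum>j. (1 / qpoch q q j) * x ^ j - (1 / qpoch q q j) * (q * x) ^ j)"
      unfolding f_def by (rule suminf_diff[OF s[OF x] s[OF qx]])
    also have "\<dots> = (\<Sum>j. (1 / qpoch q q (Suc j)) * x ^ Suc j - (1 / qpoch q q (Suc j)) * (q * x) ^ Suc j)"
      by (subst suminf_split_head[OF summable_diff[OF s[OF x] s[OF qx]]]) simp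
    also have "(\<lambda>j. (1 / qpoch q q (Suc j)) * x ^ Suc j - (1 / qpoch q q (Suc j)) * (q * x) ^ Suc j)
             = (\<lambda>j. x * ((1 / qpoch q q j) * x ^ j))"
    proof
      fix j
      have "1 - q ^ Suc j \<noteq> 0" using qpow_less_1[of j] by simp
      moreover have "(1 / qpoch q q (Suc j)) * x ^ Suc j - (1 / qpoch q q (Suc j)) * (q * x) ^ Suc j
        = x ^ Suc j * (1 - q ^ Suc j) / qpoch q q (Suc j)"
        by (simp only: power_mult_distrib right_diff_distrib diff_divide_distrib) (simp add: mult_ac)
      ultimately show "(1 / qpoch q q (Suc j)) * x ^ Suc j - (1 / qpoch q q (Suc j)) * (q * x) ^ Suc j
        = x * ((1 / qpoch q q j) * x ^ j)"
        by (simp add: qpoch_qq_Suc del: power_Suc) simp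
    qed
    also have "(\<Sum>j. x * ((1 / qpoch q q j) * x ^ j)) = x * f x"
      unfolding f_def by (rule suminf_mult[OF s[OF x]])
    finally show ?thesis by (simp add: algebra_simps)
  qed
  have le: "0 \<le> q ^ k * \<gamma>" "q ^ k * \<gamma> \<le> \<gamma>" for k
    using q \<gamma> mult_right_mono[of "q ^ k" 1 \<gamma>] by (auto simp: power_le_one)
  have it: "f (q ^ k * \<gamma>) = qpoch q \<gamma> k * f \<gamma>" for k
  proof (induction k)
    case 0
    then show ?case by (simp add: qpoch_def)
  next
    case (Suc k)
    then show ?case using feq[OF le(1)[of k] le(2)[of k]] by (simp add: qpoch_Suc mult_ac)
  qed
  have c: "isCont f 0"
    unfolding f_def by (rule isCont_powser[OF s[of \<gamma>]]) (use \<gamma> in auto)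
  have "(\<lambda>k. q ^ k * \<gamma>) \<longlonglongrightarrow> 0 * \<gamma>" using q by (intro tendsto_intros LIMSEQ_realpow_zero) auto
  then have "(\<lambda>k. f (q ^ k * \<gamma>)) \<longlonglongrightarrow> f 0" using isCont_tendsto_compose[OF c] by simp
  moreover have "f 0 = 1" unfolding f_def by (simp only: powser_zero) (simp add: qpoch_def)
  moreover have "(\<lambda>k. f (q ^ k * \<gamma>)) \<longlonglongrightarrow> qpoch_inf q \<gamma> * f \<gamma>"
    unfolding it by (intro tendsto_intros qpoch_inf_tendsto)
  ultimately have "qpoch_inf q \<gamma> * f \<gamma> = 1" using LIMSEQ_unique by metis
  moreover have "(\<lambda>j. (1 / qpoch q q j) * \<gamma> ^ j) sums f \<gamma>"
    unfolding f_def using s[of \<gamma>] \<gamma> by (auto intro!: summable_sums)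
  then have "(\<lambda>j. qpoch_inf q \<gamma> * ((1 / qpoch q q j) * \<gamma> ^ j)) sums (qpoch_inf q \<gamma> * f \<gamma>)"
    by (rule sums_mult)
  ultimately show ?thesis by (simp add: pgeom_inf_def[abs_def] mult_ac)
qed

lemma sums_pgeom: "pgeom q m \<gamma> sums 1"
  using sums_finite[of "{..m}" "pgeom q m \<gamma>"] sum_pgeom pgeom_gt by (auto simp: not_le)

end

section \<open>Sequential updates of particle configurations\<close>

text \<open>Arguments of a kernel \<open>\<kappa>\<close>: the index \<open>i\<close> of a particle, the old position \<open>p\<close> and the increment \<open>b\<close>
  of its predecessor, and its own old position \<open>x\<close>. It returns the increment of the particle.\<close>

fun scan :: "(nat \<Rightarrow> nat \<Rightarrow> nat \<Rightarrow> nat \<Rightarrow> nat pmf) \<Rightarrow> nat \<Rightarrow> nat \<Rightarrow> nat \<Rightarrow> nat list \<Rightarrow> nat list pmf" where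
  "scan \<kappa> i p b [] = return_pmf []"
| "scan \<kappa> i p b (x # xs) =
     bind_pmf (\<kappa> i p b x) (\<lambda>j. map_pmf ((#) (x + j)) (scan \<kappa> (Suc i) x j xs))"

lemma length_scan: "zs \<in> set_pmf (scan \<kappa> i p b xs) \<Longrightarrow> length zs = length xs"
  by (induction xs arbitrary: i p b zs) auto

lemma sorted_scan:
  assumes "\<And>i' p b x j. i \<le> i' \<Longrightarrow> x \<le> p \<Longrightarrow> j \<in> set_pmf (\<kappa> i' p b x) \<Longrightarrow> x + j \<le> p + b"
    and "sorted_wrt (\<ge>) (p # xs)" and "zs \<in> set_pmf (scan \<kappa> i p b xs)"
  shows "sorted_wrt (\<ge>) ((p + b) # zs)"
  using assms
proof (induction xs arbitrary: i p b zs)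
  case Nil
  then show ?case by simp
next
  case (Cons x xs)
  from Cons.prems(3) obtain j ys where j: "j \<in> set_pmf (\<kappa> i p b x)"
    and ys: "ys \<in> set_pmf (scan \<kappa> (Suc i) x j xs)" and zs: "zs = (x + j) # ys" by auto
  have 1: "x + j \<le> p + b" using Cons.prems(1)[OF le_refl _ j] Cons.prems(2) by auto
  have "sorted_wrt (\<ge>) ((x + j) # ys)"
  proof (rule Cons.IH[OF _ _ ys])
    show "x' + j' \<le> p' + b'" if "Suc i \<le> i'" "x' \<le> p'" "j' \<in> set_pmf (\<kappa> i' p' b' x')" for i' p' b' x' j'
      using Cons.prems(1)[of i' x' p' j' b'] that by simp
  qed (use Cons.prems(2) in simp)
  then show ?case using 1 zs by fastforce
qed

lemma pmf_map_Cons: "pmf (map_pmf ((#) x) P) (z # zs) = (if x = z then pmf P zs else 0)"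
proof (cases "x = z")
  case True
  then show ?thesis by (simp add: pmf_map_inj')
next
  case False
  then show ?thesis by (auto simp: pmf_eq_0_set_pmf)
qed

text \<open>The head z fixes the increment as z - y, so at most one term of the mixture
  survives.\<close>

lemma pmf_bind_map_Cons:
  fixes y :: nat
  shows "pmf (bind_pmf Q (\<lambda>k. map_pmf ((#) (y + k)) (F k))) (z # zs)
     = (if y \<le> z then pmf Q (z - y) * pmf (F (z - y)) zs else (0::real))"
proof -
  have "pmf (bind_pmf Q (\<lambda>k. map_pmf ((#) (y + k)) (F k))) (z # zs)
      = (\<Sum>k\<in>{z - y}. pmf (map_pmf ((#) (y + k)) (F k)) (z # zs) * pmf Q k)"
    unfolding pmf_bind
    by (rule integral_measure_pmf_real) (auto simp: pmf_map_Cons split: if_splits)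
  then show ?thesis by (simp add: pmf_map_Cons)
qed

section \<open>Kernels of a vertex row and of a geometric move\<close>

locale particle_system =
  fixes q :: real and a :: "nat \<Rightarrow> real"
  assumes q: "0 < q" "q < 1" and a_pos: "\<And>i. 1 \<le> i \<Longrightarrow> 0 < a i"
begin

text \<open>The probability of a right exit when g vertical and b horizontal arrows come in, for u =
  -\<beta> and \<nu> = \<open>\<mu> i\<close>. For \<open>\<mu> i\<close> = 0 it is the jump
  probability of the Bernoulli move, b telling whether the predecessor has jumped.\<close>

definition vprob :: "real \<Rightarrow> (nat \<Rightarrow> real) \<Rightarrow> nat \<Rightarrow> nat \<Rightarrow> nat \<Rightarrow> real" where
  "vprob \<beta> \<mu> i g b = (if b = 0 then a i * \<beta> * (1 - q ^ g) else \<mu> i * q ^ g + a i * \<beta>) / (1 + a i * \<beta>)"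

definition vker :: "real \<Rightarrow> (nat \<Rightarrow> real) \<Rightarrow> nat \<Rightarrow> nat \<Rightarrow> nat \<Rightarrow> nat \<Rightarrow> nat pmf" where
  "vker \<beta> \<mu> i p b x = map_pmf of_bool (bernoulli_pmf (vprob \<beta> \<mu> i (p - x) b))"

definition jumpw :: "real \<Rightarrow> nat \<Rightarrow> nat \<Rightarrow> nat \<Rightarrow> real" where
  "jumpw \<alpha> i g = (if i = 1 then pgeom_inf q (a i * \<alpha>) else pgeom q g (a i * \<alpha>))"

text \<open>Unlike \<open>vker\<close> this is a parallel update, governed by the gap p - x before
  the move.\<close>

definition jker :: "real \<Rightarrow> nat \<Rightarrow> nat \<Rightarrow> nat \<Rightarrow> nat \<Rightarrow> nat \<Rightarrow> nat \<Rightarrow> nat pmf" where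
  "jker \<alpha> lo hi i p b x = (if lo \<le> i \<and> i < hi then embed_pmf (jumpw \<alpha> i (p - x)) else return_pmf 0)"

abbreviation V :: "real \<Rightarrow> (nat \<Rightarrow> real) \<Rightarrow> nat \<Rightarrow> nat \<Rightarrow> nat \<Rightarrow> nat list \<Rightarrow> nat list pmf" where
  "V \<beta> \<mu> \<equiv> scan (vker \<beta> \<mu>)"

abbreviation J :: "real \<Rightarrow> nat \<Rightarrow> nat \<Rightarrow> nat \<Rightarrow> nat \<Rightarrow> nat \<Rightarrow> nat list \<Rightarrow> nat list pmf" where
  "J \<alpha> lo hi \<equiv> scan (jker \<alpha> lo hi)"

definition geom_ok :: "real \<Rightarrow> bool" where
  "geom_ok \<alpha> \<longleftrightarrow> 0 < \<alpha> \<and> (\<forall>i\<ge>1. a i * \<alpha> < 1)"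

lemma geom_okD: "geom_ok \<alpha> \<Longrightarrow> 1 \<le> i \<Longrightarrow> qgeom q (a i * \<alpha>)"
  using q a_pos by unfold_locales (auto simp: geom_ok_def)

lemma vprob_bounds:
  assumes "0 < \<beta>" "1 \<le> i" "0 \<le> \<mu> i" "\<mu> i \<le> 1"
  shows "0 \<le> vprob \<beta> \<mu> i g b" "vprob \<beta> \<mu> i g b \<le> 1"
proof -
  have ab: "0 < a i * \<beta>" using assms a_pos by simp
  have qg: "0 \<le> q ^ g" "q ^ g \<le> 1" using q by (auto intro: power_le_one)
  have 1: "a i * \<beta> * (1 - q ^ g) \<le> a i * \<beta> * 1" using ab qg by (intro mult_left_mono) auto
  have 2: "\<mu> i * q ^ g \<le> 1 * 1" using assms qg by (intro mult_mono) auto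
  have 3: "0 \<le> a i * \<beta> * (1 - q ^ g)" "0 \<le> \<mu> i * q ^ g" using ab qg assms by auto
  show "0 \<le> vprob \<beta> \<mu> i g b" "vprob \<beta> \<mu> i g b \<le> 1"
    unfolding vprob_def using ab 1 2 3 by (auto simp: divide_simps)
qed

lemma vprob_upd: "vprob \<beta> (\<mu>(k := v)) i g b = (if i = k then vprob \<beta> (\<lambda>_. v) i g b else vprob \<beta> \<mu> i g b)"
  by (simp add: vprob_def)

lemma V_cong: "(\<And>k. i \<le> k \<Longrightarrow> k < i + length xs \<Longrightarrow> \<mu> k = \<mu>' k) \<Longrightarrow> V \<beta> \<mu> i p b xs = V \<beta> \<mu>' i p b xs"
  by (induction xs arbitrary: i p b) (auto simp: vker_def vprob_def intro!: bind_pmf_cong)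

lemma pmf_bind_vker:
  assumes "0 < \<beta>" "1 \<le> i" "0 \<le> \<mu> i" "\<mu> i \<le> 1"
  shows "pmf (bind_pmf (vker \<beta> \<mu> i p b x) f) z =
     (1 - vprob \<beta> \<mu> i (p - x) b) * pmf (f 0) z + vprob \<beta> \<mu> i (p - x) b * pmf (f 1) z"
  using vprob_bounds[of \<beta> i \<mu> "p - x" b] assms by (simp add: vker_def bind_map_pmf pmf_bind)

text \<open>\<open>embed_pmf\<close> has the intended weights only if they are nonnegative with
  total mass 1, which \<open>sum_pgeom\<close> and Euler's identity supply.\<close>

lemma pmf_jump:
  assumes "geom_ok \<alpha>" "1 \<le> i"
  shows "pmf (embed_pmf (jumpw \<alpha> i g)) j = jumpw \<alpha> i g j"
proof -
  interpret qgeom q "a i * \<alpha>" by (rule geom_okD[OF assms])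
  have nn: "0 \<le> jumpw \<alpha> i g j" for j unfolding jumpw_def using pgeom_nonneg pgeom_inf_nonneg by presburger
  have s: "jumpw \<alpha> i g sums 1" unfolding jumpw_def using sums_pgeom sums_pgeom_inf by presburger
  have "(\<integral>\<^sup>+j. ennreal (jumpw \<alpha> i g j) \<partial>count_space UNIV) = ennreal 1"
    unfolding nn_integral_count_space_nat
    using nn s by (subst suminf_ennreal2) (auto simp: sums_iff)
  then show ?thesis using nn by (intro pmf_embed_pmf) auto
qed

lemma set_jker_le:
  assumes "geom_ok \<alpha>" "1 < i" "j \<in> set_pmf (jker \<alpha> lo hi i p b x)"
  shows "j \<le> p - x"
proof (rule ccontr)
  assume "\<not> j \<le> p - x"
  interpret qgeom q "a i * \<alpha>" using assms by (intro geom_okD) auto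
  show False using assms \<open>\<not> j \<le> p - x\<close> pgeom_gt[of "p - x" j] pmf_jump[of \<alpha> i "p - x" j]
    by (auto simp: jker_def set_pmf_iff jumpw_def split: if_splits)
qed

lemma J_trivial_ge: "hi \<le> i \<Longrightarrow> J \<alpha> lo hi i p b xs = return_pmf xs"
  by (induction xs arbitrary: i p b) (auto simp: jker_def bind_return_pmf)

lemma J_ignores_jump: "J \<alpha> lo hi i p b xs = J \<alpha> lo hi i p b' xs"
  by (cases xs) (auto simp: jker_def)

lemma J_ignores_carry: "i = 1 \<or> i < lo \<Longrightarrow> J \<alpha> lo hi i p b xs = J \<alpha> lo hi i p' b' xs"
  by (cases xs) (auto simp: jker_def jumpw_def)

text \<open>A jump by one can break the order only for a particle with gap 0 behind a predecessor
  that stays; there the factor 1 - q^0 rules the jump out.\<close>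

lemma sorted_V:
  assumes "sorted_wrt (\<ge>) (p # xs)" "zs \<in> set_pmf (V \<beta> \<mu> i p b xs)"
  shows "sorted_wrt (\<ge>) ((p + b) # zs)"
proof (rule sorted_scan[OF _ assms])
  fix i p b x j assume *: "x \<le> p" "j \<in> set_pmf (vker \<beta> \<mu> i p b x)"
  then have j: "j \<le> 1" by (auto simp: vker_def)
  show "x + j \<le> p + b"
  proof (cases "b = 0 \<and> p = x")
    case True
    then have "vprob \<beta> \<mu> i (p - x) b = 0" by (simp add: vprob_def)
    moreover have "True \<notin> set_pmf (bernoulli_pmf 0)" by (simp add: set_pmf_iff)
    ultimately have "j = 0" using * by (auto simp: vker_def)
    then show ?thesis using * by simp
  qed (use * j in auto)
qed

text \<open>The bound is the old position p, sharper than p + b, because a geometric jump never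
  exceeds the gap before the move. The first particle is excluded, its jump being unbounded.\<close>

lemma sorted_J:
  assumes "geom_ok \<alpha>" "1 < i" "sorted_wrt (\<ge>) (p # xs)" "zs \<in> set_pmf (J \<alpha> lo hi i p b xs)"
  shows "sorted_wrt (\<ge>) (p # zs)"
proof -
  have zs: "zs \<in> set_pmf (J \<alpha> lo hi i p 0 xs)" using assms(4) J_ignores_jump by metis
  have "sorted_wrt (\<ge>) ((p + 0) # zs)"
  proof (rule sorted_scan[OF _ assms(3) zs])
    fix i' p b x j assume "i \<le> i'" "x \<le> p" "j \<in> set_pmf (jker \<alpha> lo hi i' p b x)"
    then show "x + j \<le> p + b" using set_jker_le[of \<alpha> i' j] assms(1,2) by fastforce
  qed
  then show ?thesis by simp
qed

text \<open>Signed weights that convert a (Bernoulli, then geometric) increment of a particle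
  with total increment \<open>s\<close> and Bernoulli part \<open>b\<close> into a (geometric, then Bernoulli) one with Bernoulli part \<open>0\<close>;
  the complementary weight belongs to Bernoulli part \<open>1\<close>. They may be negative.\<close>

definition rz :: "real \<Rightarrow> real \<Rightarrow> nat \<Rightarrow> nat \<Rightarrow> real" where
  "rz \<alpha> \<beta> b s = (if b = 0 then 1 else - (\<alpha> / \<beta>)) / q ^ s"

text \<open>Over the common denominator 1 + a i \<beta>, every right-exit probability is a i \<beta>
  plus a multiple of q^G. The enlarged gap G + s contributes a factor q^s that cancels against the
  one in \<open>rz\<close>, and the coefficients -a i \<beta> for b = 0 and a i \<alpha> for b = 1
  remain; this dictates \<open>rz\<close>. With parameter 0 and b = 1 the gap drops out, so G' is
  arbitrary.\<close>

lemma vprob_convert: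
  assumes "0 < \<beta>" "1 \<le> i"
  shows "vprob \<beta> (\<lambda>_. a i * \<alpha>) i G b =
    rz \<alpha> \<beta> b s * vprob \<beta> (\<lambda>_. 0) i (G + s) 0 + (1 - rz \<alpha> \<beta> b s) * vprob \<beta> (\<lambda>_. 0) i G' 1"
proof -
  define r where "r = rz \<alpha> \<beta> b s"
  have r: "r * q ^ s = (if b = 0 then 1 else - (\<alpha> / \<beta>))" using q by (simp add: r_def rz_def)
  have "r * (a i * \<beta> * (1 - q ^ (G + s))) + (1 - r) * (a i * \<beta>) = a i * \<beta> - (r * q ^ s) * (a i * \<beta> * q ^ G)"
    by (simp add: algebra_simps power_add)
  also have "\<dots> = (if b = 0 then a i * \<beta> * (1 - q ^ G) else a i * \<alpha> * q ^ G + a i * \<beta>)"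
    unfolding r using assms by (simp add: algebra_simps)
  finally show ?thesis unfolding r_def[symmetric] by (simp add: vprob_def flip: add_divide_distrib)
qed

text \<open>A two-point mixture is affine in the jump probability, and the tail behind particle i
  sees only the old position and the increment of that particle. Hence \<open>vprob_convert\<close>
  lifts to whole lists: a predecessor at x without geometric jump is traded for one at x + s or at
  x'.\<close>

lemma V_convert:
  assumes "0 < \<beta>" "1 \<le> i" "\<mu> i = 0" "a i * \<alpha> \<le> 1" "0 \<le> \<alpha>" "ys = [] \<or> hd ys \<le> x"
  shows "pmf (V \<beta> (\<mu>(i := a i * \<alpha>)) i x b ys) zs =
    rz \<alpha> \<beta> b s * pmf (V \<beta> \<mu> i (x + s) 0 ys) zs + (1 - rz \<alpha> \<beta> b s) * pmf (V \<beta> \<mu> i x' 1 ys) zs"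
proof (cases ys)
  case Nil
  then show ?thesis by (simp add: algebra_simps)
next
  case (Cons y ys')
  have tail: "V \<beta> (\<mu>(i := a i * \<alpha>)) (Suc i) y j ys' = V \<beta> \<mu> (Suc i) y j ys'" for j
    by (rule V_cong) auto
  define A B where "A = pmf (map_pmf ((#) y) (V \<beta> \<mu> (Suc i) y 0 ys')) zs"
    and "B = pmf (map_pmf ((#) (Suc y)) (V \<beta> \<mu> (Suc i) y 1 ys')) zs"
  define w where "w = vprob \<beta> (\<lambda>_. a i * \<alpha>) i (x - y) b"
  define w0 where "w0 = vprob \<beta> (\<lambda>_. 0) i (x - y + s) 0"
  define w1 where "w1 = vprob \<beta> (\<lambda>_. 0) i (x' - y) 1"
  define r where "r = rz \<alpha> \<beta> b s"
  have w: "w = r * w0 + (1 - r) * w1"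
    unfolding w_def w0_def w1_def r_def by (rule vprob_convert) fact+
  \<comment> \<open>The order y \<le> x keeps the truncated subtraction exact.\<close>
  have xy: "x + s - y = x - y + s" using assms(6) Cons by auto
  have v: "vprob \<beta> \<mu> i (x - y + s) 0 = w0" "vprob \<beta> \<mu> i (x' - y) (Suc 0) = w1"
    unfolding w0_def w1_def vprob_def using assms(3) by auto
  have 0: "0 \<le> a i * \<alpha>" using assms a_pos[of i] by simp
  have "pmf (V \<beta> (\<mu>(i := a i * \<alpha>)) i x b ys) zs = (1 - w) * A + w * B"
    unfolding Cons scan.simps A_def B_def w_def using assms 0
    by (subst pmf_bind_vker) (auto simp: tail vprob_upd)
  moreover have "pmf (V \<beta> \<mu> i (x + s) 0 ys) zs = (1 - w0) * A + w0 * B"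
    unfolding Cons scan.simps A_def B_def using assms xy v
    by (subst pmf_bind_vker) auto
  moreover have "pmf (V \<beta> \<mu> i x' 1 ys) zs = (1 - w1) * A + w1 * B"
    unfolding Cons scan.simps A_def B_def using assms xy v
    by (subst pmf_bind_vker) auto
  moreover have "(1 - w) * A + w * B = r * ((1 - w0) * A + w0 * B) + (1 - r) * ((1 - w1) * A + w1 * B)"
    unfolding w by (simp only: algebra_simps)
  ultimately show ?thesis unfolding r_def[symmetric] by simp
qed

lemma bind_V_convert:
  assumes "0 < \<beta>" "1 \<le> i" "\<mu> i = 0" "a i * \<alpha> \<le> 1" "0 \<le> \<alpha>"
    and "\<And>ys. ys \<in> set_pmf Q \<Longrightarrow> ys = [] \<or> hd ys \<le> x"
  shows "pmf (bind_pmf Q (V \<beta> (\<mu>(i := a i * \<alpha>)) i x b)) zs =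
    rz \<alpha> \<beta> b s * pmf (bind_pmf Q (V \<beta> \<mu> i (x + s) 0)) zs
    + (1 - rz \<alpha> \<beta> b s) * pmf (bind_pmf Q (V \<beta> \<mu> i x' 1)) zs"
proof -
  have int: "integrable (measure_pmf Q) (\<lambda>ys. pmf (F ys) zs)" for F :: "nat list \<Rightarrow> nat list pmf"
    by (rule measure_pmf.integrable_const_bound[where B=1]) (auto simp: pmf_le_1)
  have "pmf (bind_pmf Q (V \<beta> (\<mu>(i := a i * \<alpha>)) i x b)) zs =
     (\<integral>ys. rz \<alpha> \<beta> b s * pmf (V \<beta> \<mu> i (x + s) 0 ys) zs + (1 - rz \<alpha> \<beta> b s) * pmf (V \<beta> \<mu> i x' 1 ys) zs \<partial>measure_pmf Q)"
    unfolding pmf_bind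
    by (rule integral_cong_AE) (use V_convert[where \<mu> = \<mu> and i = i, OF assms(1-5)] assms(6) in \<open>auto simp: AE_measure_pmf_iff\<close>)
  then show ?thesis unfolding pmf_bind using int by simp
qed

end

section \<open>The exchange relation\<close>

text \<open>Dictionary: A = a i \<beta>, \<gamma> = a i \<alpha>, t = \<alpha> / \<beta>, Q =
  q^(s+1), c = 1 / Q; P, R, S are weights of geometric jumps and G, H, K powers of q. The three
  pairs treat a predecessor that stays, one that jumps, and the infinite gap in front of the first
  particle; within a pair, the final Bernoulli part is 0, then 1.\<close>

lemma exchange_algebra:
  fixes c :: real
  assumes "c * Q = 1" "t * A = \<gamma>"
  shows "P * (1 - Q) = \<gamma> * (1 - G) * R \<Longrightarrow> G = Q * H \<Longrightarrow>
      c * (1 + A * G) * P + - t * c * (A * (1 - G)) * R = P * (1 + A * H)"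
    and "P * (1 - Q) = \<gamma> * (1 - G) * R \<Longrightarrow> G = Q * H \<Longrightarrow> S * (1 - K) = R * (1 - \<gamma> * H) * (1 - G) \<Longrightarrow>
      (1 - c) * (1 + A * G) * P + (1 - - t * c) * (A * (1 - G)) * R = S * (A * (1 - K))"
    and "P * (1 - Q) = \<gamma> * (1 - G) * R \<Longrightarrow> G = Q * H \<Longrightarrow> P = (1 - \<gamma> * K) * S + \<gamma> * H * R \<Longrightarrow>
      c * P + - t * c * A * R = S * (1 - \<gamma> * K)"
    and "P * (1 - Q) = \<gamma> * (1 - G) * R \<Longrightarrow> G = Q * H \<Longrightarrow>
      (1 - c) * P + (1 - - t * c) * A * R = R * (\<gamma> * H + A)"
    and "P * (1 - Q) = \<gamma> * R \<Longrightarrow> c * P + - t * c * A * R = P"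
    and "P * (1 - Q) = \<gamma> * R \<Longrightarrow> (1 - c) * P + (1 - - t * c) * A * R = R * A"
  using assms by algebra+

context qgeom
begin

text \<open>The predecessor stays, so a Bernoulli jump leaves only the gap g - 1 for the geometric
  jump that follows. The common denominator 1 + A is dropped. For s \<ge> g both sides
  vanish.\<close>

lemma exchange_weights_0:
  assumes "A > 0"
  shows "1 / q ^ Suc s * (1 + A * q ^ g) * pgeom q g \<gamma> (Suc s)
          + (- (\<gamma> / A)) / q ^ Suc s * (A * (1 - q ^ g)) * pgeom q (g - 1) \<gamma> s
        = pgeom q g \<gamma> (Suc s) * (1 + A * q ^ (g - Suc s))" (is ?thesis1)
    and "(1 - 1 / q ^ Suc s) * (1 + A * q ^ g) * pgeom q g \<gamma> (Suc s)
          + (1 - (- (\<gamma> / A)) / q ^ Suc s) * (A * (1 - q ^ g)) * pgeom q (g - 1) \<gamma> s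
        = pgeom q g \<gamma> s * (A * (1 - q ^ (g - s)))" (is ?thesis2)
proof -
  have c: "(1 / q ^ Suc s) * q ^ Suc s = 1" using q by simp
  have t: "(\<gamma> / A) * A = \<gamma>" using assms by simp
  have d: "(- (\<gamma> / A)) / q ^ Suc s = - (\<gamma> / A) * (1 / q ^ Suc s)" by simp
  consider "g = 0" | h where "g = Suc h" "s \<le> h" | h where "g = Suc h" "h < s"
    by (metis not_less old.nat.exhaust)
  then have "?thesis1 \<and> ?thesis2"
  proof cases
    case 1
    then show ?thesis by (cases s) (auto simp: pgeom_def)
  next
    case (2 h)
    have g: "q ^ g = q ^ Suc s * q ^ (h - s)" "q ^ (g - s) = q * q ^ (h - s)"
      using 2 by (simp_all flip: power_add add: Suc_diff_le)
    have gs: "g - Suc s = h - s" "g - 1 = h" using 2 by auto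
    have r1: "pgeom q g \<gamma> (Suc s) * (1 - q ^ Suc s) = \<gamma> * (1 - q ^ g) * pgeom q h \<gamma> s"
      using pgeom_Suc_Suc[of h s] 2 by simp
    have r2: "pgeom q g \<gamma> s * (1 - q ^ (g - s)) = pgeom q h \<gamma> s * (1 - \<gamma> * q ^ (h - s)) * (1 - q ^ g)"
      using pgeom_Suc[of s h] 2 by (simp add: Suc_diff_le)
    show ?thesis unfolding gs d
      using exchange_algebra(1)[OF c t r1 g(1)] exchange_algebra(2)[OF c t r1 g(1) r2] by blast
  next
    case (3 h)
    then show ?thesis by (auto simp: pgeom_def)
  qed
  then show ?thesis1 ?thesis2 by blast+
qed

text \<open>The predecessor jumps, so the geometric jump has the gap g + 1, or g if the particle
  itself has made its Bernoulli jump. The Pascal rule enters here, and the terms \<gamma> q^k on the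
  right come from the parameter transported to this particle.\<close>

lemma exchange_weights_1:
  assumes "A > 0"
  shows "1 / q ^ Suc s * pgeom q (Suc g) \<gamma> (Suc s) + (- (\<gamma> / A)) / q ^ Suc s * A * pgeom q g \<gamma> s
        = pgeom q g \<gamma> (Suc s) * (1 - \<gamma> * q ^ (g - Suc s))" (is ?thesis1)
    and "(1 - 1 / q ^ Suc s) * pgeom q (Suc g) \<gamma> (Suc s) + (1 - (- (\<gamma> / A)) / q ^ Suc s) * A * pgeom q g \<gamma> s
        = pgeom q g \<gamma> s * (\<gamma> * q ^ (g - s) + A)" (is ?thesis2)
proof -
  have c: "(1 / q ^ Suc s) * q ^ Suc s = 1" using q by simp
  have t: "(\<gamma> / A) * A = \<gamma>" using assms by simp
  have d: "(- (\<gamma> / A)) / q ^ Suc s = - (\<gamma> / A) * (1 / q ^ Suc s)" by simp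
  have "?thesis1 \<and> ?thesis2"
  proof (cases "s \<le> g")
    case True
    have g: "q ^ Suc g = q ^ Suc s * q ^ (g - s)"
      using True by (simp flip: power_add)
    have r1: "pgeom q (Suc g) \<gamma> (Suc s) * (1 - q ^ Suc s) = \<gamma> * (1 - q ^ Suc g) * pgeom q g \<gamma> s"
      by (rule pgeom_Suc_Suc)
    have r2: "pgeom q (Suc g) \<gamma> (Suc s) = (1 - \<gamma> * q ^ (g - Suc s)) * pgeom q g \<gamma> (Suc s)
        + \<gamma> * q ^ (g - s) * pgeom q g \<gamma> s"
      by (rule pgeom_pascal) fact
    show ?thesis unfolding d
      using exchange_algebra(3)[OF c t r1 g r2] exchange_algebra(4)[OF c t r1 g] by blast
  next
    case False
    then show ?thesis by (auto simp: pgeom_def)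
  qed
  then show ?thesis1 ?thesis2 by blast+
qed

lemma pgeom_Suc_0: "pgeom q (Suc g) \<gamma> 0 = pgeom q g \<gamma> 0 * (1 - \<gamma> * q ^ g)"
  using pgeom_Suc[of 0 g] qpow_less_1[of g] by simp

lemma exchange_weights_inf:
  assumes "A > 0"
  shows "1 / q ^ Suc s * pgeom_inf q \<gamma> (Suc s) + (- (\<gamma> / A)) / q ^ Suc s * A * pgeom_inf q \<gamma> s
        = pgeom_inf q \<gamma> (Suc s)" (is ?thesis1)
    and "(1 - 1 / q ^ Suc s) * pgeom_inf q \<gamma> (Suc s) + (1 - (- (\<gamma> / A)) / q ^ Suc s) * A * pgeom_inf q \<gamma> s
        = pgeom_inf q \<gamma> s * A" (is ?thesis2)
proof -
  have c: "(1 / q ^ Suc s) * q ^ Suc s = 1" using q by simp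
  have t: "(\<gamma> / A) * A = \<gamma>" using assms by simp
  have d: "(- (\<gamma> / A)) / q ^ Suc s = - (\<gamma> / A) * (1 / q ^ Suc s)" by simp
  have r: "pgeom_inf q \<gamma> (Suc s) * (1 - q ^ Suc s) = \<gamma> * pgeom_inf q \<gamma> s"
    by (rule pgeom_inf_Suc)
  show ?thesis1 ?thesis2 unfolding d using exchange_algebra(5,6)[OF c t r] by blast+
qed

end

lemma common_denominator:
  fixes D :: real
  assumes "r * n * P + r' * m * P' = Q * k"
  shows "r * (n / D) * P + r' * (m / D) * P' = Q * (k / D)"
  using arg_cong[OF assms, of "\<lambda>z. z / D"] by (simp add: add_divide_distrib)

context particle_system
begin

text \<open>In the order Bernoulli, geometric, v is the jump probability and P0, P1 are the
  geometric weights after no jump and after a jump; P and w are the data of the opposite order. The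
  first equation concerns total increment 0, the other two the splits of a total s + 1 with
  Bernoulli part 0 and 1.\<close>

definition exchange_weights :: "real \<Rightarrow> real \<Rightarrow> real \<Rightarrow> (nat \<Rightarrow> real) \<Rightarrow> (nat \<Rightarrow> real) \<Rightarrow> (nat \<Rightarrow> real)
    \<Rightarrow> (nat \<Rightarrow> real) \<Rightarrow> bool" where
  "exchange_weights \<alpha> \<beta> v P0 P1 P w \<longleftrightarrow>
     (1 - v) * P0 0 = P 0 * (1 - w 0) \<and>
     (\<forall>s. rz \<alpha> \<beta> 0 (Suc s) * (1 - v) * P0 (Suc s) + rz \<alpha> \<beta> 1 (Suc s) * v * P1 s
           = P (Suc s) * (1 - w (Suc s)) \<and>
          (1 - rz \<alpha> \<beta> 0 (Suc s)) * (1 - v) * P0 (Suc s) + (1 - rz \<alpha> \<beta> 1 (Suc s)) * v * P1 s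
           = P s * w s)"

lemma exchange_weights_mid:
  assumes "geom_ok \<alpha>" "0 < \<beta>" "1 < i" "\<mu> i = 0" "\<mu>' i = a i * \<alpha>" "b \<le> 1" "x \<le> p"
  shows "exchange_weights \<alpha> \<beta> (vprob \<beta> \<mu> i (p - x) b) (jumpw \<alpha> i (p + b - x)) (jumpw \<alpha> i (p + b - (x + 1)))
    (jumpw \<alpha> i (p - x)) (\<lambda>k. vprob \<beta> \<mu>' i (p - (x + k)) b)"
proof -
  interpret qgeom q "a i * \<alpha>" using assms by (intro geom_okD) auto
  define A where "A = a i * \<beta>"
  define D where "D = 1 + A"
  define g where "g = p - x"
  have A: "A > 0" using a_pos[of i] assms by (simp add: A_def)
  then have D: "D > 0" by (simp add: D_def)
  have ab: "\<alpha> / \<beta> = a i * \<alpha> / A" using assms a_pos[of i] by (simp add: A_def)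
  have pk: "p - (x + k) = g - k" for k by (simp add: g_def)
  consider "b = 0" | "b = 1" using assms(6) by linarith
  then show ?thesis
  proof cases
    case 1
    have gb: "p + b - x = g" "p + b - (x + 1) = g - 1" using 1 by (auto simp: g_def)
    have v: "vprob \<beta> \<mu> i g b = A * (1 - q ^ g) / D" "1 - vprob \<beta> \<mu> i g b = (1 + A * q ^ g) / D"
      using 1 D by (simp_all add: vprob_def A_def D_def field_simps)
    have w: "vprob \<beta> \<mu>' i k b = A * (1 - q ^ k) / D" "1 - vprob \<beta> \<mu>' i k b = (1 + A * q ^ k) / D" for k
      using 1 D by (simp_all add: vprob_def A_def D_def field_simps)
    note e = exchange_weights_0[OF A, of _ g]
    show ?thesis unfolding exchange_weights_def pk gb g_def[symmetric] v(2) w(2) unfolding v(1) w(1) rz_def ab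
    proof (intro conjI allI, goal_cases)
      case 1
      then show ?case by (simp add: mult_ac)
    next
      case (2 s)
      show ?case using e(1)[of s] assms(3) by (intro common_denominator) (simp add: jumpw_def)
    next
      case (3 s)
      show ?case using e(2)[of s] assms(3) by (intro common_denominator) (simp add: jumpw_def)
    qed
  next
    case 2
    have gb: "p + b - x = Suc g" "p + b - (x + 1) = g" using 2 assms(7) by (auto simp: g_def)
    have v: "vprob \<beta> \<mu> i g b = A / D" "1 - vprob \<beta> \<mu> i g b = 1 / D"
      using 2 D assms(4) by (simp_all add: vprob_def A_def D_def field_simps)
    have w: "vprob \<beta> \<mu>' i k b = (a i * \<alpha> * q ^ k + A) / D" "1 - vprob \<beta> \<mu>' i k b = (1 - a i * \<alpha> * q ^ k) / D" for k
      using 2 D assms(5) by (simp_all add: vprob_def A_def D_def field_simps)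
    note e = exchange_weights_1[OF A, of _ g]
    show ?thesis unfolding exchange_weights_def pk gb g_def[symmetric] v(2) w(2) unfolding v(1) w(1) rz_def ab
    proof (intro conjI allI, goal_cases)
      case 1
      then show ?case using assms(3) by (simp add: jumpw_def pgeom_Suc_0)
    next
      case (2 s)
      show ?case using e(1)[of s] assms(3) by (intro common_denominator) (simp add: jumpw_def)
    next
      case (3 s)
      show ?case using e(2)[of s] assms(3) by (intro common_denominator) (simp add: jumpw_def)
    qed
  qed
qed

lemma exchange_weights_first:
  assumes "geom_ok \<alpha>" "0 < \<beta>" "\<mu> 1 = 0" "\<mu>' 1 = 0"
  shows "exchange_weights \<alpha> \<beta> (vprob \<beta> \<mu> 1 g 1) (jumpw \<alpha> 1 g0) (jumpw \<alpha> 1 g1)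
    (jumpw \<alpha> 1 g2) (\<lambda>k. vprob \<beta> \<mu>' 1 (h k) 1)"
proof -
  interpret qgeom q "a 1 * \<alpha>" using assms by (intro geom_okD) auto
  define A where "A = a 1 * \<beta>"
  define D where "D = 1 + A"
  have A: "A > 0" using a_pos[of 1] assms by (simp add: A_def)
  then have D: "D > 0" by (simp add: D_def)
  have ab: "\<alpha> / \<beta> = a 1 * \<alpha> / A" using assms a_pos[of 1] by (simp add: A_def)
  have v: "vprob \<beta> \<mu> 1 k 1 = A / D" "1 - vprob \<beta> \<mu> 1 k 1 = 1 / D" for k
    using D assms(3) by (simp_all add: vprob_def A_def D_def field_simps)
  have w: "vprob \<beta> \<mu>' 1 k 1 = A / D" "1 - vprob \<beta> \<mu>' 1 k 1 = 1 / D" for k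
    using D assms(4) by (simp_all add: vprob_def A_def D_def field_simps)
  note e = exchange_weights_inf[OF A]
  show ?thesis unfolding exchange_weights_def v(2) w(2) unfolding v(1) w(1) rz_def ab
  proof (intro conjI allI, goal_cases)
    case 1
    then show ?case by (simp add: jumpw_def)
  next
    case (2 s)
    show ?case using e(1)[of s] by (intro common_denominator) (simp add: jumpw_def)
  next
    case (3 s)
    show ?case using e(2)[of s] by (intro common_denominator) (simp add: jumpw_def)
  qed
qed

text \<open>Particle i is stripped off both sides. On the left the tail law depends, by the
  induction hypothesis, only on the Bernoulli part j (\<open>W j\<close>); on the right it also
  depends on the geometric part k (\<open>U k j\<close>). Writing \<open>W\<close> as a signed
  mixture of \<open>U\<close>s leaves the scalar equations of \<open>exchange_weights\<close>. The
  positions p, p', p'' stay independent so that the step serves interior particles, where p' = p + b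
  and p'' = p, as well as the first one.\<close>

lemma exchange_step:
  assumes ok: "geom_ok \<alpha>" "0 < \<beta>" and i: "1 \<le> i" "lo \<le> i" "i < hi"
    and \<mu>: "0 \<le> \<mu> i" "\<mu> i \<le> 1" "0 \<le> \<mu>' i" "\<mu>' i \<le> 1"
    and w: "exchange_weights \<alpha> \<beta> (vprob \<beta> \<mu> i (p - x) b) (jumpw \<alpha> i (p' - x)) (jumpw \<alpha> i (p' - (x + 1)))
       (jumpw \<alpha> i (p'' - x)) (\<lambda>k. vprob \<beta> \<mu>' i (p - (x + k)) b)"
    and IH: "\<And>j k. j \<le> 1 \<Longrightarrow> bind_pmf (V \<beta> \<mu> (Suc i) x j xs) (J \<alpha> lo hi (Suc i) (x + j) k) =
       bind_pmf (J \<alpha> lo hi (Suc i) x 0 xs) (V \<beta> (\<eta>(Suc i := a (Suc i) * \<alpha>)) (Suc i) x j)"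
    and \<eta>: "\<eta> (Suc i) = 0" "\<And>k. i < k \<Longrightarrow> \<mu>' k = \<eta> k"
    and sorted: "sorted_wrt (\<ge>) (x # xs)"
  shows "bind_pmf (V \<beta> \<mu> i p b (x # xs)) (J \<alpha> lo hi i p' c) =
         bind_pmf (J \<alpha> lo hi i p'' d (x # xs)) (V \<beta> \<mu>' i p b)"
proof -
  define Q where "Q = J \<alpha> lo hi (Suc i) x 0 xs"
  define W where "W j = bind_pmf Q (V \<beta> (\<eta>(Suc i := a (Suc i) * \<alpha>)) (Suc i) x j)" for j
  define U where "U k j = bind_pmf Q (V \<beta> \<eta> (Suc i) (x + k) j)" for k j
  have ja: "jker \<alpha> lo hi i p d x = embed_pmf (jumpw \<alpha> i (p - x))" for p d x
    using i by (simp add: jker_def)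
  \<comment> \<open>The geometric jump of particle i does not look at the tail, so it may be drawn
    before it.\<close>
  have L1: "bind_pmf (V \<beta> \<mu> (Suc i) x j xs) (\<lambda>ys. J \<alpha> lo hi i p' c ((x + j) # ys)) =
      bind_pmf (embed_pmf (jumpw \<alpha> i (p' - (x + j)))) (\<lambda>k. map_pmf ((#) (x + j + k)) (W j))" if "j \<le> 1" for j
    unfolding scan.simps W_def Q_def IH[OF that, symmetric] ja map_bind_pmf
    by (subst bind_commute_pmf) (simp add: IH[OF that] that flip: map_bind_pmf)
  have L: "bind_pmf (V \<beta> \<mu> i p b (x # xs)) (J \<alpha> lo hi i p' c) =
      bind_pmf (vker \<beta> \<mu> i p b x) (\<lambda>j. bind_pmf (embed_pmf (jumpw \<alpha> i (p' - (x + j)))) (\<lambda>k. map_pmf ((#) (x + j + k)) (W j)))"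
    unfolding scan.simps(2)[of _ _ _ _ x xs] bind_assoc_pmf bind_map_pmf
  proof (intro bind_pmf_cong refl L1)
    fix j assume "j \<in> set_pmf (vker \<beta> \<mu> i p b x)"
    then show "j \<le> 1" by (auto simp: vker_def)
  qed
  have tail: "V \<beta> \<mu>' (Suc i) y j ys = V \<beta> \<eta> (Suc i) y j ys" for y j ys
    by (rule V_cong) (use \<eta> in auto)
  have R1: "bind_pmf (J \<alpha> lo hi (Suc i) x k xs) (\<lambda>ys. V \<beta> \<mu>' i p b ((x + k) # ys)) =
      bind_pmf (vker \<beta> \<mu>' i p b (x + k)) (\<lambda>j. map_pmf ((#) (x + k + j)) (U k j))" for k
    unfolding scan.simps U_def Q_def map_bind_pmf J_ignores_jump[of \<alpha> lo hi "Suc i" x k xs 0] tail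
    by (subst bind_commute_pmf) simp
  have R: "bind_pmf (J \<alpha> lo hi i p'' d (x # xs)) (V \<beta> \<mu>' i p b) =
      bind_pmf (embed_pmf (jumpw \<alpha> i (p'' - x))) (\<lambda>k. bind_pmf (vker \<beta> \<mu>' i p b (x + k)) (\<lambda>j. map_pmf ((#) (x + k + j)) (U k j)))"
    unfolding scan.simps(2)[of _ _ _ _ x xs] bind_assoc_pmf bind_map_pmf R1 ja ..
  \<comment> \<open>In \<open>W\<close> the predecessor of particle i + 1 is still at x; in the two
    laws \<open>U\<close> it has moved to x + s or x + s', and the parameter of particle i + 1 is
    0.\<close>
  have conv: "pmf (W j) zs = rz \<alpha> \<beta> j s * pmf (U s 0) zs + (1 - rz \<alpha> \<beta> j s) * pmf (U s' 1) zs" for j s s' zs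
    unfolding W_def U_def
  proof (rule bind_V_convert[where i = "Suc i" and x = x])
    show "a (Suc i) * \<alpha> \<le> 1" "0 \<le> \<alpha>" using ok by (auto simp: geom_ok_def less_imp_le)
    show "ys = [] \<or> hd ys \<le> x" if "ys \<in> set_pmf Q" for ys
      using sorted_J[OF ok(1) _ sorted that[unfolded Q_def]] i by (cases ys) auto
  qed (use ok \<eta> in auto)
  note pj = pmf_jump[OF ok(1) i(1)]
  note pv = pmf_bind_vker[where i = i and \<mu> = \<mu>, OF ok(2) i(1) \<mu>(1,2)]
    pmf_bind_vker[where i = i and \<mu> = \<mu>', OF ok(2) i(1) \<mu>(3,4)]
  define v where "v = vprob \<beta> \<mu> i (p - x) b"
  define w' where "w' = (\<lambda>k. vprob \<beta> \<mu>' i (p - (x + k)) b)"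
  define P0 where "P0 = jumpw \<alpha> i (p' - x)"
  define P1 where "P1 = jumpw \<alpha> i (p' - (x + 1))"
  define P where "P = jumpw \<alpha> i (p'' - x)"
  show ?thesis unfolding L R
  proof (rule pmf_eqI)
    fix zs' :: "nat list"
    show "pmf (bind_pmf (vker \<beta> \<mu> i p b x) (\<lambda>j. bind_pmf (embed_pmf (jumpw \<alpha> i (p' - (x + j)))) (\<lambda>k. map_pmf ((#) (x + j + k)) (W j)))) zs'
      = pmf (bind_pmf (embed_pmf (jumpw \<alpha> i (p'' - x))) (\<lambda>k. bind_pmf (vker \<beta> \<mu>' i p b (x + k)) (\<lambda>j. map_pmf ((#) (x + k + j)) (U k j)))) zs'"
      (is "pmf ?L _ = pmf ?R _")
    proof (cases zs')
      case Nil
      have "[] \<notin> set_pmf ?L" "[] \<notin> set_pmf ?R" by auto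
      then show ?thesis unfolding Nil by (simp only: set_pmf_iff) simp
    next
      case (Cons z zs)
      have l: "pmf ?L (z # zs) = (1 - v) * (if x \<le> z then P0 (z - x) * pmf (W 0) zs else 0)
         + v * (if x + 1 \<le> z then P1 (z - (x + 1)) * pmf (W 1) zs else 0)"
        unfolding pv pmf_bind_map_Cons pj v_def P0_def P1_def by simp
      define G where "G k = bind_pmf (vker \<beta> \<mu>' i p b (x + k)) (\<lambda>j. map_pmf ((#) (x + k + j)) (U k j))" for k
      have G: "pmf (G k) (z # zs) = (1 - w' k) * (if x + k = z then pmf (U k 0) zs else 0)
         + w' k * (if x + k + 1 = z then pmf (U k 1) zs else 0)" for k
        unfolding G_def pv pmf_map_Cons w'_def by simp
      have "pmf ?R (z # zs) = (\<integral>k. pmf (G k) (z # zs) \<partial>measure_pmf (embed_pmf (jumpw \<alpha> i (p'' - x))))"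
        unfolding pmf_bind G_def ..
      also have "\<dots> = (\<Sum>k\<in>{k. x + k = z \<or> x + k + 1 = z}. pmf (G k) (z # zs) * pmf (embed_pmf (jumpw \<alpha> i (p'' - x))) k)"
      proof (rule integral_measure_pmf_real)
        show "finite {k. x + k = z \<or> x + k + 1 = z}" by (rule finite_subset[of _ "{..z}"]) auto
      qed (auto simp: G split: if_splits)
      finally have r: "pmf ?R (z # zs) = (\<Sum>k\<in>{k. x + k = z \<or> x + k + 1 = z}. pmf (G k) (z # zs) * P k)"
        unfolding pj P_def .
      have w0: "(1 - v) * P0 0 = P 0 * (1 - w' 0)"
        and w1: "rz \<alpha> \<beta> 0 (Suc s) * (1 - v) * P0 (Suc s) + rz \<alpha> \<beta> 1 (Suc s) * v * P1 s = P (Suc s) * (1 - w' (Suc s))"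
        and w2: "(1 - rz \<alpha> \<beta> 0 (Suc s)) * (1 - v) * P0 (Suc s) + (1 - rz \<alpha> \<beta> 1 (Suc s)) * v * P1 s = P s * w' s" for s
        using w unfolding exchange_weights_def v_def w'_def P0_def P1_def P_def by auto
      consider "z < x" | "z = x" | s where "z = x + Suc s"
        by (metis add_Suc_right less_iff_Suc_add linorder_neqE_nat)
      then show ?thesis unfolding Cons
      proof cases
        case 1
        then have "{k. x + k = z \<or> x + k + 1 = z} = {}" by auto
        then show "pmf ?L (z # zs) = pmf ?R (z # zs)" using 1 unfolding l r by simp
      next
        case 2
        then have "{k. x + k = z \<or> x + k + 1 = z} = {0}" by auto
        then have "pmf ?R (z # zs) = P 0 * (1 - w' 0) * pmf (U 0 0) zs"
          unfolding r using 2 G[of 0] by simp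
        moreover have "pmf ?L (z # zs) = (1 - v) * P0 0 * pmf (W 0) zs"
          unfolding l using 2 by simp
        moreover have "pmf (W 0) zs = pmf (U 0 0) zs" using conv[of 0 zs 0] by (simp add: rz_def)
        ultimately show "pmf ?L (z # zs) = pmf ?R (z # zs)" using w0 by simp
      next
        case (3 s)
        define u0 where "u0 = pmf (U (Suc s) 0) zs"
        define u1 where "u1 = pmf (U s 1) zs"
        \<comment> \<open>On the right a total increment s + 1 has geometric part s + 1 or s, the
          rest being the Bernoulli jump.\<close>
        have "{k. x + k = z \<or> x + k + 1 = z} = {Suc s, s}" using 3 by auto
        then have "pmf ?R (z # zs) = P (Suc s) * (1 - w' (Suc s)) * u0 + P s * w' s * u1"
          unfolding r using 3 G[of s] G[of "Suc s"] by (simp add: u0_def u1_def mult_ac)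
        also have "\<dots> = (1 - v) * P0 (Suc s) * (rz \<alpha> \<beta> 0 (Suc s) * u0 + (1 - rz \<alpha> \<beta> 0 (Suc s)) * u1)
            + v * P1 s * (rz \<alpha> \<beta> 1 (Suc s) * u0 + (1 - rz \<alpha> \<beta> 1 (Suc s)) * u1)"
          unfolding w1[symmetric] w2[symmetric] by (simp only: algebra_simps)
        also have "\<dots> = (1 - v) * P0 (Suc s) * pmf (W 0) zs + v * P1 s * pmf (W 1) zs"
          unfolding conv[of _ zs "Suc s" s] u0_def u1_def ..
        also have "\<dots> = pmf ?L (z # zs)"
          unfolding l using 3 by (simp add: mult_ac)
        finally show "pmf ?L (z # zs) = pmf ?R (z # zs)" by simp
      qed
    qed
  qed
qed

text \<open>The predecessor of particle i takes no part in the geometric move: it is seen at p + b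
  after the row and at p before it. In the recursion particle i plays this role for particle i + 1,
  and \<open>exchange_step\<close> then shifts the parameter from i + 1 to i.\<close>

lemma exchange_mid:
  assumes ok: "geom_ok \<alpha>" "0 < \<beta>"
    and \<mu>: "\<And>k. 0 \<le> \<mu> k" "\<And>k. \<mu> k \<le> 1"
    and "1 < i" "lo \<le> i" "i \<le> hi" "\<And>k. i \<le> k \<Longrightarrow> k < hi \<Longrightarrow> \<mu> k = 0"
    and "i + length xs \<le> hi \<or> \<mu> hi = a hi * \<alpha>"
    and "sorted_wrt (\<ge>) (p # xs)" "b \<le> 1"
  shows "bind_pmf (V \<beta> \<mu> i p b xs) (J \<alpha> lo hi i (p + b) c) =
         bind_pmf (J \<alpha> lo hi i p d xs) (V \<beta> (\<mu>(hi := 0, i := a i * \<alpha>)) i p b)"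
  using assms(5-)
proof (induction xs arbitrary: i p b c d)
  case Nil
  then show ?case by (simp add: bind_return_pmf)
next
  case (Cons x xs)
  show ?case
  proof (cases "i = hi")
    case True
    \<comment> \<open>Here hi lies within the list, so its parameter is already a hi \<alpha> and
      the two updates together change nothing.\<close>
    then have upd: "\<mu>(hi := 0, i := a i * \<alpha>) = \<mu>" using Cons.prems(5) by auto
    show ?thesis unfolding upd using True
      by (simp add: J_trivial_ge bind_return_pmf bind_return_pmf' del: scan.simps)
  next
    case False
    then have hi: "i < hi" using Cons.prems by simp
    have ai: "0 \<le> a i * \<alpha>" "a i * \<alpha> \<le> 1"
      using ok a_pos[of i] Cons.prems(1) by (auto simp: geom_ok_def less_imp_le)
    show ?thesis
    proof (rule exchange_step[where \<eta> = "\<mu>(hi := 0)"])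
      show "exchange_weights \<alpha> \<beta> (vprob \<beta> \<mu> i (p - x) b) (jumpw \<alpha> i (p + b - x)) (jumpw \<alpha> i (p + b - (x + 1)))
        (jumpw \<alpha> i (p - x)) (\<lambda>k. vprob \<beta> (\<mu>(hi := 0, i := a i * \<alpha>)) i (p - (x + k)) b)"
        using ok Cons.prems hi by (intro exchange_weights_mid) auto
      show "bind_pmf (V \<beta> \<mu> (Suc i) x j xs) (J \<alpha> lo hi (Suc i) (x + j) k) =
        bind_pmf (J \<alpha> lo hi (Suc i) x 0 xs) (V \<beta> (\<mu>(hi := 0, Suc i := a (Suc i) * \<alpha>)) (Suc i) x j)"
        if "j \<le> 1" for j k
        using that Cons.prems hi by (intro Cons.IH) auto
      show "(\<mu>(hi := 0)) (Suc i) = 0" using Cons.prems(4)[of "Suc i"] hi by (cases "Suc i = hi") auto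
    qed (use ok \<mu> ai Cons.prems hi in auto)
  qed
qed

text \<open>Particles in front of lo only pass on their Bernoulli increments until
  \<open>exchange_mid\<close> takes over. As hi lies behind the end of the list, no parameter is
  consumed there, yet one appears at lo. The order relative to p is demanded only at i = lo, because
  p is a dummy in front of the first particle.\<close>

lemma exchange_suffix:
  assumes ok: "geom_ok \<alpha>" "0 < \<beta>"
    and \<mu>: "\<And>k. 0 \<le> \<mu> k" "\<And>k. \<mu> k \<le> 1"
    and "1 < lo" "i \<le> lo" "\<And>k. lo \<le> k \<Longrightarrow> \<mu> k = 0"
    and "i + length xs \<le> hi" "i = lo \<Longrightarrow> sorted_wrt (\<ge>) (p # xs)" "sorted_wrt (\<ge>) xs" "b \<le> 1"
    and "lo \<le> hi"
  shows "bind_pmf (V \<beta> \<mu> i p b xs) (J \<alpha> lo hi i (p + b) c) =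
         bind_pmf (J \<alpha> lo hi i p d xs) (V \<beta> (\<mu>(lo := a lo * \<alpha>)) i p b)"
  using assms(6,8-11)
proof (induction xs arbitrary: i p b c d)
  case Nil
  then show ?case by (simp add: bind_return_pmf)
next
  case (Cons x xs)
  show ?case
  proof (cases "i = lo")
    case True
    have upd: "\<mu>(lo := a lo * \<alpha>) = \<mu>(hi := 0, i := a i * \<alpha>)" using assms(7)[of hi] assms(12) True by auto
    show ?thesis unfolding upd by (rule exchange_mid) (use True Cons.prems assms in auto)
  next
    case False
    then have i: "i < lo" using Cons.prems by simp
    have j0: "jker \<alpha> lo hi i p b x = return_pmf 0" for p b x using i by (simp add: jker_def)
    have vk: "vker \<beta> (\<mu>(lo := a lo * \<alpha>)) i p b x = vker \<beta> \<mu> i p b x" using i by (simp add: vker_def vprob_def)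
    have "bind_pmf (V \<beta> \<mu> i p b (x # xs)) (J \<alpha> lo hi i (p + b) c)
       = bind_pmf (vker \<beta> \<mu> i p b x) (\<lambda>j. map_pmf ((#) (x + j)) (bind_pmf (V \<beta> \<mu> (Suc i) x j xs) (J \<alpha> lo hi (Suc i) (x + j) 0)))"
      by (simp add: bind_assoc_pmf bind_map_pmf j0 bind_return_pmf map_bind_pmf)
    also have "\<dots> = bind_pmf (vker \<beta> \<mu> i p b x) (\<lambda>j. map_pmf ((#) (x + j)) (bind_pmf (J \<alpha> lo hi (Suc i) x 0 xs) (V \<beta> (\<mu>(lo := a lo * \<alpha>)) (Suc i) x j)))"
    proof (rule bind_pmf_cong[OF refl], rule arg_cong[where f = "map_pmf _"], rule Cons.IH)
      fix j assume "j \<in> set_pmf (vker \<beta> \<mu> i p b x)"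
      then show "j \<le> 1" by (auto simp: vker_def)
    qed (use Cons.prems i in auto)
    also have "\<dots> = bind_pmf (J \<alpha> lo hi i p d (x # xs)) (V \<beta> (\<mu>(lo := a lo * \<alpha>)) i p b)"
      by (simp add: bind_assoc_pmf bind_map_pmf j0 bind_return_pmf map_bind_pmf vk)
        (subst bind_commute_pmf, rule refl)
    finally show ?thesis .
  qed
qed

text \<open>From particle 2 on this is the interior exchange, which would leave the parameter at 2.
  The step at particle 1 absorbs it and leaves nothing behind: in front of particle 1 the gap is
  infinite and a term \<mu> q^g would be 0.\<close>

lemma exchange_prefix:
  assumes ok: "geom_ok \<alpha>" "0 < \<beta>"
    and \<mu>: "\<And>k. 0 \<le> \<mu> k" "\<And>k. \<mu> k \<le> 1"
    and "1 < hi" "\<And>k. k < hi \<Longrightarrow> \<mu> k = 0" "\<mu> hi = a hi * \<alpha>"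
    and "sorted_wrt (\<ge>) xs"
  shows "bind_pmf (V \<beta> \<mu> 1 p 1 xs) (J \<alpha> 1 hi 1 p' c) =
         bind_pmf (J \<alpha> 1 hi 1 p'' d xs) (V \<beta> (\<mu>(hi := 0)) 1 p 1)"
proof (cases xs)
  case Nil
  then show ?thesis by (simp add: bind_return_pmf)
next
  case (Cons x xs')
  have ai: "0 \<le> a 2 * \<alpha>" "a 2 * \<alpha> \<le> 1"
    using ok a_pos[of 2] by (auto simp: geom_ok_def less_imp_le)
  show ?thesis unfolding Cons
  proof (rule exchange_step[where \<eta> = "\<mu>(hi := 0)"])
    show "exchange_weights \<alpha> \<beta> (vprob \<beta> \<mu> 1 (p - x) 1) (jumpw \<alpha> 1 (p' - x)) (jumpw \<alpha> 1 (p' - (x + 1)))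
        (jumpw \<alpha> 1 (p'' - x)) (\<lambda>k. vprob \<beta> (\<mu>(hi := 0)) 1 (p - (x + k)) 1)"
      using ok assms by (intro exchange_weights_first) auto
    show "bind_pmf (V \<beta> \<mu> (Suc 1) x j xs') (J \<alpha> 1 hi (Suc 1) (x + j) k) =
        bind_pmf (J \<alpha> 1 hi (Suc 1) x 0 xs') (V \<beta> (\<mu>(hi := 0, Suc 1 := a (Suc 1) * \<alpha>)) (Suc 1) x j)"
      if "j \<le> 1" for j k
      using that assms Cons by (intro exchange_mid) auto
    show "(\<mu>(hi := 0)) (Suc 1) = 0" using assms(5) assms(6)[of "Suc 1"] by (cases "Suc 1 = hi") auto
  qed (use assms Cons ai in auto)
qed

section \<open>Splitting and commuting geometric moves\<close>

lemma J_cong_lo: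
  assumes "lo \<le> i" "lo' \<le> i"
  shows "J \<alpha> lo hi i p b xs = J \<alpha> lo' hi i p d xs"
  using assms
proof (induction xs arbitrary: i p b d)
  case (Cons x xs)
  have "J \<alpha> lo hi (Suc i) x j xs = J \<alpha> lo' hi (Suc i) x j xs" for j
    using Cons by simp
  moreover have "jker \<alpha> lo hi i p b x = jker \<alpha> lo' hi i p d x" using Cons.prems by (simp add: jker_def)
  ultimately show ?case by simp
qed simp

text \<open>The update is parallel, so the rear particles have to go first: they still see the front
  ones in their old positions, while the front particles never look back.\<close>

lemma J_split:
  assumes "i \<le> m" "m \<le> hi" "lo \<le> m"
  shows "bind_pmf (J \<alpha> m hi i p b xs) (J \<alpha> lo m i p c) = J \<alpha> lo hi i p d xs"
  using assms
proof (induction xs arbitrary: i p b c d)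
  case Nil
  then show ?case by (simp add: bind_return_pmf)
next
  case (Cons x xs)
  show ?case
  proof (cases "i = m")
    case True
    have "J \<alpha> m hi i p b (x # xs) = J \<alpha> lo hi i p d (x # xs)"
      using True assms(3) by (intro J_cong_lo) auto
    then show ?thesis using True by (simp add: J_trivial_ge bind_return_pmf' del: scan.simps)
  next
    case False
    then have i: "i < m" using Cons.prems by simp
    have "bind_pmf (J \<alpha> m hi i p b (x # xs)) (J \<alpha> lo m i p c) =
        bind_pmf (J \<alpha> m hi (Suc i) x 0 xs) (\<lambda>ys. bind_pmf (jker \<alpha> lo m i p c x) (\<lambda>j. map_pmf ((#) (x + j)) (J \<alpha> lo m (Suc i) x j ys)))"
      using i by (simp add: bind_assoc_pmf bind_map_pmf bind_return_pmf jker_def)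
    also have "\<dots> = bind_pmf (jker \<alpha> lo m i p c x) (\<lambda>j. map_pmf ((#) (x + j)) (bind_pmf (J \<alpha> m hi (Suc i) x 0 xs) (J \<alpha> lo m (Suc i) x j)))"
      by (subst bind_commute_pmf) (simp add: map_bind_pmf)
    also have "\<dots> = bind_pmf (jker \<alpha> lo m i p c x) (\<lambda>j. map_pmf ((#) (x + j)) (J \<alpha> lo hi (Suc i) x j xs))"
      using i Cons.prems by (intro bind_pmf_cong refl arg_cong[where f = "map_pmf _"] Cons.IH) auto
    also have "jker \<alpha> lo m i p c x = jker \<alpha> lo hi i p d x"
      using i assms(2) by (simp add: jker_def)
    finally show ?thesis by simp
  qed
qed

text \<open>Since m < lo, the predecessor of particle lo is moved by neither side, so the rear block
  sees the same gaps in either order.\<close>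

lemma J_commute:
  assumes "m < lo"
  shows "bind_pmf (J \<alpha> l m i p c xs) (J \<alpha>' lo hi i p' b) = bind_pmf (J \<alpha>' lo hi i p' b xs) (J \<alpha> l m i p c)"
proof (induction xs arbitrary: i p p' b c)
  case Nil
  then show ?case by (simp add: bind_return_pmf)
next
  case (Cons x xs)
  show ?case
  proof (cases "m \<le> i")
    case True
    then show ?thesis by (simp add: J_trivial_ge bind_return_pmf bind_return_pmf' del: scan.simps)
  next
    case False
    then have i: "i < m" by simp
    have j0: "jker \<alpha>' lo hi i p b x = return_pmf 0" for p b x using i assms by (simp add: jker_def)
    have ign: "J \<alpha>' lo hi (Suc i) (x + j) 0 ys = J \<alpha>' lo hi (Suc i) x 0 ys" for j ys
      using i assms by (intro J_ignores_carry) auto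
    have ign': "J \<alpha> l m (Suc i) x j ys = J \<alpha> l m (Suc i) x 0 ys" for j ys
      by (rule J_ignores_jump)
    have unused: "bind_pmf (J \<alpha> l m (Suc i) x j xs) (\<lambda>ys. map_pmf f (J \<alpha>' lo hi (Suc i) (x + j) 0 ys)) =
        bind_pmf (J \<alpha> l m (Suc i) x 0 xs) (\<lambda>ys. map_pmf f (J \<alpha>' lo hi (Suc i) x 0 ys))" for j f
      unfolding ign'[of j] ign ..
    have unused': "bind_pmf (J \<alpha>' lo hi (Suc i) x 0 xs) (\<lambda>ys. map_pmf f (J \<alpha> l m (Suc i) x 0 ys)) =
        bind_pmf (J \<alpha>' lo hi (Suc i) x 0 xs) (\<lambda>ys. map_pmf f (J \<alpha> l m (Suc i) x j ys))" for j f
      unfolding ign'[of j] ..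
    have "bind_pmf (J \<alpha> l m i p c (x # xs)) (J \<alpha>' lo hi i p' b) =
       bind_pmf (jker \<alpha> l m i p c x) (\<lambda>j. map_pmf ((#) (x + j)) (bind_pmf (J \<alpha> l m (Suc i) x 0 xs) (J \<alpha>' lo hi (Suc i) x 0)))"
      by (simp add: bind_assoc_pmf bind_map_pmf bind_return_pmf j0 map_bind_pmf unused)
    also have "\<dots> = bind_pmf (J \<alpha>' lo hi i p' b (x # xs)) (J \<alpha> l m i p c)"
      unfolding Cons.IH[of "Suc i"]
      by (simp add: bind_assoc_pmf bind_map_pmf bind_return_pmf j0 map_bind_pmf)
        (subst (2) bind_commute_pmf, rule bind_pmf_cong[OF refl], rule unused')
    finally show ?thesis .
  qed
qed

end

section \<open>Laws along time-like paths\<close>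

fun path_law :: "(nat \<Rightarrow> nat) \<Rightarrow> (nat \<Rightarrow> nat) \<Rightarrow> (nat \<Rightarrow> nat \<Rightarrow> nat list \<Rightarrow> nat list pmf)
    \<Rightarrow> (nat \<Rightarrow> nat list \<Rightarrow> nat list pmf) \<Rightarrow> nat \<Rightarrow> nat \<Rightarrow> nat list \<Rightarrow> nat list pmf" where
  "path_law Np Tp KV KH t 0 x = return_pmf []"
| "path_law Np Tp KV KH t (Suc k) x =
     bind_pmf (if Tp (Suc t) = Tp t + 1 then KV (Np (Suc t)) (Tp (Suc t)) x else KH (Np (Suc t)) x)
       (\<lambda>y. map_pmf ((#) (y ! (Np (Suc t) - 1))) (path_law Np Tp KV KH (Suc t) k y))"

lemma path_law_Suc:
  "path_law Np Tp KV KH t (Suc k) = (\<lambda>x.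
     bind_pmf (if Tp (Suc t) = Tp t + 1 then KV (Np (Suc t)) (Tp (Suc t)) x else KH (Np (Suc t)) x)
       (\<lambda>y. map_pmf ((#) (y ! (Np (Suc t) - 1))) (path_law Np Tp KV KH (Suc t) k y)))"
  by (rule ext) simp

locale mixed_system = particle_system +
  fixes u \<nu> :: "nat \<Rightarrow> real" and Np Tp :: "nat \<Rightarrow> nat" and M n :: nat
  assumes u: "\<And>T. 1 \<le> T \<Longrightarrow> u T < 0"
    and \<nu>_1: "\<nu> 1 = 0" and \<nu>: "\<And>N. 2 \<le> N \<Longrightarrow> 0 < \<nu> N" "\<And>N. 2 \<le> N \<Longrightarrow> \<nu> N < 1"
    and a\<nu>: "\<And>i j. 1 \<le> i \<Longrightarrow> 1 \<le> j \<Longrightarrow> a i * (\<nu> j / a j) < 1"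
    and path: "timelike_path Np Tp M"
    and n: "n = Np M"
begin

abbreviation cc :: "nat \<Rightarrow> real" where "cc N \<equiv> \<nu> N / a N"

text \<open>A row carries \<nu> j at particle j once it has been exchanged with E_j or with D_j. At
  each stage of the argument these j form an interval.\<close>

definition \<nu>_on :: "nat \<Rightarrow> nat \<Rightarrow> nat \<Rightarrow> real" where
  "\<nu>_on lo hi j = (if lo < j \<and> j \<le> hi then \<nu> j else 0)"

text \<open>The first particle moves as if its predecessor had jumped (\<open>b = 1\<close>); since its parameter is \<open>0\<close>,
  the gap in front of it is irrelevant.\<close>

abbreviation Vm :: "real \<Rightarrow> (nat \<Rightarrow> real) \<Rightarrow> nat list \<Rightarrow> nat list pmf" where
  "Vm \<beta> \<mu> \<equiv> V \<beta> \<mu> 1 0 1"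

abbreviation Em :: "nat \<Rightarrow> nat list \<Rightarrow> nat list pmf" where
  "Em N \<equiv> J (cc N) N (Suc n) 1 0 0"

abbreviation Dm :: "nat \<Rightarrow> nat list \<Rightarrow> nat list pmf" where
  "Dm N \<equiv> J (cc N) 1 N 1 0 0"

abbreviation Gm :: "nat \<Rightarrow> nat list \<Rightarrow> nat list pmf" where
  "Gm N \<equiv> J (cc N) 1 (Suc n) 1 0 0"

definition states :: "nat list set" where
  "states = {xs. length xs = n \<and> sorted_wrt (\<ge>) xs}"

lemma geom_ok_cc: "2 \<le> N \<Longrightarrow> geom_ok (cc N)"
  using \<nu>(1)[of N] a_pos[of N] a\<nu>[of _ N] by (auto simp: geom_ok_def)

lemma \<nu>_on_bounds: "1 \<le> lo \<Longrightarrow> 0 \<le> \<nu>_on lo hi j" "1 \<le> lo \<Longrightarrow> \<nu>_on lo hi j \<le> 1"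
  using \<nu>[of j] by (auto simp: \<nu>_on_def less_imp_le)

lemma path_0: "Np 0 = 1" "Tp 0 = 0"
  using path by (auto simp: timelike_path_def)

lemma path_step:
  assumes "t < M"
  obtains "Np (Suc t) = Np t + 1" "Tp (Suc t) = Tp t" | "Np (Suc t) = Np t" "Tp (Suc t) = Tp t + 1"
  using path assms by (auto simp: timelike_path_def)

lemma path_step_disj:
  assumes "t < M"
  shows "Np (Suc t) = Np t + 1 \<and> Tp (Suc t) = Tp t \<or> Np (Suc t) = Np t \<and> Tp (Suc t) = Tp t + 1"
  using path assms by (auto simp: timelike_path_def)

lemma Np_mono: "s \<le> t \<Longrightarrow> t \<le> M \<Longrightarrow> Np s \<le> Np t"
proof (induction rule: dec_induct)
  case (step k)
  then have "Np k \<le> Np (Suc k)" using path_step_disj[of k] by auto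
  then show ?case using step by simp
qed simp

lemma Np_ge_1: "t \<le> M \<Longrightarrow> 1 \<le> Np t"
  using Np_mono[of 0 t] path_0 by simp

lemma Np_le_n: "t \<le> M \<Longrightarrow> Np t \<le> n"
  using Np_mono[of t M] n by simp

lemma states_V:
  assumes "xs \<in> states" "zs \<in> set_pmf (Vm \<beta> \<mu> xs)"
  shows "zs \<in> states"
proof -
  have "length zs = length xs" using assms(2) by (rule length_scan)
  moreover have "sorted_wrt (\<ge>) zs"
  proof (cases xs)
    case Nil
    then show ?thesis using assms by simp
  next
    case (Cons x xs')
    then obtain j ys where "zs = (x + j) # ys" "ys \<in> set_pmf (V \<beta> \<mu> (Suc 1) x j xs')"
      using assms(2) by auto
    then show ?thesis using sorted_V[of x xs' ys] assms(1) Cons by (simp add: states_def)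
  qed
  ultimately show ?thesis using assms(1) by (simp add: states_def)
qed

lemma states_J:
  assumes "geom_ok \<alpha>" "xs \<in> states" "zs \<in> set_pmf (J \<alpha> lo hi 1 p b xs)"
  shows "zs \<in> states"
proof -
  have "length zs = length xs" using assms(3) by (rule length_scan)
  moreover have "sorted_wrt (\<ge>) zs"
  proof (cases xs)
    case Nil
    then show ?thesis using assms by simp
  next
    case (Cons x xs')
    then obtain j ys where "zs = (x + j) # ys" "ys \<in> set_pmf (J \<alpha> lo hi (Suc 1) x j xs')"
      using assms(3) by auto
    then show ?thesis using sorted_J[of \<alpha> "Suc 1" x xs' ys] assms(1,2) Cons
      by (fastforce simp: states_def)
  qed
  ultimately show ?thesis using assms(2) by (simp add: states_def)
qed

lemma J_fixes:
  assumes "zs \<in> set_pmf (J \<alpha> lo hi i p b xs)" "k < length xs" "i + k < lo \<or> hi \<le> i + k"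
  shows "zs ! k = xs ! k"
  using assms
proof (induction xs arbitrary: i p b k zs)
  case (Cons x xs)
  then obtain j ys where *: "zs = (x + j) # ys" "ys \<in> set_pmf (J \<alpha> lo hi (Suc i) x j xs)"
    "j \<in> set_pmf (jker \<alpha> lo hi i p b x)"
    by auto
  show ?case
  proof (cases k)
    case 0
    then show ?thesis using * Cons.prems by (auto simp: jker_def)
  next
    case (Suc k')
    then show ?thesis using * Cons.IH[OF *(2), of k'] Cons.prems by auto
  qed
qed simp

text \<open>In the step configuration all finite gaps are 0, and N \<ge> 2 excludes the first
  particle, the only one with room to jump.\<close>

lemma Em_zero: "2 \<le> N \<Longrightarrow> Em N (replicate k 0) = return_pmf (replicate k 0)"
proof -
  assume N: "2 \<le> N"
  have "J (cc N) N (Suc n) i 0 b (replicate k 0) = return_pmf (replicate k 0)" if "1 \<le> i" for i b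
    using that
  proof (induction k arbitrary: i b)
    case (Suc k)
    have "jker (cc N) N (Suc n) i 0 b 0 = return_pmf 0"
    proof (cases "N \<le> i")
      case True
      interpret qgeom q "a i * cc N" using geom_okD[OF geom_ok_cc[OF N] Suc.prems] .
      have "pmf (embed_pmf (jumpw (cc N) i 0)) j = pmf (return_pmf 0) j" for j
        using pmf_jump[OF geom_ok_cc[OF N] Suc.prems, of 0 j] True N pgeom_0_0 pgeom_gt[of 0 j]
        by (cases "j = 0") (auto simp: jumpw_def)
      then have "embed_pmf (jumpw (cc N) i 0) = return_pmf 0" by (rule pmf_eqI)
      then show ?thesis by (simp add: jker_def)
    qed (simp add: jker_def)
    then show ?case using Suc by (simp add: bind_return_pmf)
  qed simp
  then show ?thesis by simp
qed

lemma VE_exchange: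
  assumes "xs \<in> states" "0 < \<beta>" "1 \<le> N" "N \<le> m" "m < n"
  shows "bind_pmf (Vm \<beta> (\<nu>_on N m) xs) (Em (Suc m)) = bind_pmf (Em (Suc m) xs) (Vm \<beta> (\<nu>_on N (Suc m)))"
proof -
  have upd: "\<nu>_on N (Suc m) = (\<nu>_on N m)(Suc m := a (Suc m) * cc (Suc m))"
    using assms a_pos[of "Suc m"] by (auto simp: \<nu>_on_def fun_eq_iff)
  have "bind_pmf (Vm \<beta> (\<nu>_on N m) xs) (J (cc (Suc m)) (Suc m) (Suc n) 1 (0 + 1) 0)
      = bind_pmf (Em (Suc m) xs) (Vm \<beta> (\<nu>_on N (Suc m)))"
    unfolding upd
    by (rule exchange_suffix)
      (use assms \<nu>_on_bounds[of N m] geom_ok_cc[of "Suc m"] in \<open>auto simp: \<nu>_on_def states_def\<close>)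
  \<comment> \<open>In front of the first particle the predecessor data are dummies and can be
    normalised.\<close>
  moreover have "J (cc (Suc m)) (Suc m) (Suc n) 1 (0 + 1) 0 = Em (Suc m)"
    by (rule ext, rule J_ignores_carry) simp
  ultimately show ?thesis by simp
qed

lemma VD_exchange:
  assumes "xs \<in> states" "0 < \<beta>" "1 \<le> m" "Suc m \<le> n"
  shows "bind_pmf (Vm \<beta> (\<nu>_on m n) xs) (Dm (Suc m)) = bind_pmf (Dm (Suc m) xs) (Vm \<beta> (\<nu>_on (Suc m) n))"
proof -
  have upd: "\<nu>_on (Suc m) n = (\<nu>_on m n)(Suc m := 0)"
    by (auto simp: \<nu>_on_def fun_eq_iff)
  show ?thesis unfolding upd
    by (rule exchange_prefix)
      (use assms \<nu>_on_bounds[of m n] geom_ok_cc[of "Suc m"] a_pos[of "Suc m"] in \<open>auto simp: \<nu>_on_def states_def\<close>)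
qed

lemma ED_Gm: "N \<le> n \<Longrightarrow> 1 \<le> N \<Longrightarrow> bind_pmf (Em N xs) (Dm N) = Gm N xs"
  by (rule J_split) auto

lemma bind_map_observe:
  assumes "\<And>y z. z \<in> set_pmf (K y) \<Longrightarrow> y \<in> set_pmf P \<Longrightarrow> f z = f y"
  shows "bind_pmf P (\<lambda>y. map_pmf ((#) (f y)) (bind_pmf (K y) F)) = bind_pmf (bind_pmf P K) (\<lambda>z. map_pmf ((#) (f z)) (F z))"
  unfolding bind_assoc_pmf map_bind_pmf by (intro bind_pmf_cong refl) (simp add: assms)

text \<open>In \<open>law_E m\<close> the geometric moves of index at most \<open>m\<close> act only on the particles to the front,
  their action on the rear particles having been absorbed in the parameters of the Bernoulli moves.\<close>

abbreviation law_E :: "nat \<Rightarrow> nat \<Rightarrow> nat \<Rightarrow> nat list \<Rightarrow> nat list pmf" where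
  "law_E m \<equiv> path_law Np Tp (\<lambda>N T. Vm (- u T) (\<nu>_on N m)) (\<lambda>N. if N \<le> m then Dm N else Gm N)"

text \<open>All rear moves are gone, and the front moves of index above m have been pushed past the
  end. A row in a column N > m has thereby gained the parameters with index in (m, N], hence
  \<open>min N m\<close>.\<close>

abbreviation law_D :: "nat \<Rightarrow> nat \<Rightarrow> nat \<Rightarrow> nat list \<Rightarrow> nat list pmf" where
  "law_D m \<equiv> path_law Np Tp (\<lambda>N T. Vm (- u T) (\<nu>_on (min N m) n)) (\<lambda>N. if N \<le> m then Dm N else return_pmf)"

section \<open>Advancing the rear moves to the start of the path\<close>

lemma law_E_beyond:
  assumes "t + k = M" "Suc m \<le> Np t"
  shows "law_E m t k xs = law_E (Suc m) t k xs"
  using assms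
proof (induction k arbitrary: t xs)
  case (Suc k)
  have "\<nu>_on (Np (Suc t)) m = \<nu>_on (Np (Suc t)) (Suc m)"
    using Suc.prems Np_mono[of t "Suc t"] by (auto simp: \<nu>_on_def fun_eq_iff)
  moreover have "law_E m (Suc t) k = law_E (Suc m) (Suc t) k"
    using Suc.IH[of "Suc t"] Suc.prems Np_mono[of t "Suc t"] by (intro ext) auto
  moreover have "Tp (Suc t) = Tp t + 1 \<or> \<not> Np (Suc t) \<le> Suc m"
    using path_step_disj[of t] Suc.prems by auto
  ultimately show ?case by auto
qed simp

text \<open>The rear move of index m + 1 splits off when the path enters column m + 1 and is carried
  back in time from there: it fixes the particles recorded so far, commutes with front moves of
  smaller index, and is exchanged with the rows.\<close>

lemma law_E_Suc:
  assumes "t + k = M" "Np t \<le> m" "m < n" "1 \<le> m" "xs \<in> states"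
  shows "law_E m t k xs = bind_pmf (Em (Suc m) xs) (law_E (Suc m) t k)"
  using assms
proof (induction k arbitrary: t xs)
  case 0
  \<comment> \<open>The path ends in column n > m, so it cannot stop before column m + 1.\<close>
  then show ?case using n by simp
next
  case (Suc k)
  have t: "t < M" using Suc.prems by simp
  define N where "N = Np (Suc t)"
  have N: "1 \<le> N" "N \<le> n" using Np_ge_1[of "Suc t"] Np_le_n[of "Suc t"] t by (auto simp: N_def)
  have fixes_N: "z ! (N - 1) = y ! (N - 1)" if "z \<in> set_pmf (Em (Suc m) y)" "y \<in> states" "N \<le> m" for y z
    using J_fixes[OF that(1), of "N - 1"] that N by (auto simp: states_def)
  show ?case
  proof (cases rule: path_step[OF t])
    case 1
    show ?thesis
    proof (cases "Np t = m")
      case True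
      have "law_E m (Suc t) k = law_E (Suc m) (Suc t) k"
        using law_E_beyond[of "Suc t" k m] Suc.prems 1 True by (intro ext) auto
      then show ?thesis using 1 True Suc.prems N ED_Gm[of N xs] unfolding N_def
        by (simp add: bind_assoc_pmf[symmetric])
    next
      case False
      then have Nm: "N \<le> m" "2 \<le> N" using 1 Suc.prems Np_ge_1[of t] by (auto simp: N_def)
      have st: "y \<in> states" if "y \<in> set_pmf (Dm N xs)" for y
        using states_J[OF geom_ok_cc[OF Nm(2)] Suc.prems(5) that] .
      have "law_E m t (Suc k) xs = bind_pmf (Dm N xs) (\<lambda>y. map_pmf ((#) (y ! (N - 1))) (law_E m (Suc t) k y))"
        using 1 Nm by (simp add: N_def)
      also have "\<dots> = bind_pmf (Dm N xs) (\<lambda>y. map_pmf ((#) (y ! (N - 1))) (bind_pmf (Em (Suc m) y) (law_E (Suc m) (Suc t) k)))"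
      proof (rule bind_pmf_cong[OF refl], rule arg_cong[where f = "map_pmf _"], rule Suc.IH)
        show "y \<in> states" if "y \<in> set_pmf (Dm N xs)" for y using st that .
      qed (use Suc.prems Nm in \<open>auto simp: N_def\<close>)
      also have "\<dots> = bind_pmf (bind_pmf (Dm N xs) (Em (Suc m))) (\<lambda>z. map_pmf ((#) (z ! (N - 1))) (law_E (Suc m) (Suc t) k z))"
        by (rule bind_map_observe) (use fixes_N st Nm in auto)
      also have "bind_pmf (Dm N xs) (Em (Suc m)) = bind_pmf (Em (Suc m) xs) (Dm N)"
        by (rule J_commute) (use Nm in simp)
      finally show ?thesis using 1 Nm by (simp add: N_def bind_assoc_pmf)
    qed
  next
    case 2
    define \<beta> where "\<beta> = - u (Tp (Suc t))"
    have \<beta>: "0 < \<beta>" using u[of "Tp (Suc t)"] 2 by (simp add: \<beta>_def)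
    have Nm: "N \<le> m" using 2 Suc.prems by (simp add: N_def)
    have st: "y \<in> states" if "y \<in> set_pmf (Vm \<beta> (\<nu>_on N m) xs)" for y
      using states_V[OF Suc.prems(5) that] .
    have "law_E m t (Suc k) xs = bind_pmf (Vm \<beta> (\<nu>_on N m) xs) (\<lambda>y. map_pmf ((#) (y ! (N - 1))) (law_E m (Suc t) k y))"
      using 2 by (simp add: N_def \<beta>_def)
    also have "\<dots> = bind_pmf (Vm \<beta> (\<nu>_on N m) xs) (\<lambda>y. map_pmf ((#) (y ! (N - 1))) (bind_pmf (Em (Suc m) y) (law_E (Suc m) (Suc t) k)))"
    proof (rule bind_pmf_cong[OF refl], rule arg_cong[where f = "map_pmf _"], rule Suc.IH)
      show "y \<in> states" if "y \<in> set_pmf (Vm \<beta> (\<nu>_on N m) xs)" for y using st that .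
    qed (use Suc.prems Nm in \<open>auto simp: N_def\<close>)
    also have "\<dots> = bind_pmf (bind_pmf (Vm \<beta> (\<nu>_on N m) xs) (Em (Suc m))) (\<lambda>z. map_pmf ((#) (z ! (N - 1))) (law_E (Suc m) (Suc t) k z))"
      by (rule bind_map_observe) (use fixes_N st Nm in auto)
    also have "bind_pmf (Vm \<beta> (\<nu>_on N m) xs) (Em (Suc m)) = bind_pmf (Em (Suc m) xs) (Vm \<beta> (\<nu>_on N (Suc m)))"
      by (rule VE_exchange) (use Suc.prems \<beta> N Nm in auto)
    finally show ?thesis using 2 by (simp add: N_def \<beta>_def bind_assoc_pmf)
  qed
qed

lemma zero_in_states: "replicate n 0 \<in> states"
  by (auto simp: states_def sorted_wrt_iff_nth_less)

lemma law_E_all: "1 \<le> m \<Longrightarrow> m \<le> n \<Longrightarrow> law_E 1 0 M (replicate n 0) = law_E m 0 M (replicate n 0)"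
proof (induction m rule: dec_induct)
  case (step m)
  then have "law_E m 0 M (replicate n 0) = law_E (Suc m) 0 M (replicate n 0)"
    using law_E_Suc[of 0 M m] path_0 zero_in_states Em_zero[of "Suc m" n] by (simp add: bind_return_pmf)
  then show ?case using step by simp
qed simp

section \<open>Postponing the front moves to the end of the path\<close>

lemma law_D_above:
  assumes "t + k = M" "Suc m \<le> Np t" "1 \<le> m" "xs \<in> states"
  shows "bind_pmf (Dm (Suc m) xs) (law_D (Suc m) t k) = law_D m t k xs"
  using assms
proof (induction k arbitrary: t xs)
  case 0
  \<comment> \<open>Nothing is recorded any more, so the postponed move integrates out.\<close>
  then show ?case by simp
next
  case (Suc k)
  have t: "t < M" using Suc.prems by simp
  define N where "N = Np (Suc t)"
  have N: "Suc m \<le> N" "N \<le> n" using Np_mono[of t "Suc t"] Np_le_n[of "Suc t"] t Suc.prems by (auto simp: N_def)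
  have fixes_N: "z ! (N - 1) = y ! (N - 1)" if "z \<in> set_pmf (Dm (Suc m) y)" "y \<in> states" for y z
    using J_fixes[OF that(1), of "N - 1"] that N by (auto simp: states_def)
  show ?case
  proof (cases rule: path_step[OF t])
    case 1
    have NN: "\<not> N \<le> Suc m" "\<not> N \<le> m" using 1 Suc.prems by (auto simp: N_def)
    have "bind_pmf (Dm (Suc m) xs) (law_D (Suc m) t (Suc k))
        = bind_pmf (bind_pmf (return_pmf xs) (Dm (Suc m))) (\<lambda>z. map_pmf ((#) (z ! (N - 1))) (law_D (Suc m) (Suc t) k z))"
      using 1 NN by (simp add: N_def bind_return_pmf path_law_Suc)
    also have "\<dots> = bind_pmf (return_pmf xs) (\<lambda>y. map_pmf ((#) (y ! (N - 1))) (bind_pmf (Dm (Suc m) y) (law_D (Suc m) (Suc t) k)))"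
      by (rule bind_map_observe[symmetric]) (use fixes_N Suc.prems in auto)
    also have "\<dots> = law_D m t (Suc k) xs"
      using 1 NN Suc.IH[of "Suc t" xs] Suc.prems by (simp add: N_def bind_return_pmf)
    finally show ?thesis .
  next
    case 2
    define \<beta> where "\<beta> = - u (Tp (Suc t))"
    have \<beta>: "0 < \<beta>" using u[of "Tp (Suc t)"] 2 by (simp add: \<beta>_def)
    have mn: "min N (Suc m) = Suc m" "min N m = m" using N by auto
    have st: "y \<in> states" if "y \<in> set_pmf (Vm \<beta> (\<nu>_on m n) xs)" for y
      using states_V[OF Suc.prems(4) that] .
    have "bind_pmf (Dm (Suc m) xs) (law_D (Suc m) t (Suc k))
        = bind_pmf (bind_pmf (Dm (Suc m) xs) (Vm \<beta> (\<nu>_on (Suc m) n))) (\<lambda>z. map_pmf ((#) (z ! (N - 1))) (law_D (Suc m) (Suc t) k z))"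
      using 2 mn by (simp add: N_def \<beta>_def bind_assoc_pmf path_law_Suc)
    also have "bind_pmf (Dm (Suc m) xs) (Vm \<beta> (\<nu>_on (Suc m) n)) = bind_pmf (Vm \<beta> (\<nu>_on m n) xs) (Dm (Suc m))"
      by (rule VD_exchange[symmetric]) (use Suc.prems \<beta> N in auto)
    also have "bind_pmf (bind_pmf (Vm \<beta> (\<nu>_on m n) xs) (Dm (Suc m))) (\<lambda>z. map_pmf ((#) (z ! (N - 1))) (law_D (Suc m) (Suc t) k z))
        = bind_pmf (Vm \<beta> (\<nu>_on m n) xs) (\<lambda>y. map_pmf ((#) (y ! (N - 1))) (bind_pmf (Dm (Suc m) y) (law_D (Suc m) (Suc t) k)))"
      by (rule bind_map_observe[symmetric]) (use fixes_N st in auto)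
    also have "\<dots> = bind_pmf (Vm \<beta> (\<nu>_on m n) xs) (\<lambda>y. map_pmf ((#) (y ! (N - 1))) (law_D m (Suc t) k y))"
    proof (rule bind_pmf_cong[OF refl], rule arg_cong[where f = "map_pmf _"], rule Suc.IH)
      show "y \<in> states" if "y \<in> set_pmf (Vm \<beta> (\<nu>_on m n) xs)" for y using st that .
    qed (use Suc.prems N in \<open>auto simp: N_def\<close>)
    also have "\<dots> = law_D m t (Suc k) xs"
      using 2 mn by (simp add: N_def \<beta>_def)
    finally show ?thesis .
  qed
qed

text \<open>The two laws agree until column m + 1 is entered. There one of them performs the front
  move of index m + 1, which \<open>law_D_above\<close> pushes past the rest of the path.\<close>

lemma law_D_Suc:
  assumes "t + k = M" "Np t \<le> m" "1 \<le> m" "xs \<in> states"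
  shows "law_D (Suc m) t k xs = law_D m t k xs"
  using assms
proof (induction k arbitrary: t xs)
  case 0
  then show ?case by simp
next
  case (Suc k)
  have t: "t < M" using Suc.prems by simp
  define N where "N = Np (Suc t)"
  have N: "1 \<le> N" "N \<le> n" using Np_ge_1[of "Suc t"] Np_le_n[of "Suc t"] t by (auto simp: N_def)
  show ?case
  proof (cases rule: path_step[OF t])
    case 1
    show ?thesis
    proof (cases "Np t = m")
      case True
      then have NN: "N = Suc m" using 1 by (simp add: N_def)
      have fixes_N: "z ! m = y ! m" if "z \<in> set_pmf (Dm (Suc m) y)" "y \<in> states" for y z
        using J_fixes[OF that(1), of m] that N NN by (auto simp: states_def)
      have "law_D (Suc m) t (Suc k) xs
          = bind_pmf (bind_pmf (return_pmf xs) (Dm (Suc m))) (\<lambda>z. map_pmf ((#) (z ! m)) (law_D (Suc m) (Suc t) k z))"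
        using 1 NN by (simp add: N_def bind_return_pmf)
      also have "\<dots> = bind_pmf (return_pmf xs) (\<lambda>y. map_pmf ((#) (y ! m)) (bind_pmf (Dm (Suc m) y) (law_D (Suc m) (Suc t) k)))"
        by (rule bind_map_observe[symmetric]) (use fixes_N Suc.prems in auto)
      also have "\<dots> = law_D m t (Suc k) xs"
        using 1 NN law_D_above[of "Suc t" k m xs] Suc.prems by (simp add: N_def bind_return_pmf)
      finally show ?thesis .
    next
      case False
      then have Nm: "N \<le> m" "2 \<le> N" using 1 Suc.prems Np_ge_1[of t] by (auto simp: N_def)
      have "law_D (Suc m) (Suc t) k y = law_D m (Suc t) k y" if "y \<in> set_pmf (Dm N xs)" for y
        by (rule Suc.IH) (use states_J[OF geom_ok_cc[OF Nm(2)] Suc.prems(4) that] Suc.prems Nm in \<open>auto simp: N_def\<close>)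
      then show ?thesis using 1 Nm by (auto simp: N_def intro!: bind_pmf_cong)
    qed
  next
    case 2
    have Nm: "N \<le> m" using 2 Suc.prems by (simp add: N_def)
    have "law_D (Suc m) (Suc t) k y = law_D m (Suc t) k y" if "y \<in> set_pmf (Vm (- u (Tp (Suc t))) (\<nu>_on N n) xs)" for y
      by (rule Suc.IH) (use states_V[OF Suc.prems(4) that] Suc.prems Nm in \<open>auto simp: N_def\<close>)
    then show ?thesis using 2 Nm by (auto simp: N_def min_def intro!: bind_pmf_cong)
  qed
qed

lemma law_D_all: "1 \<le> m \<Longrightarrow> law_D m 0 M (replicate n 0) = law_D 1 0 M (replicate n 0)"
proof (induction m rule: dec_induct)
  case (step m)
  then show ?case using law_D_Suc[of 0 M m "replicate n 0"] path_0 zero_in_states by simp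
qed simp

lemma path_law_cong:
  assumes "\<And>s. t \<le> s \<Longrightarrow> s < t + k \<Longrightarrow> Tp (Suc s) = Tp s + 1 \<Longrightarrow>
      KV (Np (Suc s)) (Tp (Suc s)) = KV' (Np (Suc s)) (Tp (Suc s))"
    and "\<And>s. t \<le> s \<Longrightarrow> s < t + k \<Longrightarrow> Tp (Suc s) \<noteq> Tp s + 1 \<Longrightarrow> KH (Np (Suc s)) = KH' (Np (Suc s))"
  shows "path_law Np Tp KV KH t k x = path_law Np Tp KV' KH' t k x"
  using assms
proof (induction k arbitrary: t x)
  case (Suc k)
  have "path_law Np Tp KV KH (Suc t) k = path_law Np Tp KV' KH' (Suc t) k"
  proof (rule ext, rule Suc.IH)
    show "KV (Np (Suc s)) (Tp (Suc s)) = KV' (Np (Suc s)) (Tp (Suc s))"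
      if "Suc t \<le> s" "s < Suc t + k" "Tp (Suc s) = Tp s + 1" for s
      using that by (intro Suc.prems(1)) simp_all
    show "KH (Np (Suc s)) = KH' (Np (Suc s))"
      if "Suc t \<le> s" "s < Suc t + k" "Tp (Suc s) \<noteq> Tp s + 1" for s
      using that by (intro Suc.prems(2)) simp_all
  qed
  moreover have "KV (Np (Suc t)) (Tp (Suc t)) = KV' (Np (Suc t)) (Tp (Suc t))" if "Tp (Suc t) = Tp t + 1"
    using that by (intro Suc.prems(1)) simp_all
  moreover have "KH (Np (Suc t)) = KH' (Np (Suc t))" if "Tp (Suc t) \<noteq> Tp t + 1"
    using that by (intro Suc.prems(2)) simp_all
  ultimately show ?case by (cases "Tp (Suc t) = Tp t + 1") simp_all
qed simp

text \<open>Horizontal steps enter columns from 2 to n. Hence at m = 1 \<open>law_E\<close> has only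
  full geometric moves and rows with parameter 0, at m = n it coincides with \<open>law_D\<close>,
  and at m = 1 \<open>law_D\<close> has only the rows of the vertex model left.\<close>

lemma path_law_eq:
  "path_law Np Tp (\<lambda>N T. Vm (- u T) (\<lambda>_. 0)) Gm 0 M (replicate n 0) =
   path_law Np Tp (\<lambda>N T. Vm (- u T) (\<nu>_on 1 n)) (\<lambda>N. return_pmf) 0 M (replicate n 0)"
  (is "?L = ?R")
proof -
  have n1: "1 \<le> n" using Np_ge_1[of M] n by simp
  have nz: "\<nu>_on N 1 = (\<lambda>_. 0)" if "1 \<le> N" for N using that by (auto simp: \<nu>_on_def fun_eq_iff)
  have N2: "\<not> Np (Suc s) \<le> 1" if "s < M" "Tp (Suc s) \<noteq> Tp s + 1" for s
    using path_step_disj[OF that(1)] that(2) Np_ge_1[of s] that(1) by auto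
  have min1: "min (Np s) 1 = 1" if "s \<le> M" for s using Np_ge_1[OF that] by simp
  have "?L = law_E 1 0 M (replicate n 0)"
    by (rule path_law_cong) (use nz N2 Np_ge_1 in auto)
  also have "\<dots> = law_E n 0 M (replicate n 0)" using law_E_all[OF n1 le_refl] .
  also have "\<dots> = law_D n 0 M (replicate n 0)"
    by (rule path_law_cong) (use Np_le_n in \<open>auto simp: min_def\<close>)
  also have "\<dots> = law_D 1 0 M (replicate n 0)" using n1 by (rule law_D_all)
  also have "\<dots> = ?R"
    by (rule path_law_cong) (use N2 min1 in auto)
  finally show ?thesis .
qed

end

section \<open>Sampling from independent uniform variables\<close>

abbreviation unif :: "real measure" where "unif \<equiv> uniform_measure lborel {0..1}"

lemma measurable_unif: "f \<in> unif \<rightarrow>\<^sub>M N \<longleftrightarrow> f \<in> borel \<rightarrow>\<^sub>M N"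
proof -
  have "measurable unif N = measurable borel N" by (rule measurable_cong_sets) simp_all
  then show ?thesis by simp
qed

lemma prob_space_unif: "prob_space unif"
  by (rule prob_space_uniform_measure) auto

interpretation unif_product: product_prob_space "\<lambda>_ :: nat \<times> nat. unif" UNIV
  by (intro product_prob_spaceI prob_space_unif)

lemma prob_space_unifOmega: "prob_space unifOmega"
  unfolding unifOmega_def by (rule unif_product.P.prob_space_axioms)

interpretation Om: prob_space unifOmega
  by (rule prob_space_unifOmega)

lemma space_unifOmega: "space unifOmega = UNIV"
  by (simp add: unifOmega_def space_PiM)

lemma measurable_coord [measurable]: "(\<lambda>\<omega>. \<omega> k) \<in> unifOmega \<rightarrow>\<^sub>M borel"
proof -
  have "(\<lambda>\<omega>. \<omega> k) \<in> unifOmega \<rightarrow>\<^sub>M unif"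
    unfolding unifOmega_def by (rule measurable_component_singleton) simp
  then show ?thesis by (simp cong: measurable_cong_sets)
qed

lemma distr_coord: "distr unifOmega unif (\<lambda>\<omega>. \<omega> k) = unif"
  unfolding unifOmega_def by (rule unif_product.PiM_component) simp

lemma indep_coords: "Om.indep_vars (\<lambda>_. unif) (\<lambda>k \<omega>. \<omega> k) UNIV"
proof (subst Om.indep_vars_iff_distr_eq_PiM)
  show "(\<lambda>\<omega>. \<omega> k) \<in> unifOmega \<rightarrow>\<^sub>M unif" for k
    using measurable_coord by (simp cong: measurable_cong_sets)
  show "distr unifOmega (Pi\<^sub>M UNIV (\<lambda>i. unif)) (\<lambda>x. \<lambda>i\<in>UNIV. x i) = Pi\<^sub>M UNIV (\<lambda>i. distr unifOmega unif (\<lambda>\<omega>. \<omega> i))"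
    unfolding distr_coord by (simp add: unifOmega_def[symmetric] distr_id restrict_UNIV)
qed simp

definition depends_on :: "(nat \<times> nat) set \<Rightarrow> ((nat \<times> nat \<Rightarrow> real) \<Rightarrow> 'a) \<Rightarrow> bool" where
  "depends_on K F \<longleftrightarrow> (\<forall>\<omega> \<omega>'. (\<forall>k\<in>K. \<omega> k = \<omega>' k) \<longrightarrow> F \<omega> = F \<omega>')"

text \<open>K records the randomness consumed, so that independence of successive steps becomes
  disjointness of coordinate sets.\<close>

definition samples :: "(nat \<times> nat) set \<Rightarrow> ((nat \<times> nat \<Rightarrow> real) \<Rightarrow> 'a) \<Rightarrow> 'a pmf \<Rightarrow> bool" where
  "samples K F p \<longleftrightarrow> F \<in> unifOmega \<rightarrow>\<^sub>M count_space UNIV \<and> depends_on K F \<and>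
     distr unifOmega (count_space UNIV) F = measure_pmf p"

text \<open>Extending a restricted family by 0 (\<open>ext\<close>) turns X and Y into functions of
  the families over J and over K, which are independent as J and K are disjoint.\<close>

lemma indep_depends_on:
  assumes X: "X \<in> unifOmega \<rightarrow>\<^sub>M count_space UNIV" "depends_on J X"
    and Y: "Y \<in> unifOmega \<rightarrow>\<^sub>M count_space UNIV" "depends_on K Y"
    and JK: "J \<inter> K = {}"
  shows "Om.indep_var (count_space UNIV) X (count_space UNIV) Y"
proof -
  define ext where "ext A \<omega> = (\<lambda>k. if k \<in> A then \<omega> k else 0)" for A and \<omega> :: "nat \<times> nat \<Rightarrow> real"
  have ext: "ext A \<in> PiM A (\<lambda>_. unif) \<rightarrow>\<^sub>M unifOmega" for A
    unfolding unifOmega_def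
  proof (rule measurable_PiM_single')
    show "(\<lambda>\<omega>. ext A \<omega> k) \<in> PiM A (\<lambda>_. unif) \<rightarrow>\<^sub>M unif" for k
      by (cases "k \<in> A") (simp_all add: ext_def measurable_component_singleton)
  qed (auto simp: space_PiM)
  have "Om.indep_var (count_space UNIV) ((\<lambda>\<omega>. X (ext J \<omega>)) \<circ> (\<lambda>\<omega>. restrict (\<lambda>i. \<omega> i) J))
     (count_space UNIV) ((\<lambda>\<omega>. Y (ext K \<omega>)) \<circ> (\<lambda>\<omega>. restrict (\<lambda>i. \<omega> i) K))"
    by (rule Om.indep_var_compose[OF Om.indep_var_restrict[OF indep_coords JK]])
      (auto intro: measurable_compose[OF ext X(1)] measurable_compose[OF ext Y(1)])
  moreover have "(\<lambda>\<omega>. X (ext J \<omega>)) \<circ> (\<lambda>\<omega>. restrict (\<lambda>i. \<omega> i) J) = X"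
    using X(2) by (auto simp: depends_on_def ext_def fun_eq_iff)
  moreover have "(\<lambda>\<omega>. Y (ext K \<omega>)) \<circ> (\<lambda>\<omega>. restrict (\<lambda>i. \<omega> i) K) = Y"
    using Y(2) by (auto simp: depends_on_def ext_def fun_eq_iff)
  ultimately show ?thesis by simp
qed

lemma samples_return: "samples K (\<lambda>_. x) (return_pmf x)"
  by (simp add: samples_def depends_on_def Om.distr_const return_pmf.rep_eq)

lemma emeasure_samples:
  assumes "samples K F p"
  shows "emeasure unifOmega {\<omega>. F \<omega> = x} = ennreal (pmf p x)"
proof -
  have "emeasure (distr unifOmega (count_space UNIV) F) {x} = emeasure unifOmega (F -` {x} \<inter> space unifOmega)"
    using assms by (intro emeasure_distr) (auto simp: samples_def)
  moreover have "F -` {x} \<inter> space unifOmega = {\<omega>. F \<omega> = x}" by (auto simp: space_unifOmega)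
  ultimately show ?thesis using assms by (simp add: samples_def emeasure_pmf_single)
qed

text \<open>The event is decomposed over the countably many values of X. The fresh coordinates in K
  make \<open>F x\<close> independent of each event X = x, so the probabilities add up to the
  mixture.\<close>

lemma samples_bind:
  fixes p :: "'a::countable pmf" and \<kappa> :: "'a \<Rightarrow> 'b::countable pmf"
  assumes X: "samples J X p" and F: "\<And>x. samples K (F x) (\<kappa> x)" and JK: "J \<inter> K = {}"
  shows "samples (J \<union> K) (\<lambda>\<omega>. F (X \<omega>) \<omega>) (bind_pmf p \<kappa>)"
  unfolding samples_def
proof (intro conjI)
  show m: "(\<lambda>\<omega>. F (X \<omega>) \<omega>) \<in> unifOmega \<rightarrow>\<^sub>M count_space UNIV"
    by (rule measurable_compose_countable[where f = F and g = X]) (use X F in \<open>simp_all add: samples_def\<close>)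
  show "depends_on (J \<union> K) (\<lambda>\<omega>. F (X \<omega>) \<omega>)"
    unfolding depends_on_def
  proof (intro allI impI)
    fix \<omega> \<omega>' :: "nat \<times> nat \<Rightarrow> real" assume *: "\<forall>k\<in>J \<union> K. \<omega> k = \<omega>' k"
    have "X \<omega> = X \<omega>'" using X * unfolding samples_def depends_on_def by blast
    moreover have "F (X \<omega>) \<omega> = F (X \<omega>) \<omega>'" using F * unfolding samples_def depends_on_def by blast
    ultimately show "F (X \<omega>) \<omega> = F (X \<omega>') \<omega>'" by simp
  qed
  show "distr unifOmega (count_space UNIV) (\<lambda>\<omega>. F (X \<omega>) \<omega>) = measure_pmf (bind_pmf p \<kappa>)"
  proof (rule measure_eqI_countable[of _ UNIV])
    fix y
    have Xs: "{\<omega>. X \<omega> = x} \<in> sets unifOmega" for x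
      using X measurable_sets[of X unifOmega "count_space UNIV" "{x}"]
      by (auto simp: samples_def space_unifOmega vimage_def)
    have Fs: "{\<omega>. F x \<omega> = y} \<in> sets unifOmega" for x
      using F[of x] measurable_sets[of "F x" unifOmega "count_space UNIV" "{y}"]
      by (auto simp: samples_def space_unifOmega vimage_def)
    have "emeasure (distr unifOmega (count_space UNIV) (\<lambda>\<omega>. F (X \<omega>) \<omega>)) {y}
        = emeasure unifOmega ((\<lambda>\<omega>. F (X \<omega>) \<omega>) -` {y} \<inter> space unifOmega)"
      using m by (intro emeasure_distr) auto
    also have "(\<lambda>\<omega>. F (X \<omega>) \<omega>) -` {y} \<inter> space unifOmega = (\<Union>x\<in>UNIV. {\<omega>. X \<omega> = x} \<inter> {\<omega>. F x \<omega> = y})"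
      by (auto simp: space_unifOmega)
    also have "emeasure unifOmega \<dots> = (\<integral>\<^sup>+x. emeasure unifOmega ({\<omega>. X \<omega> = x} \<inter> {\<omega>. F x \<omega> = y}) \<partial>count_space UNIV)"
      using Xs Fs by (intro emeasure_UN_countable) (auto simp: disjoint_family_on_def)
    also have "\<dots> = (\<integral>\<^sup>+x. ennreal (pmf p x) * ennreal (pmf (\<kappa> x) y) \<partial>count_space UNIV)"
    proof (rule nn_integral_cong)
      fix x
      have "Om.indep_var (count_space UNIV) (\<lambda>\<omega>. X \<omega> = x) (count_space UNIV) (\<lambda>\<omega>. F x \<omega> = y)"
      proof (rule indep_depends_on[OF _ _ _ _ JK])
        show "depends_on J (\<lambda>\<omega>. X \<omega> = x)" "depends_on K (\<lambda>\<omega>. F x \<omega> = y)"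
          using X F[of x] unfolding samples_def depends_on_def by metis+
        show "(\<lambda>\<omega>. X \<omega> = x) \<in> unifOmega \<rightarrow>\<^sub>M count_space UNIV" "(\<lambda>\<omega>. F x \<omega> = y) \<in> unifOmega \<rightarrow>\<^sub>M count_space UNIV"
          using X F[of x] by (auto simp: samples_def intro: measurable_compose)
      qed
      from Om.indep_varD[OF this, of "{True}" "{True}"]
      have "Om.prob ({\<omega>. X \<omega> = x} \<inter> {\<omega>. F x \<omega> = y}) = Om.prob {\<omega>. X \<omega> = x} * Om.prob {\<omega>. F x \<omega> = y}"
        by (simp add: space_unifOmega vimage_def Int_def)
      then show "emeasure unifOmega ({\<omega>. X \<omega> = x} \<inter> {\<omega>. F x \<omega> = y}) = ennreal (pmf p x) * ennreal (pmf (\<kappa> x) y)"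
        unfolding emeasure_samples[OF X, symmetric] emeasure_samples[OF F, symmetric] Om.emeasure_eq_measure
        by (simp add: ennreal_mult)
    qed
    also have "\<dots> = (\<integral>\<^sup>+x. ennreal (pmf (\<kappa> x) y) \<partial>measure_pmf p)"
      unfolding measure_pmf_eq_density by (subst nn_integral_density) auto
    also have "\<dots> = emeasure (measure_pmf (bind_pmf p \<kappa>)) {y}"
      by (simp add: emeasure_pmf_single ennreal_pmf_bind)
    finally show "emeasure (distr unifOmega (count_space UNIV) (\<lambda>\<omega>. F (X \<omega>) \<omega>)) {y} = emeasure (measure_pmf (bind_pmf p \<kappa>)) {y}" .
  qed auto
qed

lemma samples_map:
  assumes "samples K F p"
  shows "samples K (\<lambda>\<omega>. f (F \<omega>)) (map_pmf f p)"
proof -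
  have "distr unifOmega (count_space UNIV) (\<lambda>\<omega>. f (F \<omega>)) = distr (distr unifOmega (count_space UNIV) F) (count_space UNIV) f"
    using assms by (subst distr_distr) (auto simp: samples_def comp_def)
  then show ?thesis using assms
    by (auto simp: samples_def map_pmf_rep_eq depends_on_def intro: measurable_compose) (metis)
qed

section \<open>Realising a discrete law by one uniform variable\<close>

definition unif_law :: "(real \<Rightarrow> 'a) \<Rightarrow> 'a pmf \<Rightarrow> bool" where
  "unif_law f p \<longleftrightarrow> f \<in> borel \<rightarrow>\<^sub>M count_space UNIV \<and> distr unif (count_space UNIV) f = measure_pmf p"

lemma samples_coord:
  assumes "unif_law f p"
  shows "samples {k} (\<lambda>\<omega>. f (\<omega> k)) p"
proof -
  have f: "f \<in> borel \<rightarrow>\<^sub>M count_space UNIV" using assms by (simp add: unif_law_def)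
  have m: "(\<lambda>\<omega>. \<omega> k) \<in> unifOmega \<rightarrow>\<^sub>M unif" "f \<in> unif \<rightarrow>\<^sub>M count_space UNIV"
    using measurable_coord f by (simp cong: measurable_cong_sets) (simp add: measurable_unif f)
  have "distr unifOmega (count_space UNIV) (\<lambda>\<omega>. f (\<omega> k)) = distr (distr unifOmega unif (\<lambda>\<omega>. \<omega> k)) (count_space UNIV) f"
    using m by (subst distr_distr) (auto simp: comp_def)
  then show ?thesis using assms measurable_compose[OF measurable_coord f]
    by (simp add: samples_def depends_on_def distr_coord unif_law_def)
qed

text \<open>Each value is taken on a half-open interval as long as its probability. Only v < 1 is
  compared, since the endpoint 1 is a null set.\<close>

lemma unif_lawI:
  fixes f :: "real \<Rightarrow> nat"
  assumes f: "f \<in> borel \<rightarrow>\<^sub>M count_space UNIV"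
    and eq: "\<And>j v. 0 \<le> v \<Longrightarrow> v < 1 \<Longrightarrow> f v = j \<longleftrightarrow> l j \<le> v \<and> v < l j + pmf p j"
    and l: "\<And>j. 0 \<le> l j" "\<And>j. l j + pmf p j \<le> 1"
  shows "unif_law f p"
  unfolding unif_law_def
proof (intro conjI f measure_eqI_countable[of _ UNIV])
  fix j
  have fs: "f -` {j} \<in> sets borel" using measurable_sets[OF f, of "{j}"] by simp
  have "emeasure (distr unif (count_space UNIV) f) {j} = emeasure unif (f -` {j})"
    using f by (subst emeasure_distr) (auto simp: measurable_unif)
  also have "\<dots> = emeasure lborel ({0..1} \<inter> f -` {j})"
    using fs by (subst emeasure_uniform_measure) (auto simp: divide_ennreal_def)
  also have "\<dots> = emeasure lborel {l j ..< l j + pmf p j}"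
  proof (rule emeasure_eq_AE)
    have "AE v in lborel. v \<noteq> (1::real)" by (rule AE_lborel_singleton)
    then show "AE v in lborel. (v \<in> {0..1} \<inter> f -` {j}) = (v \<in> {l j..<l j + pmf p j})"
    proof (eventually_elim)
      case (elim v)
      show ?case using eq[of v j] l[of j] elim by (cases "0 \<le> v \<and> v < 1") auto
    qed
  qed (use fs in auto)
  also have "\<dots> = emeasure (measure_pmf p) {j}" by (simp add: emeasure_pmf_single)
  finally show "emeasure (distr unif (count_space UNIV) f) {j} = emeasure (measure_pmf p) {j}" .
qed auto

lemma unif_law_bernoulli:
  assumes "0 \<le> r" "r \<le> 1"
  shows "unif_law (\<lambda>v. if v < r then 1 else 0 :: nat) (map_pmf of_bool (bernoulli_pmf r))"
\<comment> \<open>The value 1 occupies [0, r) and the value 0 occupies [r, 1).\<close>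
proof (rule unif_lawI[where l = "\<lambda>j. if j = 0 then r else 0"])
  have inj: "inj (of_bool :: bool \<Rightarrow> nat)" by (auto simp: inj_def)
  have 0: "pmf (map_pmf of_bool (bernoulli_pmf r)) (0::nat) = 1 - r"
    using pmf_map_inj'[OF inj, of "bernoulli_pmf r" False] assms by simp
  have 1: "pmf (map_pmf of_bool (bernoulli_pmf r)) (Suc 0) = r"
    using pmf_map_inj'[OF inj, of "bernoulli_pmf r" True] assms by simp
  have 2: "pmf (map_pmf of_bool (bernoulli_pmf r)) j = 0" if "1 < j" for j :: nat
    using that by (auto simp: pmf_eq_0_set_pmf of_bool_def split: if_splits)
  have j: "j = 0 \<or> j = Suc 0 \<or> 1 < j" for j :: nat by linarith
  show "(if v < r then 1 else 0) = j \<longleftrightarrow> (if j = 0 then r else 0) \<le> v \<and>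
     v < (if j = 0 then r else 0) + pmf (map_pmf of_bool (bernoulli_pmf r)) j" if "0 \<le> v" "v < 1" for v and j :: nat
    using j[of j] that by (auto simp: 0 1 2)
  show "(if j = 0 then r else 0) + pmf (map_pmf of_bool (bernoulli_pmf r)) j \<le> 1" for j :: nat
    using j[of j] assms by (auto simp: 0 1 2)
qed (use assms in auto)

text \<open>The value j occupies the interval between consecutive partial sums. As the total mass is
  1, some partial sum exceeds any given v < 1, so the default branch of \<open>icdf\<close> is not
  reached there.\<close>

lemma unif_law_icdf:
  assumes f: "\<And>j. 0 \<le> f j" "f sums 1" and p: "\<And>j. pmf p j = f j"
  shows "unif_law (icdf f) p"
proof (rule unif_lawI[where l = "\<lambda>j. \<Sum>k<j. f k"])
  show "icdf f \<in> borel \<rightarrow>\<^sub>M count_space UNIV"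
    unfolding icdf_def[abs_def] by measurable
  show "0 \<le> (\<Sum>k<j. f k)" for j using f by (simp add: sum_nonneg)
  show "(\<Sum>k<j. f k) + pmf p j \<le> 1" for j
    using sum_le_suminf[of f "{..<Suc j}"] f p by (simp add: sums_iff)
  show "icdf f v = j \<longleftrightarrow> (\<Sum>k<j. f k) \<le> v \<and> v < (\<Sum>k<j. f k) + pmf p j" if v: "0 \<le> v" "v < 1" for j v
  proof -
    have S: "(\<Sum>k<j. f k) + pmf p j = (\<Sum>k\<le>j. f k)" for j
      by (simp add: p flip: lessThan_Suc_atMost)
    have "(\<lambda>n. \<Sum>k<n. f k) \<longlonglongrightarrow> 1" using f(2) by (simp add: sums_def)
    then have "\<forall>\<^sub>F n in sequentially. v < (\<Sum>k<n. f k)" using v by (intro order_tendstoD(1))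
    then obtain n where "v < (\<Sum>k<n. f k)" by (auto simp: eventually_sequentially)
    also have "\<dots> \<le> (\<Sum>k\<le>n. f k)" using f(1) by (intro sum_mono2) auto
    finally have ex: "\<exists>j. v < (\<Sum>k\<le>j. f k)" by blast
    define m where "m = (LEAST j. v < (\<Sum>k\<le>j. f k))"
    have m: "v < (\<Sum>k\<le>m. f k)" unfolding m_def using ex by (rule LeastI_ex)
    have lt: "\<not> v < (\<Sum>k\<le>j. f k)" if "j < m" for j using not_less_Least that unfolding m_def by blast
    have "(\<Sum>k<m. f k) \<le> v"
    proof (cases m)
      case (Suc m')
      then show ?thesis using lt[of m'] by (simp add: lessThan_Suc_atMost)
    qed (use v in simp)
    moreover have "j = m" if "(\<Sum>k<j. f k) \<le> v" "v < (\<Sum>k\<le>j. f k)" for j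
    proof (rule ccontr)
      assume "j \<noteq> m"
      then consider "j < m" | "m < j" by linarith
      then show False
      proof cases
        case 1
        then show ?thesis using lt that by simp
      next
        case 2
        then have "(\<Sum>k\<le>m. f k) \<le> (\<Sum>k<j. f k)" using f(1) by (intro sum_mono2) auto
        then show ?thesis using m that by simp
      qed
    qed
    moreover have "icdf f v = m" using ex by (simp add: icdf_def m_def)
    ultimately show ?thesis unfolding S using m by metis
  qed
qed

fun dscan :: "(nat \<Rightarrow> nat \<Rightarrow> nat \<Rightarrow> nat \<Rightarrow> real \<Rightarrow> nat) \<Rightarrow> nat \<Rightarrow> nat \<Rightarrow> nat \<Rightarrow> nat list \<Rightarrow> (nat \<Rightarrow> real) \<Rightarrow> nat list" where
  "dscan f i p b [] U = []"
| "dscan f i p b (x # xs) U = (x + f i p b x (U i)) # dscan f (Suc i) x (f i p b x (U i)) xs U"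

lemma samples_dscan:
  assumes f: "\<And>i p b x. 1 \<le> i \<Longrightarrow> unif_law (f i p b x) (\<kappa> i p b x)" and idx: "inj idx" and i: "1 \<le> i"
  shows "samples (idx ` {i..}) (\<lambda>\<omega>. dscan f i p b xs (\<lambda>k. \<omega> (idx k))) (scan \<kappa> i p b xs)"
  using i
proof (induction xs arbitrary: i p b)
  case Nil
  then show ?case by (simp add: samples_return)
next
  case (Cons x xs)
  have "samples ({idx i} \<union> idx ` {Suc i..})
     (\<lambda>\<omega>. (\<lambda>j \<omega>. (x + j) # dscan f (Suc i) x j xs (\<lambda>k. \<omega> (idx k))) (f i p b x (\<omega> (idx i))) \<omega>)
     (bind_pmf (\<kappa> i p b x) (\<lambda>j. map_pmf ((#) (x + j)) (scan \<kappa> (Suc i) x j xs)))"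
  proof (rule samples_bind)
    show "samples {idx i} (\<lambda>\<omega>. f i p b x (\<omega> (idx i))) (\<kappa> i p b x)"
      using Cons.prems by (intro samples_coord f)
    show "samples (idx ` {Suc i..}) (\<lambda>\<omega>. (x + j) # dscan f (Suc i) x j xs (\<lambda>k. \<omega> (idx k)))
        (map_pmf ((#) (x + j)) (scan \<kappa> (Suc i) x j xs))" for j
      by (intro samples_map Cons.IH) simp
    show "{idx i} \<inter> idx ` {Suc i..} = {}" using idx by (auto dest: injD)
  qed
  moreover have "{idx i} \<union> idx ` {Suc i..} = idx ` {i..}"
  proof -
    have "{i..} = insert i {Suc i..}" by auto
    then show ?thesis by simp
  qed
  ultimately show ?case by simp
qed

section \<open>The q-TASEP as a function of uniform variables\<close>

fun dpath :: "(nat \<Rightarrow> nat) \<Rightarrow> (nat \<Rightarrow> nat list \<Rightarrow> 'w \<Rightarrow> nat list) \<Rightarrow> nat \<Rightarrow> nat \<Rightarrow> nat list \<Rightarrow> 'w \<Rightarrow> nat list" where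
  "dpath Np S t 0 x \<omega> = []"
| "dpath Np S t (Suc k) x \<omega> = S t x \<omega> ! (Np (Suc t) - 1) # dpath Np S (Suc t) k (S t x \<omega>) \<omega>"

lemma dpath_trajectory:
  assumes "\<And>s. t \<le> s \<Longrightarrow> s < t + k \<Longrightarrow> Y (Suc s) = S s (Y s) \<omega>"
  shows "dpath Np S t k (Y t) \<omega> = map (\<lambda>s. Y s ! (Np s - 1)) [Suc t..<Suc (t + k)]"
  using assms
proof (induction k arbitrary: t)
  case (Suc k)
  have "dpath Np S (Suc t) k (Y (Suc t)) \<omega> = map (\<lambda>s. Y s ! (Np s - 1)) [Suc (Suc t)..<Suc (Suc t + k)]"
    by (rule Suc.IH) (use Suc.prems in auto)
  moreover have "Y (Suc t) = S t (Y t) \<omega>" using Suc.prems[of t] by simp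
  moreover have "[Suc t..<Suc (t + Suc k)] = Suc t # [Suc (Suc t)..<Suc (Suc t + k)]"
    by (subst upt_conv_Cons) auto
  ultimately show ?case by simp
qed simp

lemma samples_dpath:
  assumes "\<And>s x. t \<le> s \<Longrightarrow> s < t + k \<Longrightarrow> samples (K s) (S s x)
      (if Tp (Suc s) = Tp s + 1 then KV (Np (Suc s)) (Tp (Suc s)) x else KH (Np (Suc s)) x)"
    and "\<And>s s'. t \<le> s \<Longrightarrow> s < s' \<Longrightarrow> s' < t + k \<Longrightarrow> K s \<inter> K s' = {}"
  shows "samples (\<Union>s\<in>{t..<t+k}. K s) (dpath Np S t k x) (path_law Np Tp KV KH t k x)"
  using assms
proof (induction k arbitrary: t x)
  case 0
  have "dpath Np S t 0 x = (\<lambda>_. [])" by (rule ext) simp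
  then show ?case by (simp add: samples_return)
next
  case (Suc k)
  have "samples (K t \<union> (\<Union>s\<in>{Suc t..<Suc t+k}. K s))
     (\<lambda>\<omega>. (\<lambda>y \<omega>. y ! (Np (Suc t) - 1) # dpath Np S (Suc t) k y \<omega>) (S t x \<omega>) \<omega>)
     (path_law Np Tp KV KH t (Suc k) x)"
    unfolding path_law.simps
  proof (rule samples_bind[where X = "S t x" and F = "\<lambda>y \<omega>. y ! (Np (Suc t) - 1) # dpath Np S (Suc t) k y \<omega>"])
    show "samples (K t) (S t x) (if Tp (Suc t) = Tp t + 1 then KV (Np (Suc t)) (Tp (Suc t)) x else KH (Np (Suc t)) x)"
      by (rule Suc.prems(1)) auto
    show "samples (\<Union>s\<in>{Suc t..<Suc t+k}. K s) (\<lambda>\<omega>. y ! (Np (Suc t) - 1) # dpath Np S (Suc t) k y \<omega>)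
        (map_pmf ((#) (y ! (Np (Suc t) - 1))) (path_law Np Tp KV KH (Suc t) k y))" for y
    proof (intro samples_map Suc.IH)
      show "samples (K s) (S s z) (if Tp (Suc s) = Tp s + 1 then KV (Np (Suc s)) (Tp (Suc s)) z else KH (Np (Suc s)) z)"
        if "Suc t \<le> s" "s < Suc t + k" for s z
        using that by (intro Suc.prems(1)) auto
      show "K s \<inter> K s' = {}" if "Suc t \<le> s" "s < s'" "s' < Suc t + k" for s s'
        using that by (intro Suc.prems(2)) auto
    qed
    have "K t \<inter> K s = {}" if "Suc t \<le> s" "s < Suc t + k" for s
      using that by (intro Suc.prems(2)) auto
    then show "K t \<inter> (\<Union>s\<in>{Suc t..<Suc t+k}. K s) = {}" by (simp add: Int_UN_distrib)
  qed
  moreover have "K t \<union> (\<Union>s\<in>{Suc t..<Suc t+k}. K s) = (\<Union>s\<in>{t..<t+Suc k}. K s)"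
  proof -
    have "{t..<t+Suc k} = insert t {Suc t..<Suc t+k}" by auto
    then show ?thesis by simp
  qed
  moreover have "(\<lambda>\<omega>. (\<lambda>y \<omega>. y ! (Np (Suc t) - 1) # dpath Np S (Suc t) k y \<omega>) (S t x \<omega>) \<omega>) = dpath Np S t (Suc k) x"
    by (auto simp: fun_eq_iff)
  ultimately show ?case by simp
qed

context particle_system
begin

definition dv :: "real \<Rightarrow> (nat \<Rightarrow> real) \<Rightarrow> nat \<Rightarrow> nat \<Rightarrow> nat \<Rightarrow> nat \<Rightarrow> real \<Rightarrow> nat" where
  "dv \<beta> \<mu> i p b x v = (if v < vprob \<beta> \<mu> i (p - x) b then 1 else 0)"

definition dj :: "real \<Rightarrow> nat \<Rightarrow> nat \<Rightarrow> nat \<Rightarrow> nat \<Rightarrow> nat \<Rightarrow> real \<Rightarrow> nat" where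
  "dj \<alpha> hi i p b x v = (if i < hi then icdf (jumpw \<alpha> i (p - x)) v else 0)"

lemma unif_law_dv:
  assumes "0 < \<beta>" "1 \<le> i" "0 \<le> \<mu> i" "\<mu> i \<le> 1"
  shows "unif_law (dv \<beta> \<mu> i p b x) (vker \<beta> \<mu> i p b x)"
  unfolding dv_def[abs_def] vker_def
  by (rule unif_law_bernoulli) (use vprob_bounds[of \<beta> i \<mu>] assms in auto)

lemma unif_law_const: "unif_law (\<lambda>_. c) (return_pmf c)"
  using prob_space.distr_const[OF prob_space_unif, of c "count_space UNIV"]
  by (simp add: unif_law_def return_pmf.rep_eq)

lemma unif_law_dj:
  assumes "geom_ok \<alpha>" "1 \<le> i"
  shows "unif_law (dj \<alpha> hi i p b x) (jker \<alpha> 1 hi i p b x)"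
proof (cases "i < hi")
  case True
  interpret qgeom q "a i * \<alpha>" by (rule geom_okD[OF assms])
  have nn: "0 \<le> jumpw \<alpha> i g j" for g j unfolding jumpw_def using pgeom_nonneg pgeom_inf_nonneg by presburger
  have s: "jumpw \<alpha> i g sums 1" for g unfolding jumpw_def using sums_pgeom sums_pgeom_inf by presburger
  have "unif_law (icdf (jumpw \<alpha> i (p - x))) (embed_pmf (jumpw \<alpha> i (p - x)))"
    by (rule unif_law_icdf[OF nn s]) (rule pmf_jump[OF assms])
  moreover have "dj \<alpha> hi i p b x = icdf (jumpw \<alpha> i (p - x))" using True by (simp add: dj_def fun_eq_iff)
  ultimately show ?thesis using True assms by (simp add: jker_def)
next
  case False
  then show ?thesis using unif_law_const[of 0] by (simp add: dj_def[abs_def] jker_def)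
qed

lemma dscan_bern:
  assumes "\<And>k. x k = int (y k) - int k" "1 \<le> i" "i \<le> Suc n"
    and "i = 1 \<Longrightarrow> b = 1" "i \<noteq> 1 \<Longrightarrow> p = y (i - 1) \<and> b = of_bool (bjumped q a \<beta> x U (i - 1))"
  shows "dscan (dv \<beta> (\<lambda>_. 0)) i p b (map y [i..<Suc n]) U =
     map (\<lambda>k. y k + of_bool (bjumped q a \<beta> x U k)) [i..<Suc n]"
  using assms(2-)
proof (induction "Suc n - i" arbitrary: i p b)
  case 0
  then show ?case by simp
next
  case (Suc m)
  then have i: "i < Suc n" by simp
  then have up: "[i..<Suc n] = i # [Suc i..<Suc n]" by (rule upt_conv_Cons)
  obtain i' where i': "i = Suc i'" using Suc.prems(1) by (cases i) auto
  have gap: "nat (x i' - x (Suc i') - 1) = y i' - y (Suc i')" by (simp add: assms(1))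
  have "U i < vprob \<beta> (\<lambda>_. 0) i (p - y i) b \<longleftrightarrow> bjumped q a \<beta> x U i"
    using Suc.prems(3,4) by (cases "i' = 0") (auto simp: i' vprob_def gap mult_ac)
  then have j: "dv \<beta> (\<lambda>_. 0) i p b (y i) (U i) = of_bool (bjumped q a \<beta> x U i)"
    by (simp add: dv_def)
  have "dscan (dv \<beta> (\<lambda>_. 0)) (Suc i) (y i) (of_bool (bjumped q a \<beta> x U i)) (map y [Suc i..<Suc n]) U =
     map (\<lambda>k. y k + of_bool (bjumped q a \<beta> x U k)) [Suc i..<Suc n]"
    using Suc.hyps(2) Suc.prems(1) i by (intro Suc.hyps(1)) auto
  then show ?case unfolding up by (simp add: j)
qed

lemma dscan_geom:
  assumes "\<And>k. x k = int (y k) - int k" "1 \<le> i" "i \<le> Suc n" "i \<noteq> 1 \<Longrightarrow> p = y (i - 1)"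
  shows "map (\<lambda>k. geom_move q a \<alpha> x U k) [i..<Suc n] =
     map2 (\<lambda>k z. int z - int k) [i..<Suc n] (dscan (dj \<alpha> (Suc n)) i p b (map y [i..<Suc n]) U)"
  using assms(2-)
proof (induction "Suc n - i" arbitrary: i p b)
  case 0
  then show ?case by simp
next
  case (Suc m)
  then have i: "i < Suc n" by simp
  then have up: "[i..<Suc n] = i # [Suc i..<Suc n]" by (rule upt_conv_Cons)
  have gap: "nat (x (i - 1) - x i - 1) = y (i - 1) - y i" using Suc.prems(1) by (simp add: assms(1) nat_diff_distrib')
  have "geom_move q a \<alpha> x U i = int (y i + dj \<alpha> (Suc n) i p b (y i) (U i)) - int i"
    unfolding geom_move_def gap using Suc.prems(3) i by (auto simp: dj_def jumpw_def assms(1)[of i])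
  moreover have "map (\<lambda>k. geom_move q a \<alpha> x U k) [Suc i..<Suc n] =
     map2 (\<lambda>k z. int z - int k) [Suc i..<Suc n] (dscan (dj \<alpha> (Suc n)) (Suc i) (y i) (dj \<alpha> (Suc n) i p b (y i) (U i)) (map y [Suc i..<Suc n]) U)"
    using Suc.hyps(2) Suc.prems(1) i by (intro Suc.hyps(1)) auto
  ultimately show ?case unfolding up by simp
qed

lemma length_dscan: "length (dscan f i p b xs U) = length xs"
  by (induction xs arbitrary: i p b) auto

end

context mixed_system
begin

definition qstep :: "nat \<Rightarrow> nat list \<Rightarrow> (nat \<times> nat \<Rightarrow> real) \<Rightarrow> nat list" where
  "qstep t xs \<omega> = (if Tp (Suc t) = Tp t + 1
     then dscan (dv (- u (Tp (Suc t))) (\<lambda>_. 0)) 1 0 1 xs (\<lambda>k. \<omega> (t, k))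
     else dscan (dj (cc (Np (Suc t))) (Suc n)) 1 0 0 xs (\<lambda>k. \<omega> (t, k)))"

definition qstate :: "(nat \<times> nat \<Rightarrow> real) \<Rightarrow> nat \<Rightarrow> nat list" where
  "qstate \<omega> t = map (\<lambda>i. nat (qtasep q u a \<nu> Np Tp \<omega> t i + int i)) [1..<Suc n]"

lemma qtasep_nonneg: "0 \<le> qtasep q u a \<nu> Np Tp \<omega> t i + int i"
proof (induction t arbitrary: i)
  case (Suc t)
  have "qtasep q u a \<nu> Np Tp \<omega> t i \<le> qtasep q u a \<nu> Np Tp \<omega> (Suc t) i"
    by (simp add: Let_def bern_move_def geom_move_def)
  then show ?case using Suc[of i] by linarith
qed simp

lemma qstate_Suc: "qstate \<omega> (Suc t) = qstep t (qstate \<omega> t) \<omega>"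
proof -
  define x where "x = qtasep q u a \<nu> Np Tp \<omega> t"
  define y where "y k = nat (x k + int k)" for k
  have xy: "x k = int (y k) - int k" for k using qtasep_nonneg[of \<omega> t k] by (simp add: y_def x_def)
  have qs: "qstate \<omega> t = map y [1..<Suc n]" by (simp add: qstate_def y_def[abs_def] x_def)
  show ?thesis
  proof (cases "Tp (Suc t) = Tp t + 1")
    case True
    have "qstep t (qstate \<omega> t) \<omega> = map (\<lambda>k. y k + of_bool (bjumped q a (- u (Tp (Suc t))) x (\<lambda>k. \<omega> (t, k)) k)) [1..<Suc n]"
      using True dscan_bern[of x y 1 n 1 0 "- u (Tp (Suc t))" "\<lambda>k. \<omega> (t, k)"] xy
      by (simp add: qstep_def qs)
    also have "\<dots> = qstate \<omega> (Suc t)"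
      using True unfolding qstate_def
      by (intro map_cong refl) (simp add: Let_def bern_move_def x_def[symmetric] xy nat_add_distrib)
    finally show ?thesis by simp
  next
    case False
    define zs where "zs = dscan (dj (cc (Np (Suc t))) (Suc n)) 1 0 0 (map y [1..<Suc n]) (\<lambda>k. \<omega> (t, k))"
    have g: "map (\<lambda>k. geom_move q a (cc (Np (Suc t))) x (\<lambda>k. \<omega> (t, k)) k) [1..<Suc n] =
      map2 (\<lambda>k z. int z - int k) [1..<Suc n] zs"
      unfolding zs_def by (rule dscan_geom) (use xy in auto)
    have len: "length zs = n" by (simp add: zs_def length_dscan)
    have "qstate \<omega> (Suc t) ! i = zs ! i" if "i < n" for i
      using arg_cong[OF g, of "\<lambda>l. l ! i"] that False len
      by (simp add: qstate_def Let_def x_def[symmetric] del: upt_Suc)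
    then have "qstate \<omega> (Suc t) = zs"
      using len by (intro nth_equalityI) (auto simp: qstate_def simp del: upt_Suc)
    then show ?thesis using False by (simp add: qstep_def qs zs_def)
  qed
qed

lemma qstate_0: "qstate \<omega> 0 = replicate n 0"
  by (simp add: qstate_def map_replicate_const del: upt_Suc)

lemma qtasep_path:
  "map (\<lambda>t. qtasep q u a \<nu> Np Tp \<omega> t (Np t) + int (Np t)) [0..<Suc M] =
    0 # map int (dpath Np qstep 0 M (replicate n 0) \<omega>)"
proof -
  have e: "qtasep q u a \<nu> Np Tp \<omega> t (Np t) + int (Np t) = int (qstate \<omega> t ! (Np t - 1))" if "t \<le> M" for t
    using Np_ge_1[OF that] Np_le_n[OF that] qtasep_nonneg[of \<omega> t "Np t"]
    by (simp add: qstate_def del: upt_Suc)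
  have up: "[0..<Suc M] = 0 # [Suc 0..<Suc M]" by (rule upt_conv_Cons) simp
  have "dpath Np qstep 0 M (qstate \<omega> 0) \<omega> = map (\<lambda>s. qstate \<omega> s ! (Np s - 1)) [Suc 0..<Suc (0 + M)]"
    by (rule dpath_trajectory) (rule qstate_Suc)
  then show ?thesis unfolding up qstate_0 using e
    by (simp add: path_0 comp_def del: upt_Suc)
qed

lemma samples_qpath:
  "samples (\<Union>s\<in>{0..<0 + M}. (Pair s) ` {1..}) (dpath Np qstep 0 M (replicate n 0))
    (path_law Np Tp (\<lambda>N T. Vm (- u T) (\<lambda>_. 0)) Gm 0 M (replicate n 0))"
proof (rule samples_dpath)
  fix s :: nat and x assume s: "s < 0 + M"
  show "samples (Pair s ` {1..}) (qstep s x) (if Tp (Suc s) = Tp s + 1 then Vm (- u (Tp (Suc s))) (\<lambda>_. 0) x else Gm (Np (Suc s)) x)"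
  proof (cases "Tp (Suc s) = Tp s + 1")
    case True
    have "samples (Pair s ` {1..}) (\<lambda>\<omega>. dscan (dv (- u (Tp (Suc s))) (\<lambda>_. 0)) 1 0 1 x (\<lambda>k. \<omega> (s, k))) (Vm (- u (Tp (Suc s))) (\<lambda>_. 0) x)"
      by (rule samples_dscan) (use u[of "Tp (Suc s)"] True in \<open>auto intro!: unif_law_dv simp: inj_def\<close>)
    then show ?thesis using True by (simp add: qstep_def[abs_def])
  next
    case False
    then have "Np (Suc s) = Np s + 1" using path_step_disj[of s] s by auto
    then have "2 \<le> Np (Suc s)" using Np_ge_1[of s] s by simp
    then have "samples (Pair s ` {1..}) (\<lambda>\<omega>. dscan (dj (cc (Np (Suc s))) (Suc n)) 1 0 0 x (\<lambda>k. \<omega> (s, k))) (Gm (Np (Suc s)) x)"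
      by (intro samples_dscan unif_law_dj geom_ok_cc) (auto simp: inj_def)
    then show ?thesis using False by (simp add: qstep_def[abs_def])
  qed
qed auto

end

section \<open>The vertex model as a function of uniform variables\<close>

declare vout.simps [simp del]

lemma vout_0: "vout q u a \<nu> \<omega> 0 T = (0, 0)" "vout q u a \<nu> \<omega> N 0 = (0, 0)"
  by (subst vout.simps, simp)+

lemma snd_vout_le_1: "snd (vout q u a \<nu> \<omega> N T) \<le> 1"
  by (subst vout.simps) (simp add: Let_def)

text \<open>For i = j = 0 the truncated \<open>i + j - 1\<close> is 0, arrow conservation fails and
  the weight is 0; the formula agrees because 1 - q^0 = 0.\<close>

lemma Lw_right_exit:
  assumes "j \<le> 1"
  shows "Lw q u a \<nu> i j (i + j - 1) 1 = (if j = 0 then - a * u * (1 - q ^ i) else \<nu> * q ^ i - a * u) / (1 - a * u)"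
  using assms by (cases "j = 0"; cases "i = 0") (auto simp: Lw_def)

context mixed_system
begin

abbreviation vo :: "(nat \<times> nat \<Rightarrow> real) \<Rightarrow> nat \<Rightarrow> nat \<Rightarrow> nat \<times> nat" where
  "vo \<equiv> vout q u a \<nu>"

definition vin :: "(nat \<times> nat \<Rightarrow> real) \<Rightarrow> nat \<Rightarrow> nat \<Rightarrow> nat" where
  "vin \<omega> N T = (if N = 1 then 1 else snd (vo \<omega> (N - 1) T))"

lemma vo_Suc:
  assumes "1 \<le> N"
  shows "vo \<omega> N (Suc T) =
    (if \<omega> (N, Suc T) < vprob (- u (Suc T)) \<nu> N (fst (vo \<omega> N T)) (vin \<omega> N (Suc T))
     then (fst (vo \<omega> N T) + vin \<omega> N (Suc T) - 1, 1) else (fst (vo \<omega> N T) + vin \<omega> N (Suc T), 0))"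
proof -
  have "vin \<omega> N (Suc T) \<le> 1" using snd_vout_le_1 by (simp add: vin_def)
  from Lw_right_exit[OF this, of q "u (Suc T)" "a N" "\<nu> N" "fst (vo \<omega> N T)"]
  show ?thesis using assms
    by (subst vout.simps) (simp add: Let_def vin_def vprob_def)
qed

text \<open>The arrows crossing from column N to column N + 1 in the rows up to T: a finite sum that
  takes the role of y_N and replaces the infinite one in \<open>hBer\<close>.\<close>

definition hgt :: "(nat \<times> nat \<Rightarrow> real) \<Rightarrow> nat \<Rightarrow> nat \<Rightarrow> nat" where
  "hgt \<omega> N T = (\<Sum>s\<in>{1..T}. snd (vo \<omega> N s))"

lemma hgt_0: "hgt \<omega> N 0 = 0"
  by (simp add: hgt_def)

lemma hgt_Suc: "hgt \<omega> N (Suc T) = hgt \<omega> N T + snd (vo \<omega> N (Suc T))"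
  by (simp add: hgt_def)

text \<open>Nonnegativity of \<open>\<omega>\<close> excludes a right exit from a vertex without incoming arrows, which has weight \<open>0\<close>.\<close>

lemma vo_conserve:
  assumes "1 \<le> N" "\<And>k. 0 \<le> \<omega> k"
  shows "fst (vo \<omega> N (Suc T)) + snd (vo \<omega> N (Suc T)) = fst (vo \<omega> N T) + vin \<omega> N (Suc T)"
proof (cases "fst (vo \<omega> N T) + vin \<omega> N (Suc T) = 0")
  case True
  then have "vprob (- u (Suc T)) \<nu> N (fst (vo \<omega> N T)) (vin \<omega> N (Suc T)) = 0" by (simp add: vprob_def)
  then show ?thesis using assms(2)[of "(N, Suc T)"] True by (subst (1 2) vo_Suc[OF assms(1)]) simp
next
  case False
  then show ?thesis by (subst (1 2) vo_Suc[OF assms(1)]) auto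
qed

text \<open>Conservation summed up a column: nothing enters from below, so the arrows that came from
  the left have gone right or sit on the top edge.\<close>

lemma fst_vo:
  assumes "2 \<le> N" "\<And>k. 0 \<le> \<omega> k"
  shows "fst (vo \<omega> N T) + hgt \<omega> N T = hgt \<omega> (N - 1) T"
proof (induction T)
  case 0
  then show ?case by (simp add: hgt_0 vout_0)
next
  case (Suc T)
  then show ?case using vo_conserve[of N \<omega> T] assms by (simp add: hgt_Suc vin_def)
qed

text \<open>By \<open>fst_vo\<close> the difference of neighbouring heights is the number of
  vertical arrows. At i = 1 the boundary arrow gives b = 1, and \<nu> 1 = 0 makes the dummy p
  harmless.\<close>

lemma dscan_vertex:
  assumes "\<And>k. 0 \<le> \<omega> k" "1 \<le> i" "i \<le> Suc n"
    and "b = vin \<omega> i (Suc T)" "i \<noteq> 1 \<Longrightarrow> p = hgt \<omega> (i - 1) T"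
  shows "dscan (dv (- u (Suc T)) (\<nu>_on 1 n)) i p b (map (\<lambda>N. hgt \<omega> N T) [i..<Suc n]) (\<lambda>N. \<omega> (N, Suc T)) =
     map (\<lambda>N. hgt \<omega> N (Suc T)) [i..<Suc n]"
  using assms(2-)
proof (induction "Suc n - i" arbitrary: i p b)
  case 0
  then show ?case by simp
next
  case (Suc m)
  then have i: "i < Suc n" by simp
  then have up: "[i..<Suc n] = i # [Suc i..<Suc n]" by (rule upt_conv_Cons)
  have "vprob (- u (Suc T)) (\<nu>_on 1 n) i (p - hgt \<omega> i T) b = vprob (- u (Suc T)) \<nu> i (fst (vo \<omega> i T)) (vin \<omega> i (Suc T))"
  proof (cases "i = 1")
    case True
    then show ?thesis using Suc.prems \<nu>_1 by (simp add: vprob_def vin_def \<nu>_on_def)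
  next
    case False
    then have "p - hgt \<omega> i T = fst (vo \<omega> i T)"
      using fst_vo[of i \<omega> T] assms(1) Suc.prems by simp
    moreover have "\<nu>_on 1 n i = \<nu> i" using False Suc.prems i by (simp add: \<nu>_on_def)
    ultimately show ?thesis using Suc.prems(3) by (simp add: vprob_def)
  qed
  then have j: "dv (- u (Suc T)) (\<nu>_on 1 n) i p b (hgt \<omega> i T) (\<omega> (i, Suc T)) = snd (vo \<omega> i (Suc T))"
    using vo_Suc[OF Suc.prems(1), of \<omega> T] by (simp add: dv_def)
  have "dscan (dv (- u (Suc T)) (\<nu>_on 1 n)) (Suc i) (hgt \<omega> i T) (snd (vo \<omega> i (Suc T)))
      (map (\<lambda>N. hgt \<omega> N T) [Suc i..<Suc n]) (\<lambda>N. \<omega> (N, Suc T)) = map (\<lambda>N. hgt \<omega> N (Suc T)) [Suc i..<Suc n]"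
    using Suc.hyps(2) Suc.prems(1) i by (intro Suc.hyps(1)) (auto simp: vin_def)
  then show ?case unfolding up list.map dscan.simps j by (simp add: hgt_Suc del: upt_Suc)
qed

text \<open>A step in the N direction leaves the vertex model alone and changes only the recorded
  column.\<close>

definition vstep :: "nat \<Rightarrow> nat list \<Rightarrow> (nat \<times> nat \<Rightarrow> real) \<Rightarrow> nat list" where
  "vstep t xs \<omega> = (if Tp (Suc t) = Tp t + 1
     then dscan (dv (- u (Tp (Suc t))) (\<nu>_on 1 n)) 1 0 1 xs (\<lambda>N. \<omega> (N, Tp (Suc t))) else xs)"

definition vstate :: "(nat \<times> nat \<Rightarrow> real) \<Rightarrow> nat \<Rightarrow> nat list" where
  "vstate \<omega> t = map (\<lambda>N. hgt \<omega> N (Tp t)) [1..<Suc n]"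

lemma vstate_Suc:
  assumes "\<And>k. 0 \<le> \<omega> k" "t < M"
  shows "vstate \<omega> (Suc t) = vstep t (vstate \<omega> t) \<omega>"
proof (cases "Tp (Suc t) = Tp t + 1")
  case True
  have "dscan (dv (- u (Suc (Tp t))) (\<nu>_on 1 n)) 1 0 1 (map (\<lambda>N. hgt \<omega> N (Tp t)) [1..<Suc n]) (\<lambda>N. \<omega> (N, Suc (Tp t))) =
     map (\<lambda>N. hgt \<omega> N (Suc (Tp t))) [1..<Suc n]"
    by (rule dscan_vertex) (use assms in \<open>auto simp: vin_def\<close>)
  then show ?thesis using True by (simp add: vstep_def vstate_def del: upt_Suc)
next
  case False
  then have "Tp (Suc t) = Tp t" using path_step_disj[OF assms(2)] by auto
  then show ?thesis by (simp add: vstep_def vstate_def)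
qed

lemma hgt_path:
  assumes "\<And>k. 0 \<le> \<omega> k"
  shows "map (\<lambda>t. hgt \<omega> (Np t) (Tp t)) [0..<Suc M] = 0 # dpath Np vstep 0 M (replicate n 0) \<omega>"
proof -
  have e: "hgt \<omega> (Np t) (Tp t) = vstate \<omega> t ! (Np t - 1)" if "t \<le> M" for t
  proof -
    have "[1..<Suc n] ! (Np t - 1) = Np t" "Np t - 1 < length [1..<Suc n]"
      using Np_ge_1[OF that] Np_le_n[OF that] by (auto simp del: upt_Suc)
    then show ?thesis by (simp only: vstate_def nth_map)
  qed
  have up: "[0..<Suc M] = 0 # [Suc 0..<Suc M]" by (rule upt_conv_Cons) simp
  have "vstate \<omega> 0 = replicate n 0"
    by (simp add: vstate_def path_0 hgt_0 map_replicate_const del: upt_Suc)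
  moreover have "dpath Np vstep 0 M (vstate \<omega> 0) \<omega> = map (\<lambda>s. vstate \<omega> s ! (Np s - 1)) [Suc 0..<Suc (0 + M)]"
    by (rule dpath_trajectory) (use vstate_Suc[OF assms] in auto)
  ultimately show ?thesis unfolding up using e
    by (simp add: path_0 hgt_0 del: upt_Suc)
qed

lemma Tp_mono: "s \<le> t \<Longrightarrow> t \<le> M \<Longrightarrow> Tp s \<le> Tp t"
proof (induction rule: dec_induct)
  case (step k)
  then have "Tp k \<le> Tp (Suc k)" using path_step_disj[of k] by auto
  then show ?case using step by simp
qed simp

lemma samples_vpath:
  "samples (\<Union>s\<in>{0..<0 + M}. if Tp (Suc s) = Tp s + 1 then (\<lambda>N. (N, Tp (Suc s))) ` {1..} else {})
    (dpath Np vstep 0 M (replicate n 0))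
    (path_law Np Tp (\<lambda>N T. Vm (- u T) (\<nu>_on 1 n)) (\<lambda>N. return_pmf) 0 M (replicate n 0))"
proof (rule samples_dpath)
  fix s :: nat and x
  show "samples (if Tp (Suc s) = Tp s + 1 then (\<lambda>N. (N, Tp (Suc s))) ` {1..} else {}) (vstep s x)
    (if Tp (Suc s) = Tp s + 1 then Vm (- u (Tp (Suc s))) (\<nu>_on 1 n) x else return_pmf x)"
  proof (cases "Tp (Suc s) = Tp s + 1")
    case True
    have "samples ((\<lambda>N. (N, Tp (Suc s))) ` {1..})
       (\<lambda>\<omega>. dscan (dv (- u (Tp (Suc s))) (\<nu>_on 1 n)) 1 0 1 x (\<lambda>N. \<omega> (N, Tp (Suc s)))) (Vm (- u (Tp (Suc s))) (\<nu>_on 1 n) x)"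
      by (rule samples_dscan)
        (use u[of "Tp (Suc s)"] \<nu>_on_bounds[of 1 n] True in \<open>auto intro!: unif_law_dv simp: inj_def\<close>)
    then show ?thesis using True by (simp add: vstep_def[abs_def])
  next
    case False
    then show ?thesis by (simp add: vstep_def[abs_def] samples_return)
  qed
next
  fix s s' :: nat assume s: "s < s'" "s' < 0 + M"
  \<comment> \<open>Between two upward steps T strictly increases, so they read different rows of
    \<omega>.\<close>
  have "Tp (Suc s) \<le> Tp s'" using s by (intro Tp_mono) auto
  then show "(if Tp (Suc s) = Tp s + 1 then (\<lambda>N. (N, Tp (Suc s))) ` {1..} else {}) \<inter>
     (if Tp (Suc s') = Tp s' + 1 then (\<lambda>N. (N, Tp (Suc s'))) ` {1..} else {}) = {}"
    by auto
qed

end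

section \<open>No arrow escapes to infinity\<close>

lemma AE_coord_nonneg: "AE \<omega> in unifOmega. \<forall>k. 0 \<le> \<omega> k"
proof -
  have "AE \<omega> in unifOmega. 0 \<le> \<omega> k" for k
  proof -
    have "AE v in distr unifOmega unif (\<lambda>\<omega>. \<omega> k). 0 \<le> v"
      unfolding distr_coord by (rule AE_uniform_measureI) auto
    from AE_distrD[OF _ this] show ?thesis
      using measurable_coord by (simp cong: measurable_cong_sets)
  qed
  then show ?thesis by (simp add: AE_all_countable)
qed

text \<open>For every k the exceptional event lies in the event that k given independent coordinates
  are below c, of probability c^k.\<close>

lemma AE_coord_ge_infinitely_often:
  assumes c: "0 \<le> c" "c < 1"
  shows "AE \<omega> in unifOmega. \<forall>m. \<exists>N\<ge>m. c \<le> \<omega> (N, T)"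
proof -
  have "AE \<omega> in unifOmega. \<exists>N\<ge>m. c \<le> \<omega> (N, T)" for m
  proof -
    have sets: "{\<omega> \<in> space unifOmega. \<forall>N\<ge>m. \<omega> (N, T) < c} \<in> sets unifOmega"
      by measurable
    have le: "emeasure unifOmega {\<omega> \<in> space unifOmega. \<forall>N\<ge>m. \<omega> (N, T) < c} \<le> ennreal (c ^ k)" for k
    proof -
      define J where "J = (\<lambda>N. (N, T)) ` {m..<m + k}"
      have "emeasure unifOmega {\<omega> \<in> space unifOmega. \<forall>N\<ge>m. \<omega> (N, T) < c}
         \<le> emeasure unifOmega {\<omega> \<in> space unifOmega. \<forall>i\<in>J. \<omega> i \<in> {..<c}}"
      proof (rule emeasure_mono)
        have "finite J" by (simp add: J_def)
        then show "{\<omega> \<in> space unifOmega. \<forall>i\<in>J. \<omega> i \<in> {..<c}} \<in> sets unifOmega" by measurable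
      qed (auto simp: J_def)
      also have "\<dots> = (\<Prod>i\<in>J. emeasure unif {..<c})"
        unfolding unifOmega_def by (rule unif_product.emeasure_PiM_Collect) (auto simp: J_def)
      also have "emeasure unif {..<c} = ennreal c"
      proof -
        have "{0..1} \<inter> {..<c} = {0..<c}" using c by auto
        then show ?thesis using c by (subst emeasure_uniform_measure) (auto simp: divide_ennreal_def)
      qed
      also have "(\<Prod>i\<in>J. ennreal c) = ennreal (c ^ k)"
        using c by (simp add: J_def card_image inj_on_def ennreal_power)
      finally show ?thesis .
    qed
    have "(\<lambda>k. ennreal (c ^ k)) \<longlonglongrightarrow> ennreal 0"
      using c by (intro tendsto_ennrealI LIMSEQ_realpow_zero)
    then have "emeasure unifOmega {\<omega> \<in> space unifOmega. \<forall>N\<ge>m. \<omega> (N, T) < c} \<le> ennreal 0"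
      by (rule LIMSEQ_le_const) (use le in auto)
    then have "{\<omega> \<in> space unifOmega. \<forall>N\<ge>m. \<omega> (N, T) < c} \<in> null_sets unifOmega"
      using sets by (auto simp: null_sets_def)
    then show ?thesis
    proof (rule AE_I')
      show "{\<omega> \<in> space unifOmega. \<not> (\<exists>N\<ge>m. c \<le> \<omega> (N, T))} \<subseteq> {\<omega> \<in> space unifOmega. \<forall>N\<ge>m. \<omega> (N, T) < c}"
        using not_le by blast
    qed
  qed
  then show ?thesis by (simp add: AE_all_countable)
qed

context mixed_system
begin

text \<open>Far to the right the previous row is empty by induction. There a horizontal arrow
  survives column N only if \<omega> lies below a threshold of at most c T, so it stops at the
  latest where \<omega> reaches c T, and nothing passes beyond.\<close>

lemma vo_eventually_0:
  assumes pos: "\<And>k. 0 \<le> \<omega> k"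
    and c: "\<And>T N. 2 \<le> N \<Longrightarrow> vprob (- u (Suc T)) \<nu> N 0 1 \<le> c T"
    and io: "\<And>T m. \<exists>N\<ge>m. c T \<le> \<omega> (N, Suc T)"
  shows "\<exists>m\<ge>2. \<forall>x\<ge>m. hgt \<omega> x T = 0 \<and> fst (vo \<omega> x T) = 0"
proof (induction T)
  case 0
  then show ?case by (auto simp: hgt_0 vout_0)
next
  case (Suc T)
  then obtain m where m: "2 \<le> m" "\<And>x. m \<le> x \<Longrightarrow> hgt \<omega> x T = 0 \<and> fst (vo \<omega> x T) = 0" by auto
  obtain N where N: "m \<le> N" "c T \<le> \<omega> (N, Suc T)" using io by blast
  have z: "vprob (- u (Suc T)) \<nu> x 0 0 = 0" for x by (simp add: vprob_def)
  have "vin \<omega> N (Suc T) \<le> 1" using snd_vout_le_1 by (simp add: vin_def)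
  then consider "vin \<omega> N (Suc T) = 0" | "vin \<omega> N (Suc T) = 1" by linarith
  then have "\<not> \<omega> (N, Suc T) < vprob (- u (Suc T)) \<nu> N (fst (vo \<omega> N T)) (vin \<omega> N (Suc T))"
    using m N c[of N T] pos[of "(N, Suc T)"] by cases (auto simp: z)
  then have sN: "snd (vo \<omega> N (Suc T)) = 0" using vo_Suc[of N \<omega> T] m(1) N(1) by simp
  have s: "snd (vo \<omega> x (Suc T)) = 0 \<and> (x \<noteq> N \<longrightarrow> fst (vo \<omega> x (Suc T)) = 0)" if "N \<le> x" for x
    using that
  proof (induction x rule: dec_induct)
    case base
    then show ?case using sN by simp
  next
    case (step x)
    have "vin \<omega> (Suc x) (Suc T) = 0" using step m(1) N(1) by (simp add: vin_def)
    then show ?case using vo_Suc[of "Suc x" \<omega> T] m(2)[of "Suc x"] N(1) step pos[of "(Suc x, Suc T)"] by (simp add: z)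
  qed
  \<comment> \<open>The stopped arrow may go up in column N itself, so the bound becomes N +
    1.\<close>
  have "hgt \<omega> x (Suc T) = 0 \<and> fst (vo \<omega> x (Suc T)) = 0" if "Suc N \<le> x" for x
    using s[of x] m(2)[of x] that N(1) by (simp add: hgt_Suc)
  then show ?case using m(1) N(1) by (intro exI[of _ "Suc N"]) auto
qed

text \<open>The vertical arrows telescope by \<open>fst_vo\<close>, and the current far to the right
  is 0.\<close>

lemma hBer_eq_hgt:
  assumes pos: "\<And>k. 0 \<le> \<omega> k" and N: "1 \<le> N"
    and m: "\<And>x. m \<le> x \<Longrightarrow> hgt \<omega> x T = 0 \<and> fst (vo \<omega> x T) = 0"
  shows "hBer q u a \<nu> \<omega> (N + 1) T = hgt \<omega> N T"
proof -
  define m' where "m' = N + 1 + m"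
  have "hBer q u a \<nu> \<omega> (N + 1) T = (\<Sum>x\<in>{N + 1..<m'}. fst (vo \<omega> x T))"
    unfolding hBer_def
  proof (rule sum.mono_neutral_left)
    show "{x. N + 1 \<le> x \<and> 0 < fst (vo \<omega> x T)} \<subseteq> {N + 1..<m'}"
    proof
      fix x assume x: "x \<in> {x. N + 1 \<le> x \<and> 0 < fst (vo \<omega> x T)}"
      then have "\<not> m \<le> x" using m[of x] by auto
      then show "x \<in> {N + 1..<m'}" using x by (simp add: m'_def)
    qed
  qed auto
  moreover have "(\<Sum>x\<in>{N + 1..<N + 1 + k}. fst (vo \<omega> x T)) + hgt \<omega> (N + k) T = hgt \<omega> N T" for k
  proof (induction k)
    case (Suc k)
    have "fst (vo \<omega> (N + Suc k) T) + hgt \<omega> (N + Suc k) T = hgt \<omega> (N + k) T"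
      using fst_vo[of "N + Suc k" \<omega> T] pos N by simp
    then show ?case using Suc by simp
  qed simp
  from this[of m] have "(\<Sum>x\<in>{N + 1..<m'}. fst (vo \<omega> x T)) + hgt \<omega> (N + m) T = hgt \<omega> N T"
    by (simp add: m'_def)
  moreover have "hgt \<omega> (N + m) T = 0" using m[of "N + m"] by simp
  ultimately show ?thesis by simp
qed

end

section \<open>Measurability of the arrow counts\<close>

lemma measurable_vout [measurable]:
  "(\<lambda>\<omega>. vout q u a \<nu> \<omega> N T) \<in> unifOmega \<rightarrow>\<^sub>M count_space UNIV"
proof (induction "N + T" arbitrary: N T rule: less_induct)
  case less
  show ?case
  proof (cases "N = 0 \<or> T = 0")
    case True
    then show ?thesis by (auto simp: vout_0)
  next
    case False
    have [measurable]: "(\<lambda>\<omega>. vout q u a \<nu> \<omega> N (T - 1)) \<in> unifOmega \<rightarrow>\<^sub>M count_space UNIV"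
      "(\<lambda>\<omega>. vout q u a \<nu> \<omega> (N - 1) T) \<in> unifOmega \<rightarrow>\<^sub>M count_space UNIV"
      using False by (auto intro!: less)
    define F where "F p \<omega> = (let i1 = fst (fst p); j1 = (if N = 1 then 1 else snd (snd p))
       in if \<omega> (N, T) < Lw q (u T) (a N) (\<nu> N) i1 j1 (i1 + j1 - 1) 1 then (i1 + j1 - 1, 1 :: nat) else (i1 + j1, 0))"
      for p :: "(nat \<times> nat) \<times> (nat \<times> nat)" and \<omega> :: "nat \<times> nat \<Rightarrow> real"
    have "(\<lambda>\<omega>. F (vout q u a \<nu> \<omega> N (T - 1), vout q u a \<nu> \<omega> (N - 1) T) \<omega>) \<in> unifOmega \<rightarrow>\<^sub>M count_space UNIV"
    proof (rule measurable_compose_countable[where f = F])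
      show "F p \<in> unifOmega \<rightarrow>\<^sub>M count_space UNIV" for p
        unfolding F_def[abs_def] Let_def by measurable
      show "(\<lambda>\<omega>. (vout q u a \<nu> \<omega> N (T - 1), vout q u a \<nu> \<omega> (N - 1) T)) \<in> unifOmega \<rightarrow>\<^sub>M count_space UNIV"
        by measurable
    qed
    moreover have "vout q u a \<nu> \<omega> N T = F (vout q u a \<nu> \<omega> N (T - 1), vout q u a \<nu> \<omega> (N - 1) T) \<omega>" for \<omega>
      using False by (subst vout.simps) (simp add: F_def)
    ultimately show ?thesis by simp
  qed
qed

text \<open>A sum over an infinite set is 0, so the cases are whether the occupied columns are
  bounded. If they are, the sum runs up to an integer-valued random bound, which countable
  composition handles.\<close>

lemma measurable_hBer:
  "(\<lambda>\<omega>. hBer q u a \<nu> \<omega> N T) \<in> unifOmega \<rightarrow>\<^sub>M count_space UNIV"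
proof -
  define f where "f x \<omega> = fst (vout q u a \<nu> \<omega> x T)" for x \<omega>
  have f [measurable]: "f x \<in> unifOmega \<rightarrow>\<^sub>M count_space UNIV" for x
    unfolding f_def by (rule measurable_compose[OF measurable_vout]) simp
  define g where "g m \<omega> = (\<Sum>x\<in>{N..<m}. f x \<omega>)" for m \<omega>
  have g [measurable]: "g m \<in> unifOmega \<rightarrow>\<^sub>M count_space UNIV" for m
  proof (induction m)
    case 0
    then show ?case by (simp add: g_def[abs_def])
  next
    case (Suc m)
    have "g (Suc m) = (\<lambda>\<omega>. if N \<le> m then g m \<omega> + f m \<omega> else 0)"
      by (auto simp: g_def fun_eq_iff)
    then show ?case using Suc by simp
  qed
  define L where "L \<omega> = (LEAST m. \<forall>x\<ge>m. f x \<omega> = 0)" for \<omega>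
  have L [measurable]: "L \<in> unifOmega \<rightarrow>\<^sub>M count_space UNIV"
    unfolding L_def[abs_def] by measurable
  have gL [measurable]: "(\<lambda>\<omega>. g (L \<omega>) \<omega>) \<in> unifOmega \<rightarrow>\<^sub>M count_space UNIV"
    by (rule measurable_compose_countable[OF g L])
  have "(\<lambda>\<omega>. if \<exists>m. \<forall>x\<ge>m. f x \<omega> = 0 then g (L \<omega>) \<omega> else 0) \<in> unifOmega \<rightarrow>\<^sub>M count_space UNIV"
    by measurable
  moreover have "hBer q u a \<nu> \<omega> N T = (if \<exists>m. \<forall>x\<ge>m. f x \<omega> = 0 then g (L \<omega>) \<omega> else 0)" for \<omega>
  proof (cases "\<exists>m. \<forall>x\<ge>m. f x \<omega> = 0")
    case True
    then have L0: "\<forall>x\<ge>L \<omega>. f x \<omega> = 0" unfolding L_def by (rule LeastI_ex)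
    have "hBer q u a \<nu> \<omega> N T = g (L \<omega>) \<omega>"
      unfolding hBer_def g_def f_def[symmetric]
    proof (rule sum.mono_neutral_left)
      show "{x. N \<le> x \<and> 0 < f x \<omega>} \<subseteq> {N..<L \<omega>}"
      proof
        fix x assume x: "x \<in> {x. N \<le> x \<and> 0 < f x \<omega>}"
        then have "\<not> L \<omega> \<le> x" using L0 by auto
        then show "x \<in> {N..<L \<omega>}" using x by simp
      qed
    qed auto
    then show ?thesis using True by simp
  next
    case False
    have "infinite {x. N \<le> x \<and> 0 < f x \<omega>}"
      unfolding infinite_nat_iff_unbounded_le
    proof
      fix m
      obtain x where "max m N \<le> x" "f x \<omega> \<noteq> 0" using False by blast
      then show "\<exists>x\<ge>m. x \<in> {x. N \<le> x \<and> 0 < f x \<omega>}" by auto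
    qed
    then show ?thesis unfolding if_not_P[OF False] by (simp add: hBer_def f_def[symmetric])
  qed
  ultimately show ?thesis by simp
qed

section \<open>The joint distributions\<close>

theorem theorem5p14:
  fixes q :: real and u a \<nu> :: "nat \<Rightarrow> real" and Np Tp :: "nat \<Rightarrow> nat" and M :: nat
  assumes "0 < q" and "q < 1"
    and "\<forall>T\<ge>1. u T < 0"
    and "\<exists>lo hi. 0 < lo \<and> (\<forall>N\<ge>1. lo \<le> a N \<and> a N \<le> hi)"
    and "\<nu> 1 = 0"
    and "\<exists>lo hi. 0 < lo \<and> hi < 1 \<and> (\<forall>N\<ge>2. lo \<le> \<nu> N \<and> \<nu> N \<le> hi)"
    and "\<forall>i\<ge>1. \<forall>j\<ge>1. a i * (\<nu> j / a j) < 1"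
    and "timelike_path Np Tp M"
  shows "(\<lambda>\<omega>. map (\<lambda>t. int (hBer q u a \<nu> \<omega> (Np t + 1) (Tp t))) [0..<Suc M])
           \<in> unifOmega \<rightarrow>\<^sub>M count_space UNIV
       \<and> (\<lambda>\<omega>. map (\<lambda>t. qtasep q u a \<nu> Np Tp \<omega> t (Np t) + int (Np t)) [0..<Suc M])
           \<in> unifOmega \<rightarrow>\<^sub>M count_space UNIV
       \<and> distr unifOmega (count_space UNIV)
           (\<lambda>\<omega>. map (\<lambda>t. int (hBer q u a \<nu> \<omega> (Np t + 1) (Tp t))) [0..<Suc M])
         = distr unifOmega (count_space UNIV)
           (\<lambda>\<omega>. map (\<lambda>t. qtasep q u a \<nu> Np Tp \<omega> t (Np t) + int (Np t)) [0..<Suc M])"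
proof -
  obtain alo ahi where a: "0 < alo" "\<And>N. 1 \<le> N \<Longrightarrow> alo \<le> a N \<and> a N \<le> ahi" using assms(4) by blast
  obtain nlo nhi where nu: "0 < nlo" "nhi < 1" "\<And>N. 2 \<le> N \<Longrightarrow> nlo \<le> \<nu> N \<and> \<nu> N \<le> nhi" using assms(6) by blast
  have a_pos: "0 < a N" if "1 \<le> N" for N using a(1) a(2)[OF that] by linarith
  interpret mixed_system q a u \<nu> Np Tp M "Np M"
  proof
    show "0 < \<nu> N" "\<nu> N < 1" if "2 \<le> N" for N using nu(1,2) nu(3)[OF that] by linarith+
  qed (use assms a_pos in auto)
  let ?h = "\<lambda>\<omega>. map (\<lambda>t. int (hBer q u a \<nu> \<omega> (Np t + 1) (Tp t))) [0..<Suc M]"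
  let ?x = "\<lambda>\<omega>. map (\<lambda>t. qtasep q u a \<nu> Np Tp \<omega> t (Np t) + int (Np t)) [0..<Suc M]"
  \<comment> \<open>At time 0 both observables are 0, and \<open>path_law\<close> starts recording
    at time 1.\<close>
  let ?ext = "\<lambda>xs :: nat list. 0 # map int xs"
  define law where "law = map_pmf ?ext (path_law Np Tp (\<lambda>N T. Vm (- u T) (\<nu>_on 1 (Np M))) (\<lambda>N. return_pmf) 0 M (replicate (Np M) 0))"
  have sx: "samples (\<Union>s\<in>{0..<0 + M}. (Pair s) ` {1..}) ?x law"
    unfolding qtasep_path law_def path_law_eq[symmetric] by (rule samples_map[OF samples_qpath])
  define D where "D = (\<lambda>\<omega>. ?ext (dpath Np vstep 0 M (replicate (Np M) 0) \<omega>))"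
  note sv = samples_map[OF samples_vpath, of ?ext, folded law_def D_def]
  have mh: "?h \<in> unifOmega \<rightarrow>\<^sub>M count_space UNIV"
  proof -
    have "(\<lambda>\<omega>. map (\<lambda>t. int (hBer q u a \<nu> \<omega> (Np t + 1) (Tp t))) ts) \<in> unifOmega \<rightarrow>\<^sub>M count_space UNIV" for ts
    proof (induction ts)
      case (Cons t ts)
      note [measurable] = Cons measurable_hBer[of q u a \<nu> "Np t + 1" "Tp t"]
      show ?case unfolding list.map by measurable
    qed simp
    then show ?thesis .
  qed
  \<comment> \<open>A lone arrow entering an empty column N turns up with probability (1 - \<nu> N)
    / (1 - a N u). The upper bounds on \<nu> and a bound this below by the fraction subtracted here,
    uniformly in N.\<close>
  define c where "c T = 1 - (1 - nhi) / (1 - ahi * u (Suc T))" for T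
  have ahi: "0 < ahi" using a(1) a(2)[of 1] by linarith
  have uT: "u (Suc T) < 0" for T using assms(3) by simp
  have den: "1 < 1 - ahi * u (Suc T)" for T using ahi uT[of T] by (simp add: mult_pos_neg)
  have nhi: "0 < nhi" using nu(1) nu(3)[of 2] by linarith
  have c: "0 \<le> c T" "c T < 1" for T
    using den[of T] nu(2) nhi by (auto simp: c_def divide_simps)
  have vc: "vprob (- u (Suc T)) \<nu> N 0 1 \<le> c T" if "2 \<le> N" for T N
  proof -
    have aN: "0 < a N" "a N \<le> ahi" using a(1) a(2)[of N] that by auto
    have aun: "0 < - (a N * u (Suc T))" using aN uT[of T] by (simp add: mult_pos_neg)
    have "vprob (- u (Suc T)) \<nu> N 0 1 = 1 - (1 - \<nu> N) / (1 - a N * u (Suc T))"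
      using aun by (simp add: vprob_def field_simps)
    moreover have "(1 - nhi) / (1 - ahi * u (Suc T)) \<le> (1 - \<nu> N) / (1 - a N * u (Suc T))"
    proof (rule frac_le)
      show "1 - a N * u (Suc T) \<le> 1 - ahi * u (Suc T)"
        using mult_right_mono_neg[of "a N" ahi "u (Suc T)"] aN uT[of T] by simp
    qed (use nu(2) nu(3)[OF that] aun in auto)
    ultimately show ?thesis by (simp add: c_def)
  qed
  have "AE \<omega> in unifOmega. \<forall>T m. \<exists>N\<ge>m. c T \<le> \<omega> (N, Suc T)"
    unfolding AE_all_countable[of "\<lambda>T \<omega>. \<forall>m. \<exists>N\<ge>m. c T \<le> \<omega> (N, Suc T)"]
    by (intro allI AE_coord_ge_infinitely_often c)
  with AE_coord_nonneg have ae: "AE \<omega> in unifOmega. ?h \<omega> = D \<omega>"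
  proof eventually_elim
    case (elim \<omega>)
    then have pos: "\<And>k. 0 \<le> \<omega> k" and io: "\<And>T m. \<exists>N\<ge>m. c T \<le> \<omega> (N, Suc T)" by blast+
    have "hBer q u a \<nu> \<omega> (Np t + 1) (Tp t) = hgt \<omega> (Np t) (Tp t)" if "t \<in> set [0..<Suc M]" for t
    proof -
      obtain m where "\<And>x. m \<le> x \<Longrightarrow> hgt \<omega> x (Tp t) = 0 \<and> fst (vout q u a \<nu> \<omega> x (Tp t)) = 0"
        using vo_eventually_0[of \<omega> c "Tp t", OF pos vc io] by blast
      then show ?thesis using that Np_ge_1[of t] pos by (intro hBer_eq_hgt) auto
    qed
    then have "?h \<omega> = map int (map (\<lambda>t. hgt \<omega> (Np t) (Tp t)) [0..<Suc M])" by (simp del: upt_Suc)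
    then show ?case unfolding hgt_path[of \<omega>, OF pos] D_def by simp
  qed
  have "distr unifOmega (count_space UNIV) ?h = distr unifOmega (count_space UNIV) D"
    by (rule distr_cong_AE) (use ae mh sv in \<open>auto simp: samples_def\<close>)
  also have "\<dots> = distr unifOmega (count_space UNIV) ?x"
    using sx sv by (simp add: samples_def)
  finally show ?thesis using mh sx unfolding samples_def by blast
qed

end
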